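(* Let $k$ be a field and $(G,\alpha)$ an Artin representation on $F_n$. If a left $k[F_n\rtimes_\alpha G]$-module $V$ is $F_n$-irreducible, then $\mathcal{KLM}_\lambda(V)$ is $F_n$-irreducible for any $\lambda\in k^\times$.
   Context: A left $k[F_n\rtimes_\alpha G]$-module $V$ is called $F_n$-irreducible if it has no nontrivial $k[F_n]$-submodule, i.e. no $k[F_n]$-submodule other than $\{0\}$ and $V$ (this definition does not require $V\neq\{0\}$). Let $k$ be a field, $n\ge 2$ an integer, $F_n$ the free group on $x_1,\dots,x_n$, and $B_n$ the Artin braid group with standard generators $\sigma_1,\dots,\sigma_{n-1}$. The map $\theta\colon B_n\to\mathrm{Aut}(F_n)$ is the injective homomorphism with $\theta(\sigma_i)(x_i)=x_{i+1}$, $\theta(\sigma_i)(x_{i+1})=x_{i+1}^{-1}x_ix_{i+1}$, $\theta(\sigma_i)(x_j)=x_j$ for $j\neq i,i+1$. An Artin representation $(G,\alpha)$ on $F_n$ is a group $G$ with a homomorphism $\alpha\colon G\to\mathrm{Aut}(F_n)$ that factors as $\alpha=\theta\circ\alpha_{B_n}$ for some homomorphism $\alpha_{B_n}\colon G\to B_n$. In $F_n\rtimes_\alpha G$ one has $gxg^{-1}=\alpha(g)(x)$. $I_{F_n}\subset k[F_n]$ is the augmentation ideal; it is a free right $k[F_n]$-module with basis $x_1-1,\dots,x_n-1$. For $0\le i\le n$ and $1\le j\le n$ put $\lambda_{\ge i}(j)=\lambda$ if $j\le i$ and $\lambda_{\ge i}(j)=1$ if $j>i$. Let $\circ_\lambda$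 be the left action of $F_n$ on $I_{F_n}$ by right $k[F_n]$-module automorphisms determined by $$x_i\circ_\lambda(x_j-1)=\lambda_{\ge i}(j)\,x_i(x_j-1)-(\lambda_{\ge (i-1)}(j)-1)(x_j-1).$$ $I_{F_n,\lambda}$ denotes $I_{F_n}$ with the left action $\circ_\lambda$ of $F_n$ and the left action of $g\in G$ by $\alpha(g)$; this makes it a left $k[F_n\rtimes_\alpha G]$-module. Put $\mathcal{LM}_\lambda(V)=I_{F_n,\lambda}\otimes_{k[F_n]}V$, with action $x\cdot(f\otimes v)=(x\circ_\lambda f)\otimes v$ for $x\in F_n$ and $g\cdot(f\otimes v)=\alpha(g)(f)\otimes gv$ for $g\in G$. Let $\mathcal{LM}_\lambda(V)^{F_n}$ be the $F_n$-invariants and, for $1\le i\le n$, $\mathcal{LM}_\lambda(V)^{[i]}=\{w\in\mathcal{LM}_\lambda(V)\mid x_iw=\lambda w,\ x_jw=w\text{ for }j\ne i\}$. The sum $\sum_i\mathcal{LM}_\lambda(V)^{[i]}+\mathcal{LM}_\lambda(V)^{F_n}$ is a submodule, and $\mathcal{KLM}_\lambda(V):=\mathcal{LM}_\lambda(V)/(\sum_{i=1}^n\mathcal{LM}_\lambda(V)^{[i]}+\mathcal{LM}_\lambda(V)^{F_n})$. *)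

theory Defs
  imports "HOL-Algebra.Algebra"
begin

section \<open>Free groups and braid groups\<close>

text \<open>A letter \<open>(i, True)\<close> stands for \<open>x\<^sub>i\<close> and \<open>(i, False)\<close> for its inverse; the elements of the
  free group are the reduced words.\<close>

type_synonym 'i gword = "('i \<times> bool) list"

fun cancels :: "'i \<times> bool \<Rightarrow> 'i \<times> bool \<Rightarrow> bool" where
  "cancels (i, s) (j, t) \<longleftrightarrow> i = j \<and> s \<noteq> t"

definition reduced :: "'i gword \<Rightarrow> bool" where
  "reduced w \<longleftrightarrow> successively (\<lambda>a b. \<not> cancels a b) w"

fun push :: "'i \<times> bool \<Rightarrow> 'i gword \<Rightarrow> 'i gword" where
  "push a [] = [a]"
| "push a (b # w) = (if cancels a b then w else a # b # w)"

definition free_group :: "'i set \<Rightarrow> 'i gword monoid" where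
  "free_group I = \<lparr>carrier = {w. reduced w \<and> fst ` set w \<subseteq> I},
     monoid.mult = (\<lambda>u v. foldr push u v), one = []\<rparr>"

definition gen :: "'i \<Rightarrow> 'i gword" where
  "gen i = [(i, True)]"

abbreviation Fn :: "nat \<Rightarrow> nat gword monoid" where
  "Fn n \<equiv> free_group {1..n}"

definition normal_closure :: "('a, 'm) monoid_scheme \<Rightarrow> 'a set \<Rightarrow> 'a set" where
  "normal_closure G S = \<Inter>{N. N \<lhd> G \<and> S \<subseteq> N}"

definition braid_relators :: "nat \<Rightarrow> nat gword set" where
  "braid_relators n = (let F = free_group {1..n - 1} in
     {gen i \<otimes>\<^bsub>F\<^esub> gen j \<otimes>\<^bsub>F\<^esub> inv\<^bsub>F\<^esub> (gen j \<otimes>\<^bsub>F\<^esub> gen i) | i j.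
        i \<in> {1..n - 1} \<and> j \<in> {1..n - 1} \<and> i + 2 \<le> j} \<union>
     {gen i \<otimes>\<^bsub>F\<^esub> gen (i + 1) \<otimes>\<^bsub>F\<^esub> gen i \<otimes>\<^bsub>F\<^esub>
        inv\<^bsub>F\<^esub> (gen (i + 1) \<otimes>\<^bsub>F\<^esub> gen i \<otimes>\<^bsub>F\<^esub> gen (i + 1)) | i.
        i \<in> {1..n - 1} \<and> i + 1 \<in> {1..n - 1}})"

definition braid_group :: "nat \<Rightarrow> nat gword set monoid" where
  "braid_group n =
     free_group {1..n - 1} Mod normal_closure (free_group {1..n - 1}) (braid_relators n)"

definition sigma :: "nat \<Rightarrow> nat \<Rightarrow> nat gword set" where
  "sigma n i = normal_closure (free_group {1..n - 1}) (braid_relators n)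
     #>\<^bsub>free_group {1..n - 1}\<^esub> gen i"

text \<open>The following conditions determine \<open>\<theta>\<close> on the carrier of the braid group.\<close>

definition is_artin_hom :: "nat \<Rightarrow> (nat gword set \<Rightarrow> nat gword \<Rightarrow> nat gword) \<Rightarrow> bool" where
  "is_artin_hom n \<theta> \<longleftrightarrow>
     \<theta> \<in> hom (braid_group n) (AutoGroup (Fn n)) \<and>
     (\<forall>i\<in>{1..n - 1}.
        \<theta> (sigma n i) (gen i) = gen (i + 1) \<and>
        \<theta> (sigma n i) (gen (i + 1)) =
          inv\<^bsub>Fn n\<^esub> (gen (i + 1)) \<otimes>\<^bsub>Fn n\<^esub> gen i \<otimes>\<^bsub>Fn n\<^esub> gen (i + 1) \<and>
        (\<forall>j\<in>{1..n} - {i, i + 1}. \<theta> (sigma n i) (gen j) = gen j))"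

definition artin_representation ::
  "nat \<Rightarrow> ('g, 'c) monoid_scheme \<Rightarrow> ('g \<Rightarrow> nat gword \<Rightarrow> nat gword) \<Rightarrow> bool" where
  "artin_representation n G \<alpha> \<longleftrightarrow>
     group G \<and> \<alpha> \<in> hom G (AutoGroup (Fn n)) \<and>
     (\<exists>\<theta> \<beta>. is_artin_hom n \<theta> \<and> \<beta> \<in> hom G (braid_group n) \<and>
            (\<forall>g\<in>carrier G. \<alpha> g = \<theta> (\<beta> g)))"

definition semidirect ::
  "('h, 'm) monoid_scheme \<Rightarrow> ('g, 'c) monoid_scheme \<Rightarrow> ('g \<Rightarrow> 'h \<Rightarrow> 'h) \<Rightarrow> ('h \<times> 'g) monoid" where
  "semidirect H G \<alpha> = \<lparr>carrier = carrier H \<times> carrier G,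
     monoid.mult = (\<lambda>(x, g) (y, h). (x \<otimes>\<^bsub>H\<^esub> \<alpha> g y, g \<otimes>\<^bsub>G\<^esub> h)), one = (\<one>\<^bsub>H\<^esub>, \<one>\<^bsub>G\<^esub>)\<rparr>"


section \<open>Group rings\<close>

text \<open>The group ring consists of the finitely supported functions \<open>a\<close> on the group, \<open>a\<close> standing
  for the formal sum of the \<open>a x \<cdot> x\<close>.\<close>

definition gr_monom :: "'k \<Rightarrow> 'h \<Rightarrow> 'h \<Rightarrow> 'k::field" where
  "gr_monom c x = (\<lambda>y. if y = x then c else 0)"

definition group_ring :: "('h, 'm) monoid_scheme \<Rightarrow> ('h \<Rightarrow> 'k::field) ring" where
  "group_ring H = \<lparr>carrier = {a. finite {x. a x \<noteq> 0} \<and> {x. a x \<noteq> 0} \<subseteq> carrier H},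
     monoid.mult = (\<lambda>a b z.
       \<Sum>(x, y)\<in>{(x, y). a x \<noteq> 0 \<and> b y \<noteq> 0 \<and> x \<otimes>\<^bsub>H\<^esub> y = z}. a x * b y),
     one = gr_monom 1 \<one>\<^bsub>H\<^esub>,
     ring.zero = (\<lambda>x. 0),
     add = (\<lambda>a b x. a x + b x)\<rparr>"

definition gr_map :: "('h \<Rightarrow> 'l) \<Rightarrow> ('h \<Rightarrow> 'k::field) \<Rightarrow> 'l \<Rightarrow> 'k" where
  "gr_map \<phi> a = (\<lambda>y. \<Sum>x | a x \<noteq> 0 \<and> \<phi> x = y. a x)"

definition augmentation :: "('h \<Rightarrow> 'k::field) \<Rightarrow> 'k" where
  "augmentation a = (\<Sum>x | a x \<noteq> 0. a x)"


section \<open>Modules over noncommutative rings\<close>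

text \<open>The record type \<open>module\<close> of the library is used; its locale is not, as it demands a
  commutative ring. The fields \<open>mult\<close> and \<open>one\<close> of module records play no role.\<close>

locale left_module = R?: ring R + M?: abelian_group M
  for R :: "('r, 'a) ring_scheme" (structure) and M :: "('r, 'v, 'm) module_scheme" (structure) +
  assumes smult_closed:
      "\<lbrakk>a \<in> carrier R; v \<in> carrier M\<rbrakk> \<Longrightarrow> a \<odot>\<^bsub>M\<^esub> v \<in> carrier M"
    and smult_l_distr:
      "\<lbrakk>a \<in> carrier R; b \<in> carrier R; v \<in> carrier M\<rbrakk> \<Longrightarrow>
       (a \<oplus>\<^bsub>R\<^esub> b) \<odot>\<^bsub>M\<^esub> v = a \<odot>\<^bsub>M\<^esub> v \<oplus>\<^bsub>M\<^esub> b \<odot>\<^bsub>M\<^esub> v"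
    and smult_r_distr:
      "\<lbrakk>a \<in> carrier R; v \<in> carrier M; w \<in> carrier M\<rbrakk> \<Longrightarrow>
       a \<odot>\<^bsub>M\<^esub> (v \<oplus>\<^bsub>M\<^esub> w) = a \<odot>\<^bsub>M\<^esub> v \<oplus>\<^bsub>M\<^esub> a \<odot>\<^bsub>M\<^esub> w"
    and smult_assoc:
      "\<lbrakk>a \<in> carrier R; b \<in> carrier R; v \<in> carrier M\<rbrakk> \<Longrightarrow>
       (a \<otimes>\<^bsub>R\<^esub> b) \<odot>\<^bsub>M\<^esub> v = a \<odot>\<^bsub>M\<^esub> (b \<odot>\<^bsub>M\<^esub> v)"
    and smult_one:
      "v \<in> carrier M \<Longrightarrow> \<one>\<^bsub>R\<^esub> \<odot>\<^bsub>M\<^esub> v = v"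

definition restrict_scalars :: "('r \<Rightarrow> 's) \<Rightarrow> ('s, 'v, 'm) module_scheme \<Rightarrow> ('r, 'v) module" where
  "restrict_scalars \<phi> M = \<lparr>carrier = carrier M, monoid.mult = monoid.mult M, one = monoid.one M,
     ring.zero = ring.zero M, add = add M, smult = (\<lambda>r. smult M (\<phi> r))\<rparr>"

definition quotient_module :: "('r, 'v, 'm) module_scheme \<Rightarrow> 'v set \<Rightarrow> ('r, 'v set) module" where
  "quotient_module M N = \<lparr>carrier = a_rcosets\<^bsub>M\<^esub> N, monoid.mult = undefined, one = undefined,
     ring.zero = N, add = set_add M,
     smult = (\<lambda>r C. the_elem ((\<lambda>v. N +>\<^bsub>M\<^esub> (r \<odot>\<^bsub>M\<^esub> v)) ` C))\<rparr>"

text \<open>Right modules are also stored in \<open>module\<close> records: \<open>r \<odot> m\<close> is then to be read as \<open>m r\<close>.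
  The tensor product of a right module \<open>M\<close> with a left module \<open>N\<close> is the free abelian group on pairs
  modulo the subgroup generated by the biadditivity and balancing relations.\<close>

definition tensor_kernel ::
  "('r, 'a) ring_scheme \<Rightarrow> ('r, 'u, 'b) module_scheme \<Rightarrow> ('r, 'v, 'c) module_scheme \<Rightarrow>
   (('u \<times> 'v) \<Rightarrow>\<^sub>0 int) set" where
  "tensor_kernel R M N = generate (free_Abelian_group (carrier M \<times> carrier N))
     ({frag_of (m \<oplus>\<^bsub>M\<^esub> m', v) - frag_of (m, v) - frag_of (m', v) | m m' v.
         m \<in> carrier M \<and> m' \<in> carrier M \<and> v \<in> carrier N} \<union>
      {frag_of (m, v \<oplus>\<^bsub>N\<^esub> v') - frag_of (m, v) - frag_of (m, v') | m v v'.
         m \<in> carrier M \<and> v \<in> carrier N \<and> v' \<in> carrier N} \<union>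
      {frag_of (r \<odot>\<^bsub>M\<^esub> m, v) - frag_of (m, r \<odot>\<^bsub>N\<^esub> v) | r m v.
         r \<in> carrier R \<and> m \<in> carrier M \<and> v \<in> carrier N})"

definition tensor ::
  "('r, 'a) ring_scheme \<Rightarrow> ('r, 'u, 'b) module_scheme \<Rightarrow> ('r, 'v, 'c) module_scheme \<Rightarrow>
   (('u \<times> 'v) \<Rightarrow>\<^sub>0 int) set ring" where
  "tensor R M N = (let A = free_Abelian_group (carrier M \<times> carrier N); K = tensor_kernel R M N in
     \<lparr>carrier = rcosets\<^bsub>A\<^esub> K, monoid.mult = undefined, one = undefined,
      ring.zero = K, add = set_mult A\<rparr>)"

text \<open>The endomorphism \<open>m \<otimes> v \<mapsto> \<phi> m \<otimes> \<psi> v\<close>, for maps \<open>\<phi>\<close>, \<open>\<psi>\<close> that respect the relations.\<close>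

definition tensor_map ::
  "('r, 'a) ring_scheme \<Rightarrow> ('r, 'u, 'b) module_scheme \<Rightarrow> ('r, 'v, 'c) module_scheme \<Rightarrow>
   ('u \<Rightarrow> 'u) \<Rightarrow> ('v \<Rightarrow> 'v) \<Rightarrow> (('u \<times> 'v) \<Rightarrow>\<^sub>0 int) set \<Rightarrow> (('u \<times> 'v) \<Rightarrow>\<^sub>0 int) set" where
  "tensor_map R M N \<phi> \<psi> C =
     the_elem ((\<lambda>c. tensor_kernel R M N #>\<^bsub>free_Abelian_group (carrier M \<times> carrier N)\<^esub>
                      frag_extend (\<lambda>(m, v). frag_of (\<phi> m, \<psi> v)) c) ` C)"


section \<open>The twisted augmentation ideal\<close>

definition aug_ideal :: "('h, 'm) monoid_scheme \<Rightarrow> ('h \<Rightarrow> 'k::field, 'h \<Rightarrow> 'k) module" where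
  "aug_ideal H = \<lparr>carrier = {a \<in> carrier (group_ring H). augmentation a = 0},
     monoid.mult = undefined, one = undefined,
     ring.zero = \<zero>\<^bsub>group_ring H\<^esub>, add = add (group_ring H),
     smult = (\<lambda>r f. f \<otimes>\<^bsub>group_ring H\<^esub> r)\<rparr>"

definition gminus1 :: "nat \<Rightarrow> nat \<Rightarrow> nat gword \<Rightarrow> 'k::field" where
  "gminus1 n j = gr_monom 1 (gen j) \<ominus>\<^bsub>group_ring (Fn n)\<^esub> \<one>\<^bsub>group_ring (Fn n)\<^esub>"

text \<open>Automorphisms of a module record; for a right module record these are the right module
  automorphisms. The product is composition.\<close>

definition module_Aut ::
  "('r, 'a) ring_scheme \<Rightarrow> ('r, 'u, 'b) module_scheme \<Rightarrow> ('u \<Rightarrow> 'u) monoid" where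
  "module_Aut R M = BijGroup (carrier M) \<lparr>carrier := {\<phi> \<in> Bij (carrier M).
     (\<forall>m\<in>carrier M. \<forall>m'\<in>carrier M. \<phi> (m \<oplus>\<^bsub>M\<^esub> m') = \<phi> m \<oplus>\<^bsub>M\<^esub> \<phi> m') \<and>
     (\<forall>r\<in>carrier R. \<forall>m\<in>carrier M. \<phi> (r \<odot>\<^bsub>M\<^esub> m) = r \<odot>\<^bsub>M\<^esub> \<phi> m)}\<rparr>"

definition lam_ge :: "'k::field \<Rightarrow> nat \<Rightarrow> nat \<Rightarrow> 'k" where
  "lam_ge lam i j = (if j \<le> i then lam else 1)"

definition twisted_action ::
  "nat \<Rightarrow> 'k::field \<Rightarrow> nat gword \<Rightarrow> (nat gword \<Rightarrow> 'k) \<Rightarrow> nat gword \<Rightarrow> 'k" where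
  "twisted_action n lam = (THE \<rho>.
     \<rho> \<in> hom (Fn n) (module_Aut (group_ring (Fn n)) (aug_ideal (Fn n))) \<and>
     \<rho> \<in> extensional (carrier (Fn n)) \<and>
     (\<forall>i\<in>{1..n}. \<forall>j\<in>{1..n}. \<rho> (gen i) (gminus1 n j) =
        (gr_monom (lam_ge lam i j) (gen i) \<otimes>\<^bsub>group_ring (Fn n)\<^esub> gminus1 n j)
        \<ominus>\<^bsub>group_ring (Fn n)\<^esub>
        (gr_monom (lam_ge lam (i - 1) j - 1) \<one>\<^bsub>Fn n\<^esub> \<otimes>\<^bsub>group_ring (Fn n)\<^esub> gminus1 n j)))"


section \<open>The Long--Moody module and its Katz quotient\<close>

abbreviation FG_ring ::
  "nat \<Rightarrow> ('g, 'c) monoid_scheme \<Rightarrow> ('g \<Rightarrow> nat gword \<Rightarrow> nat gword) \<Rightarrow>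
   (nat gword \<times> 'g \<Rightarrow> 'k::field) ring" where
  "FG_ring n G \<alpha> \<equiv> group_ring (semidirect (Fn n) G \<alpha>)"

definition restrict_Fn ::
  "('g, 'c) monoid_scheme \<Rightarrow> (nat gword \<times> 'g \<Rightarrow> 'k::field, 'v) module \<Rightarrow>
   (nat gword \<Rightarrow> 'k, 'v) module" where
  "restrict_Fn G V = restrict_scalars (gr_map (\<lambda>x. (x, \<one>\<^bsub>G\<^esub>))) V"

definition Fn_irreducible ::
  "nat \<Rightarrow> ('g, 'c) monoid_scheme \<Rightarrow> ('g \<Rightarrow> nat gword \<Rightarrow> nat gword) \<Rightarrow>
   (nat gword \<times> 'g \<Rightarrow> 'k::field, 'v) module \<Rightarrow> bool" where
  "Fn_irreducible n G \<alpha> V \<longleftrightarrow>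
     left_module (FG_ring n G \<alpha>) V \<and>
     (\<forall>W. submodule W (group_ring (Fn n)) (restrict_Fn G V) \<longrightarrow> W = {\<zero>\<^bsub>V\<^esub>} \<or> W = carrier V)"

definition LM_space ::
  "nat \<Rightarrow> ('g, 'c) monoid_scheme \<Rightarrow> (nat gword \<times> 'g \<Rightarrow> 'k::field, 'v) module \<Rightarrow>
   (((nat gword \<Rightarrow> 'k) \<times> 'v) \<Rightarrow>\<^sub>0 int) set ring" where
  "LM_space n G V = tensor (group_ring (Fn n)) (aug_ideal (Fn n)) (restrict_Fn G V)"

definition LM_map ::
  "nat \<Rightarrow> ('g, 'c) monoid_scheme \<Rightarrow> (nat gword \<times> 'g \<Rightarrow> 'k::field, 'v) module \<Rightarrow>
   ((nat gword \<Rightarrow> 'k) \<Rightarrow> (nat gword \<Rightarrow> 'k)) \<Rightarrow> ('v \<Rightarrow> 'v) \<Rightarrow>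
   (((nat gword \<Rightarrow> 'k) \<times> 'v) \<Rightarrow>\<^sub>0 int) set \<Rightarrow> (((nat gword \<Rightarrow> 'k) \<times> 'v) \<Rightarrow>\<^sub>0 int) set" where
  "LM_map n G V = tensor_map (group_ring (Fn n)) (aug_ideal (Fn n)) (restrict_Fn G V)"

definition LM_scale ::
  "nat \<Rightarrow> ('g, 'c) monoid_scheme \<Rightarrow> (nat gword \<times> 'g \<Rightarrow> 'k::field, 'v) module \<Rightarrow> 'k \<Rightarrow>
   (((nat gword \<Rightarrow> 'k) \<times> 'v) \<Rightarrow>\<^sub>0 int) set \<Rightarrow> (((nat gword \<Rightarrow> 'k) \<times> 'v) \<Rightarrow>\<^sub>0 int) set" where
  "LM_scale n G V c = LM_map n G V (\<lambda>f x. c * f x) (\<lambda>v. v)"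

definition LM_F_act ::
  "nat \<Rightarrow> ('g, 'c) monoid_scheme \<Rightarrow> 'k::field \<Rightarrow> (nat gword \<times> 'g \<Rightarrow> 'k, 'v) module \<Rightarrow> nat gword \<Rightarrow>
   (((nat gword \<Rightarrow> 'k) \<times> 'v) \<Rightarrow>\<^sub>0 int) set \<Rightarrow> (((nat gword \<Rightarrow> 'k) \<times> 'v) \<Rightarrow>\<^sub>0 int) set" where
  "LM_F_act n G lam V x = LM_map n G V (twisted_action n lam x) (\<lambda>v. v)"

definition LM_G_act ::
  "nat \<Rightarrow> ('g, 'c) monoid_scheme \<Rightarrow> ('g \<Rightarrow> nat gword \<Rightarrow> nat gword) \<Rightarrow>
   (nat gword \<times> 'g \<Rightarrow> 'k::field, 'v) module \<Rightarrow> 'g \<Rightarrow>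
   (((nat gword \<Rightarrow> 'k) \<times> 'v) \<Rightarrow>\<^sub>0 int) set \<Rightarrow> (((nat gword \<Rightarrow> 'k) \<times> 'v) \<Rightarrow>\<^sub>0 int) set" where
  "LM_G_act n G \<alpha> V g = LM_map n G V (gr_map (\<alpha> g)) (\<lambda>v. gr_monom 1 (\<one>\<^bsub>Fn n\<^esub>, g) \<odot>\<^bsub>V\<^esub> v)"

text \<open>The pair \<open>(x, g)\<close> is the product of \<open>x\<close> and \<open>g\<close> in the semidirect product, hence acts
  by \<open>x\<close> after \<open>g\<close>; the action is extended linearly to the group ring.\<close>

definition LM ::
  "nat \<Rightarrow> ('g, 'c) monoid_scheme \<Rightarrow> ('g \<Rightarrow> nat gword \<Rightarrow> nat gword) \<Rightarrow> 'k::field \<Rightarrow>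
   (nat gword \<times> 'g \<Rightarrow> 'k, 'v) module \<Rightarrow>
   (nat gword \<times> 'g \<Rightarrow> 'k, (((nat gword \<Rightarrow> 'k) \<times> 'v) \<Rightarrow>\<^sub>0 int) set) module" where
  "LM n G \<alpha> lam V = (let T = LM_space n G V in
     \<lparr>carrier = carrier T, monoid.mult = monoid.mult T, one = monoid.one T, ring.zero = ring.zero T, add = add T,
      smult = (\<lambda>a w. \<Oplus>\<^bsub>T\<^esub>h\<in>{h. a h \<noteq> 0}.
        LM_scale n G V (a h) (LM_F_act n G lam V (fst h) (LM_G_act n G \<alpha> V (snd h) w)))\<rparr>)"

definition Fn_invariants ::
  "nat \<Rightarrow> ('g, 'c) monoid_scheme \<Rightarrow> (nat gword \<times> 'g \<Rightarrow> 'k::field, 'w) module \<Rightarrow> 'w set" where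
  "Fn_invariants n G M =
     {w \<in> carrier M. \<forall>x\<in>carrier (Fn n). gr_monom 1 (x, \<one>\<^bsub>G\<^esub>) \<odot>\<^bsub>M\<^esub> w = w}"

definition Fn_eigen ::
  "nat \<Rightarrow> ('g, 'c) monoid_scheme \<Rightarrow> 'k::field \<Rightarrow> (nat gword \<times> 'g \<Rightarrow> 'k, 'w) module \<Rightarrow>
   nat \<Rightarrow> 'w set" where
  "Fn_eigen n G lam M i =
     {w \<in> carrier M.
        gr_monom 1 (gen i, \<one>\<^bsub>G\<^esub>) \<odot>\<^bsub>M\<^esub> w = gr_monom lam (\<one>\<^bsub>Fn n\<^esub>, \<one>\<^bsub>G\<^esub>) \<odot>\<^bsub>M\<^esub> w \<and>
        (\<forall>j\<in>{1..n} - {i}. gr_monom 1 (gen j, \<one>\<^bsub>G\<^esub>) \<odot>\<^bsub>M\<^esub> w = w)}"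

definition KLM_kernel ::
  "nat \<Rightarrow> ('g, 'c) monoid_scheme \<Rightarrow> 'k::field \<Rightarrow> (nat gword \<times> 'g \<Rightarrow> 'k, 'w) module \<Rightarrow> 'w set" where
  "KLM_kernel n G lam M =
     {(\<Oplus>\<^bsub>M\<^esub>i\<in>{1..n}. u i) \<oplus>\<^bsub>M\<^esub> w | u w.
        (\<forall>i\<in>{1..n}. u i \<in> Fn_eigen n G lam M i) \<and> w \<in> Fn_invariants n G M}"

definition KLM ::
  "nat \<Rightarrow> ('g, 'c) monoid_scheme \<Rightarrow> ('g \<Rightarrow> nat gword \<Rightarrow> nat gword) \<Rightarrow> 'k::field \<Rightarrow>
   (nat gword \<times> 'g \<Rightarrow> 'k, 'v) module \<Rightarrow>
   (nat gword \<times> 'g \<Rightarrow> 'k, (((nat gword \<Rightarrow> 'k) \<times> 'v) \<Rightarrow>\<^sub>0 int) set set) module" where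
  "KLM n G \<alpha> lam V =
     quotient_module (LM n G \<alpha> lam V) (KLM_kernel n G lam (LM n G \<alpha> lam V))"

end

theory Submission
  imports Defs
begin

text \<open>Write \<open>e\<^sub>j = x\<^sub>j - 1\<close>. The elements \<open>e\<^sub>j \<otimes> v\<close> span the Long--Moody module, and \<open>x\<^sub>i\<close> acts on them as a
  pseudo-reflection whose image lies in \<open>e\<^sub>i \<otimes> V\<close>:
  \<open>x\<^sub>i(e\<^sub>j \<otimes> v) = e\<^sub>j \<otimes> v + e\<^sub>i \<otimes> D\<^sub>i(e\<^sub>j)v\<close>, where \<open>D\<^sub>i(e\<^sub>j)\<close> is \<open>\<lambda>e\<^sub>j\<close>, \<open>\<lambda>x\<^sub>j - 1\<close> or \<open>e\<^sub>j\<close> according to whether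
  \<open>j < i\<close>, \<open>j = i\<close> or \<open>j > i\<close>.

  Irreducibility follows from this formula alone. Let \<open>W\<close> be a subspace stable under the free group
  and let \<open>W\<^sub>i\<close> consist of the \<open>v\<close> with \<open>e\<^sub>i \<otimes> v \<in> W\<close>. Applying \<open>x\<^sub>i\<close> to \<open>e\<^sub>j \<otimes> v\<close> shows that \<open>e\<^sub>j\<close> maps \<open>W\<^sub>j\<close>
  into \<open>W\<^sub>i\<close>, for all \<open>i\<close> and \<open>j\<close>. Hence the intersection of the \<open>W\<^sub>i\<close> is a submodule of \<open>V\<close>
  (\<open>core_submodule\<close>), and therefore it is \<open>V\<close> or zero. If it is \<open>V\<close>, then \<open>W\<close> is the whole module. If it is
  zero, then \<open>e\<^sub>j\<close> kills \<open>W\<^sub>j\<close>. For \<open>w \<in> W\<close> write \<open>x\<^sub>iw - w = e\<^sub>i \<otimes> p\<^sub>i\<close>. Here \<open>p\<^sub>i \<in> W\<^sub>i\<close>, so \<open>e\<^sub>i \<otimes> p\<^sub>i\<close> is a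
  vector of the \<open>i\<close>-th eigenspace; for \<open>\<lambda> \<noteq> 1\<close> the vector \<open>w\<close> minus the sum of the
  \<open>(\<lambda> - 1)\<inverse>e\<^sub>i \<otimes> p\<^sub>i\<close> is invariant, and for \<open>\<lambda> = 1\<close> all \<open>p\<^sub>i\<close> are equal, hence zero, and \<open>w\<close> is
  invariant. In both cases \<open>W\<close> lies in the kernel of the Katz quotient (\<open>W_subset_N_if_core_zero\<close>).

  The larger part of the work is that the objects in question exist. The twisted action is well
  defined because the augmentation ideal is a free right module on the \<open>e\<^sub>j\<close>: generation is \<open>I_induct\<close>,
  and right linear maps with prescribed values on the \<open>e\<^sub>j\<close> are constructed by Fox calculus (\<open>der_e\<close>,
  \<open>der_right_linear\<close>). The actions of the free group and of \<open>G\<close> combine to a module over the group ring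
  of the semidirect product if each automorphism \<open>\<alpha>(g)\<close> satisfies
  \<open>\<alpha>(g)(x \<circ> f) = \<alpha>(g)(x) \<circ> \<alpha>(g)(f)\<close>. This is where it matters that \<open>\<alpha>\<close> factors through the braid group:
  the automorphisms with this property form a group, and it contains the images of the standard
  generators by a direct calculation (\<open>sigma_equivariant\<close>). In the same way, \<open>\<alpha>(g)\<close> sends the \<open>x\<^sub>j\<close> to
  conjugates of the \<open>x\<^sub>j\<close> in some order, so that \<open>g\<close> permutes the eigenspaces and the kernel is a
  submodule for the action of \<open>G\<close> too (\<open>N_submodule\<close>).\<close>

section \<open>Free groups\<close>

definition flip :: "'i \<times> bool \<Rightarrow> 'i \<times> bool" where
  "flip a = (fst a, \<not> snd a)"

definition gmul :: "'i gword \<Rightarrow> 'i gword \<Rightarrow> 'i gword" where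
  "gmul u v = foldr push u v"

lemma flip_flip [simp]: "flip (flip a) = a"
  by (simp add: flip_def)

lemma fst_flip [simp]: "fst (flip a) = fst a"
  by (simp add: flip_def)

lemma cancels_iff_flip: "cancels a b \<longleftrightarrow> b = flip a"
  by (cases a; cases b) (auto simp: flip_def)

lemma gmul_Nil [simp]: "gmul [] v = v"
  and gmul_Cons [simp]: "gmul (a # u) v = push a (gmul u v)"
  by (simp_all add: gmul_def)

lemma free_group_simps [simp]:
  "u \<in> carrier (free_group I) \<longleftrightarrow> reduced u \<and> fst ` set u \<subseteq> I"
  "u \<otimes>\<^bsub>free_group I\<^esub> v = gmul u v"
  "\<one>\<^bsub>free_group I\<^esub> = []"
  by (auto simp: free_group_def gmul_def)

lemma reduced_Nil [simp]: "reduced []"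
  by (simp add: reduced_def)

lemma reduced_Cons: "reduced (a # w) \<longleftrightarrow> reduced w \<and> (w = [] \<or> hd w \<noteq> flip a)"
  by (cases w) (auto simp: reduced_def cancels_iff_flip)

lemma push_reduced: "reduced w \<Longrightarrow> reduced (push a w)"
  by (cases w) (auto simp: reduced_Cons cancels_iff_flip)

lemma push_letters: "fst ` set (push a w) \<subseteq> insert (fst a) (fst ` set w)"
  by (cases w) auto

lemma push_Cons_reduced: "reduced (a # w) \<Longrightarrow> push a w = a # w"
  by (cases w) (auto simp: reduced_Cons cancels_iff_flip)

text \<open>Pushing a letter and pushing its inverse are mutually inverse permutations of the reduced words;
  associativity and inverses in the free group both come from this.\<close>

lemma push_flip: "reduced w \<Longrightarrow> push a (push (flip a) w) = w"
proof (cases w)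
  case (Cons b u)
  assume "reduced w"
  with Cons show ?thesis
    by (cases "b = a") (auto simp: cancels_iff_flip reduced_Cons intro: push_Cons_reduced)
qed (auto simp: cancels_iff_flip)

lemma gmul_reduced: "reduced v \<Longrightarrow> reduced (gmul u v)"
  by (induction u) (auto intro: push_reduced)

lemma gmul_letters: "fst ` set (gmul u v) \<subseteq> fst ` set u \<union> fst ` set v"
proof (induction u)
  case (Cons a u)
  with push_letters[of a "gmul u v"] show ?case by auto
qed auto

lemma gmul_letters_subset:
  "fst ` set u \<subseteq> I \<Longrightarrow> fst ` set v \<subseteq> I \<Longrightarrow> fst ` set (gmul u v) \<subseteq> I"
  using gmul_letters[of u v] by blast

lemma gmul_push: "reduced w \<Longrightarrow> gmul (push a v) w = push a (gmul v w)"
  by (cases v) (auto simp: cancels_iff_flip push_flip gmul_reduced)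

lemma gmul_assoc: "reduced w \<Longrightarrow> gmul (gmul u v) w = gmul u (gmul v w)"
  by (induction u) (auto simp: gmul_push)

lemma left_inverse_word:
  "reduced w \<Longrightarrow> fst ` set w \<subseteq> I \<Longrightarrow> \<exists>y. reduced y \<and> fst ` set y \<subseteq> I \<and> gmul y w = []"
proof (induction w)
  case (Cons a w)
  then obtain y where y: "reduced y" "fst ` set y \<subseteq> I" "gmul y w = []"
    by (auto simp: reduced_Cons)
  have red: "reduced (push (flip a) [])"
    by (simp add: reduced_Cons)
  have "gmul (gmul y [flip a]) (a # w) = gmul y (gmul [flip a] (a # w))"
    using Cons.prems by (intro gmul_assoc) auto
  also have "\<dots> = []"
    using y by (simp add: cancels_iff_flip)
  finally have "gmul (gmul y [flip a]) (a # w) = []" .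
  moreover have "reduced (gmul y [flip a])"
    using red by (intro gmul_reduced) simp
  moreover have "fst ` set (gmul y [flip a]) \<subseteq> I"
    using y Cons.prems by (intro gmul_letters_subset) auto
  ultimately show ?case by blast
qed (auto intro!: exI[of _ "[]"])

lemma group_free_group: "group (free_group I)"
proof (rule groupI)
  fix x y assume "x \<in> carrier (free_group I)" "y \<in> carrier (free_group I)"
  then show "x \<otimes>\<^bsub>free_group I\<^esub> y \<in> carrier (free_group I)"
    by (simp add: gmul_reduced gmul_letters_subset)
next
  fix x assume "x \<in> carrier (free_group I)"
  then show "\<exists>y\<in>carrier (free_group I). y \<otimes>\<^bsub>free_group I\<^esub> x = \<one>\<^bsub>free_group I\<^esub>"
    using left_inverse_word[of x I] by auto
qed (auto simp: gmul_assoc)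

lemma gen_in_free_group: "i \<in> I \<Longrightarrow> gen i \<in> carrier (free_group I)"
  by (simp add: gen_def reduced_Cons)

lemma inv_gen: "i \<in> I \<Longrightarrow> inv\<^bsub>free_group I\<^esub> (gen i) = [(i, False)]"
  by (rule group.inv_equality[OF group_free_group])
     (auto simp: gen_def reduced_Cons)

text \<open>A reduced word is the product of its letters, each a generator or the inverse of one. This turns
  induction on words into a principle that no longer mentions words.\<close>

lemma free_group_induct [consumes 1, case_names one gen inv]:
  assumes "w \<in> carrier (free_group I)"
    and "P []"
    and "\<And>i w. i \<in> I \<Longrightarrow> w \<in> carrier (free_group I) \<Longrightarrow> P w \<Longrightarrow>
           P (gen i \<otimes>\<^bsub>free_group I\<^esub> w)"
    and "\<And>i w. i \<in> I \<Longrightarrow> w \<in> carrier (free_group I) \<Longrightarrow> P w \<Longrightarrow>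
           P (inv\<^bsub>free_group I\<^esub> (gen i) \<otimes>\<^bsub>free_group I\<^esub> w)"
  shows "P w"
  using assms(1)
proof (induction w)
  case (Cons a w)
  obtain i s where a: "a = (i, s)" by (cases a)
  from Cons have w: "w \<in> carrier (free_group I)" "P w" "i \<in> I"
    by (auto simp: reduced_Cons a)
  have "push a w = a # w"
    using Cons.prems by (intro push_Cons_reduced) simp
  then show ?case
    using assms(3)[OF w(3,1,2)] assms(4)[OF w(3,1,2)] w
    by (cases s) (simp_all add: a gen_def[symmetric] inv_gen, simp_all add: gen_def)
qed (use assms(2) in simp)

definition letter_val :: "('b, 'm) monoid_scheme \<Rightarrow> ('i \<Rightarrow> 'b) \<Rightarrow> 'i \<times> bool \<Rightarrow> 'b" where
  "letter_val H f a = (if snd a then f (fst a) else inv\<^bsub>H\<^esub> (f (fst a)))"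

definition word_val :: "('b, 'm) monoid_scheme \<Rightarrow> ('i \<Rightarrow> 'b) \<Rightarrow> 'i gword \<Rightarrow> 'b" where
  "word_val H f w = foldr (\<lambda>a b. letter_val H f a \<otimes>\<^bsub>H\<^esub> b) w \<one>\<^bsub>H\<^esub>"

lemma word_val_simps [simp]:
  "word_val H f [] = \<one>\<^bsub>H\<^esub>"
  "word_val H f (a # w) = letter_val H f a \<otimes>\<^bsub>H\<^esub> word_val H f w"
  by (simp_all add: word_val_def)

text \<open>The universal property of the free group: a word is evaluated letter by letter, and cancelling
  two adjacent letters does not change the value.\<close>

lemma (in group) word_val_hom:
  assumes f: "\<And>i. i \<in> I \<Longrightarrow> f i \<in> carrier G"
  shows "word_val G f \<in> hom (free_group I) G"
proof -
  have letter: "letter_val G f a \<in> carrier G" if "fst a \<in> I" for a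
    using f that by (auto simp: letter_val_def)
  have closed: "word_val G f w \<in> carrier G" if "fst ` set w \<subseteq> I" for w
    using that by (induction w) (auto intro: letter)
  have push: "word_val G f (push a w) = letter_val G f a \<otimes> word_val G f w"
    if a: "fst a \<in> I" and w: "fst ` set w \<subseteq> I" for a w
  proof (cases w)
    case (Cons b u)
    show ?thesis
    proof (cases "b = flip a")
      case True
      have "letter_val G f a \<otimes> (letter_val G f (flip a) \<otimes> word_val G f u) = word_val G f u"
        using f[OF a] closed[of u] w Cons
        by (cases "snd a") (auto simp: letter_val_def flip_def m_assoc[symmetric])
      with True Cons show ?thesis by (simp add: cancels_iff_flip)
    qed (simp add: Cons cancels_iff_flip)
  qed simp
  have "word_val G f (gmul u v) = word_val G f u \<otimes> word_val G f v"
    if "fst ` set u \<subseteq> I" "fst ` set v \<subseteq> I" for u v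
    using that(1)
  proof (induction u)
    case Nil
    then show ?case using closed that by simp
  next
    case (Cons a u)
    have "fst ` set (gmul u v) \<subseteq> I"
      using Cons that by (intro gmul_letters_subset) auto
    with Cons push[of a "gmul u v"] letter closed that show ?case
      by (auto simp: m_assoc)
  qed
  with closed show ?thesis by (auto simp: hom_def)
qed

lemma (in group) word_val_gen: "f i \<in> carrier G \<Longrightarrow> word_val G f (gen i) = f i"
  by (simp add: gen_def letter_val_def)

lemma free_group_hom_eq:
  assumes "group H" and h: "h \<in> hom (free_group I) H" and k: "k \<in> hom (free_group I) H"
    and eq: "\<And>i. i \<in> I \<Longrightarrow> h (gen i) = k (gen i)"
    and w: "w \<in> carrier (free_group I)"
  shows "h w = k w"
proof -
  interpret F: group "free_group I" by (rule group_free_group)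
  interpret h: group_hom "free_group I" H h
    using assms by (simp add: group_hom_def group_hom_axioms_def F.is_group)
  interpret k: group_hom "free_group I" H k
    using assms by (simp add: group_hom_def group_hom_axioms_def F.is_group)
  show ?thesis using w
  proof (induction rule: free_group_induct)
    case one
    then show ?case using h.hom_one k.hom_one by simp
  next
    case (gen i w)
    then show ?case using h.hom_mult k.hom_mult eq gen_in_free_group by metis
  next
    case (inv i w)
    then show ?case
      using h.hom_mult k.hom_mult h.hom_inv k.hom_inv eq gen_in_free_group F.inv_closed
      by metis
  qed
qed

section \<open>Group rings\<close>

abbreviation supp :: "('h \<Rightarrow> 'k::zero) \<Rightarrow> 'h set" where
  "supp a \<equiv> {x. a x \<noteq> 0}"

lemma group_ring_carrier:
  "a \<in> carrier (group_ring H) \<longleftrightarrow> finite (supp a) \<and> supp a \<subseteq> carrier H"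
  by (simp add: group_ring_def)

lemma group_ring_simps [simp]:
  "\<zero>\<^bsub>group_ring H\<^esub> = (\<lambda>x. 0)"
  "\<one>\<^bsub>group_ring H\<^esub> = gr_monom 1 \<one>\<^bsub>H\<^esub>"
  "a \<oplus>\<^bsub>group_ring H\<^esub> b = (\<lambda>x. a x + b x)"
  by (simp_all add: group_ring_def)

text \<open>The support of a sum or product can be smaller than the supports of the summands or factors suggest.
  Summing over any finite sets that contain the supports keeps the index sets fixed, so that the
  distributive laws become laws of finite sums.\<close>

lemma gr_mult_eq:
  assumes A: "finite A" "supp a \<subseteq> A" and B: "finite B" "supp b \<subseteq> B"
  shows "(a \<otimes>\<^bsub>group_ring H\<^esub> b) z =
    (\<Sum>x\<in>A. \<Sum>y\<in>B. if x \<otimes>\<^bsub>H\<^esub> y = z then a x * b y else 0)"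
proof -
  have "(\<Sum>(x, y)\<in>{(x, y). a x \<noteq> 0 \<and> b y \<noteq> 0 \<and> x \<otimes>\<^bsub>H\<^esub> y = z}. a x * b y) =
    (\<Sum>(x, y)\<in>A \<times> B. if x \<otimes>\<^bsub>H\<^esub> y = z then a x * b y else 0)"
    using A B by (intro sum.mono_neutral_cong_left) (auto split: if_splits)
  then show ?thesis
    using A B by (simp add: group_ring_def sum.cartesian_product)
qed

lemma gr_monom_mult:
  "gr_monom c x \<otimes>\<^bsub>group_ring H\<^esub> gr_monom d y = gr_monom (c * d) (x \<otimes>\<^bsub>H\<^esub> y)"
proof
  fix z
  show "(gr_monom c x \<otimes>\<^bsub>group_ring H\<^esub> gr_monom d y) z = gr_monom (c * d) (x \<otimes>\<^bsub>H\<^esub> y) z"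
    by (subst gr_mult_eq[of "{x}" _ "{y}"]) (auto simp: gr_monom_def)
qed

lemma gr_monom_closed: "x \<in> carrier H \<Longrightarrow> gr_monom c x \<in> carrier (group_ring H)"
  by (auto simp: group_ring_carrier gr_monom_def intro: finite_subset[of _ "{x}"])

lemma gr_monom_zero [simp]: "gr_monom 0 x = (\<lambda>y. 0)"
  by (auto simp: gr_monom_def)

lemma gr_monom_add: "gr_monom (c + d) x = (\<lambda>y. gr_monom c x y + gr_monom d x y)"
  by (auto simp: gr_monom_def)

lemma gr_add_closed:
  assumes "a \<in> carrier (group_ring H)" "b \<in> carrier (group_ring H)"
  shows "(\<lambda>x. a x + b x) \<in> carrier (group_ring H)"
proof -
  have sub: "supp (\<lambda>x. a x + b x) \<subseteq> supp a \<union> supp b" by auto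
  have "finite (supp (\<lambda>x. a x + b x))"
    using assms by (intro finite_subset[OF sub]) (simp add: group_ring_carrier)
  with sub assms show ?thesis
    unfolding group_ring_carrier by blast
qed

lemma gr_zero_closed: "(\<lambda>x. 0) \<in> carrier (group_ring H)"
  by (simp add: group_ring_carrier)

lemma gr_mult_add_left:
  assumes "finite (supp a)" "finite (supp b)" "finite (supp c)"
  shows "(\<lambda>x. a x + b x) \<otimes>\<^bsub>group_ring H\<^esub> c =
    (\<lambda>x. (a \<otimes>\<^bsub>group_ring H\<^esub> c) x + (b \<otimes>\<^bsub>group_ring H\<^esub> c) x)"
proof
  fix z
  let ?A = "supp a \<union> supp b"
  show "((\<lambda>x. a x + b x) \<otimes>\<^bsub>group_ring H\<^esub> c) z =
    (a \<otimes>\<^bsub>group_ring H\<^esub> c) z + (b \<otimes>\<^bsub>group_ring H\<^esub> c) z"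
    using assms
    by (subst (1 2 3) gr_mult_eq[of ?A _ "supp c"])
       (auto simp: sum.distrib[symmetric] distrib_right intro!: sum.cong)
qed

lemma gr_mult_add_right:
  assumes "finite (supp a)" "finite (supp b)" "finite (supp c)"
  shows "c \<otimes>\<^bsub>group_ring H\<^esub> (\<lambda>x. a x + b x) =
    (\<lambda>x. (c \<otimes>\<^bsub>group_ring H\<^esub> a) x + (c \<otimes>\<^bsub>group_ring H\<^esub> b) x)"
proof
  fix z
  let ?A = "supp a \<union> supp b"
  show "(c \<otimes>\<^bsub>group_ring H\<^esub> (\<lambda>x. a x + b x)) z =
    (c \<otimes>\<^bsub>group_ring H\<^esub> a) z + (c \<otimes>\<^bsub>group_ring H\<^esub> b) z"
    using assms
    by (subst (1 2 3) gr_mult_eq[of "supp c" _ ?A])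
       (auto simp: sum.distrib[symmetric] distrib_left intro!: sum.cong)
qed

lemma gr_mult_zero [simp]:
  "(\<lambda>x. 0) \<otimes>\<^bsub>group_ring H\<^esub> a = (\<lambda>x. 0)" "a \<otimes>\<^bsub>group_ring H\<^esub> (\<lambda>x. 0) = (\<lambda>x. 0)"
  by (auto simp: group_ring_def)

lemma gr_mult_closed:
  assumes H: "monoid H" and a: "a \<in> carrier (group_ring H)" and b: "b \<in> carrier (group_ring H)"
  shows "a \<otimes>\<^bsub>group_ring H\<^esub> b \<in> carrier (group_ring H)"
proof -
  let ?S = "(\<lambda>(x, y). x \<otimes>\<^bsub>H\<^esub> y) ` (supp a \<times> supp b)"
  have "supp (a \<otimes>\<^bsub>group_ring H\<^esub> b) \<subseteq> ?S"
  proof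
    fix z assume z: "z \<in> supp (a \<otimes>\<^bsub>group_ring H\<^esub> b)"
    show "z \<in> ?S"
    proof (rule ccontr)
      assume "z \<notin> ?S"
      then have "(a \<otimes>\<^bsub>group_ring H\<^esub> b) z = 0"
        using a b by (subst gr_mult_eq[of "supp a" _ "supp b"])
          (auto simp: group_ring_carrier intro!: sum.neutral)
      with z show False by simp
    qed
  qed
  moreover have "?S \<subseteq> carrier H" "finite ?S"
    using a b monoid.m_closed[OF H] by (auto simp: group_ring_carrier)
  ultimately show ?thesis
    unfolding group_ring_carrier using finite_subset by blast
qed

text \<open>The monomials span. Most identities in the group ring are additive in each argument, so that this
  principle reduces them to monomials.\<close>

lemma group_ring_induct [consumes 1, case_names zero add]:
  fixes a :: "'h \<Rightarrow> 'k::field"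
  assumes "a \<in> carrier (group_ring H)"
    and zero: "P (\<lambda>x. 0)"
    and add: "\<And>c x a. x \<in> carrier H \<Longrightarrow> a \<in> carrier (group_ring H) \<Longrightarrow> P a \<Longrightarrow>
      P (\<lambda>y. gr_monom c x y + a y)"
  shows "P a"
proof -
  have "finite A \<Longrightarrow> supp a = A \<Longrightarrow> A \<subseteq> carrier H \<Longrightarrow> P a" for A and a :: "'h \<Rightarrow> 'k"
  proof (induction A arbitrary: a rule: finite_induct)
    case empty
    then have "a = (\<lambda>x. 0)" by auto
    then show ?case using zero by simp
  next
    case (insert x A)
    let ?b = "a(x := 0)"
    have supp: "supp ?b = A" using insert by auto
    then have "?b \<in> carrier (group_ring H)" using insert by (simp add: group_ring_carrier)
    moreover have "P ?b" using insert supp by simp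
    ultimately have "P (\<lambda>y. gr_monom (a x) x y + ?b y)"
      using insert.prems by (intro add) (auto simp del: fun_upd_apply)
    moreover have "(\<lambda>y. gr_monom (a x) x y + ?b y) = a" by (auto simp: gr_monom_def)
    ultimately show ?case by simp
  qed
  from this[of "supp a" a] show ?thesis using assms(1) by (simp add: group_ring_carrier)
qed

lemma gr_finite: "a \<in> carrier (group_ring H) \<Longrightarrow> finite (supp a)"
  by (simp add: group_ring_carrier)

lemma gr_monom_finite [simp]: "finite (supp (gr_monom c x))"
  by (auto simp: gr_monom_def intro: finite_subset[of _ "{x}"])

lemma group_ring_is_ring:
  fixes H :: "('h, 'm) monoid_scheme"
  assumes "monoid H"
  shows "ring (group_ring H :: ('h \<Rightarrow> 'k::field) ring)"
proof -
  interpret H: monoid H by (rule assms)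
  let ?R = "group_ring H :: ('h \<Rightarrow> 'k) ring"
  note simps = gr_monom_mult gr_mult_add_left gr_mult_add_right gr_finite[of _ H] gr_add_closed
    gr_monom_closed gr_mult_closed[OF assms] gr_zero_closed
  show ?thesis
  proof (rule ringI)
    show "abelian_group ?R"
    proof (rule abelian_groupI)
      fix a :: "'h \<Rightarrow> 'k" assume "a \<in> carrier ?R"
      then show "\<exists>b\<in>carrier ?R. b \<oplus>\<^bsub>?R\<^esub> a = \<zero>\<^bsub>?R\<^esub>"
        by (intro bexI[of _ "\<lambda>x. - a x"]) (auto simp: group_ring_carrier)
    qed (auto simp: algebra_simps simps)
    show "monoid ?R"
    proof (rule monoidI)
      fix a b c :: "'h \<Rightarrow> 'k"
      assume a: "a \<in> carrier ?R" and b: "b \<in> carrier ?R" and c: "c \<in> carrier ?R"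
      have 1: "gr_monom d x \<otimes>\<^bsub>?R\<^esub> gr_monom e y \<otimes>\<^bsub>?R\<^esub> c =
          gr_monom d x \<otimes>\<^bsub>?R\<^esub> (gr_monom e y \<otimes>\<^bsub>?R\<^esub> c)"
        if "x \<in> carrier H" "y \<in> carrier H" for d e x y
        using c that
        by (induction rule: group_ring_induct) (simp_all add: simps H.m_assoc mult.assoc)
      have 2: "gr_monom d x \<otimes>\<^bsub>?R\<^esub> b \<otimes>\<^bsub>?R\<^esub> c = gr_monom d x \<otimes>\<^bsub>?R\<^esub> (b \<otimes>\<^bsub>?R\<^esub> c)"
        if "x \<in> carrier H" for d x
        using b that c
        by (induction rule: group_ring_induct) (simp_all add: simps(2-) 1)
      show "a \<otimes>\<^bsub>?R\<^esub> b \<otimes>\<^bsub>?R\<^esub> c = a \<otimes>\<^bsub>?R\<^esub> (b \<otimes>\<^bsub>?R\<^esub> c)"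
        using a b c by (induction rule: group_ring_induct) (simp_all add: simps(2-) 2)
    next
      fix a :: "'h \<Rightarrow> 'k" assume a: "a \<in> carrier ?R"
      show "\<one>\<^bsub>?R\<^esub> \<otimes>\<^bsub>?R\<^esub> a = a"
        using a by (induction rule: group_ring_induct) (simp_all add: simps)
      show "a \<otimes>\<^bsub>?R\<^esub> \<one>\<^bsub>?R\<^esub> = a"
        using a by (induction rule: group_ring_induct) (simp_all add: simps)
    qed (auto simp: simps)
  qed (auto simp: simps)
qed

lemma gr_scalar_mult:
  assumes "monoid H" "a \<in> carrier (group_ring H)"
  shows "gr_monom c \<one>\<^bsub>H\<^esub> \<otimes>\<^bsub>group_ring H\<^esub> a = (\<lambda>x. c * a x)"
    and "a \<otimes>\<^bsub>group_ring H\<^esub> gr_monom c \<one>\<^bsub>H\<^esub> = (\<lambda>x. c * a x)"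
proof -
  interpret H: monoid H by (rule assms)
  have "c * gr_monom d y x = gr_monom (c * d) y x" for d y x
    by (auto simp: gr_monom_def)
  note simps = gr_mult_add_left gr_mult_add_right gr_finite gr_monom_mult distrib_left this mult.commute[of _ c]
  from assms(2) show "gr_monom c \<one>\<^bsub>H\<^esub> \<otimes>\<^bsub>group_ring H\<^esub> a = (\<lambda>x. c * a x)"
    by (induction rule: group_ring_induct) (simp_all add: simps)
  from assms(2) show "a \<otimes>\<^bsub>group_ring H\<^esub> gr_monom c \<one>\<^bsub>H\<^esub> = (\<lambda>x. c * a x)"
    by (induction rule: group_ring_induct) (simp_all add: simps)
qed

lemma gr_map_eq:
  assumes "finite A" "supp a \<subseteq> A"
  shows "gr_map \<phi> a y = (\<Sum>x\<in>A. if \<phi> x = y then a x else 0)"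
  unfolding gr_map_def using assms by (intro sum.mono_neutral_cong_left) auto

lemma gr_map_monom: "gr_map \<phi> (gr_monom c x) = gr_monom c (\<phi> x)"
proof
  fix y show "gr_map \<phi> (gr_monom c x) y = gr_monom c (\<phi> x) y"
    by (subst gr_map_eq[of "{x}"]) (auto simp: gr_monom_def)
qed

lemma gr_map_zero: "gr_map \<phi> (\<lambda>x. 0) = (\<lambda>x. 0)"
  by (simp add: gr_map_def)

lemma gr_map_add:
  assumes "finite (supp a)" "finite (supp b)"
  shows "gr_map \<phi> (\<lambda>x. a x + b x) = (\<lambda>y. gr_map \<phi> a y + gr_map \<phi> b y)"
proof
  fix y show "gr_map \<phi> (\<lambda>x. a x + b x) y = gr_map \<phi> a y + gr_map \<phi> b y"
    using assms by (subst (1 2 3) gr_map_eq[of "supp a \<union> supp b"])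
      (auto simp: sum.distrib[symmetric] intro!: sum.cong)
qed

lemma gr_map_closed:
  assumes "a \<in> carrier (group_ring H)" "\<phi> \<in> carrier H \<rightarrow> carrier K"
  shows "gr_map \<phi> a \<in> carrier (group_ring K)"
  using assms
proof (induction rule: group_ring_induct)
  case zero
  show ?case by (simp add: gr_map_zero gr_zero_closed)
next
  case (add c x a)
  then show ?case
    by (auto simp: gr_map_add gr_finite gr_map_monom intro!: gr_add_closed gr_monom_closed)
qed

lemma gr_map_cong:
  assumes "a \<in> carrier (group_ring H)" "\<And>x. x \<in> carrier H \<Longrightarrow> \<phi> x = \<psi> x"
  shows "gr_map \<phi> a = gr_map \<psi> a"
  using assms
  by (induction rule: group_ring_induct) (simp_all add: gr_map_add gr_finite gr_map_monom gr_map_zero)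

lemma gr_map_comp:
  fixes K :: "('l, 'n) monoid_scheme" and \<psi> :: "'h \<Rightarrow> 'l" and a :: "'h \<Rightarrow> 'k::field"
  assumes "a \<in> carrier (group_ring H)" "\<psi> \<in> carrier H \<rightarrow> carrier K"
  shows "gr_map \<phi> (gr_map \<psi> a) = gr_map (\<lambda>x. \<phi> (\<psi> x)) a"
  using assms(1)
proof (induction rule: group_ring_induct)
  case (add c x a)
  then show ?case
    using gr_map_closed[OF add(2) assms(2)] by (simp add: gr_map_add gr_finite gr_map_monom)
qed (simp add: gr_map_zero)

lemma gr_map_ident:
  assumes "a \<in> carrier (group_ring H)"
  shows "gr_map (\<lambda>x. x) a = a"
  using assms
  by (induction rule: group_ring_induct) (simp_all add: gr_map_add gr_finite gr_map_monom gr_map_zero)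

text \<open>Functoriality of the group ring.\<close>

lemma gr_map_ring_hom:
  fixes H :: "('h, 'm) monoid_scheme" and K :: "('l, 'n) monoid_scheme"
  assumes H: "monoid H" and K: "monoid K" and \<phi>: "\<phi> \<in> hom H K" and one: "\<phi> \<one>\<^bsub>H\<^esub> = \<one>\<^bsub>K\<^esub>"
  shows "(gr_map \<phi> :: ('h \<Rightarrow> 'k::field) \<Rightarrow> _) \<in> ring_hom (group_ring H) (group_ring K)"
proof (rule ring_hom_memI)
  have \<phi>': "\<phi> \<in> carrier H \<rightarrow> carrier K" using \<phi> by (simp add: hom_def)
  note closed = gr_map_closed[OF _ \<phi>'] gr_mult_closed[OF H] gr_mult_closed[OF K]
  note simps = gr_map_add gr_finite[of _ H] gr_finite[of _ K] closed gr_map_monom gr_monom_mult gr_mult_add_left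
    gr_mult_add_right gr_monom_closed gr_map_zero hom_mult[OF \<phi>]
  fix a b :: "'h \<Rightarrow> 'k"
  assume a: "a \<in> carrier (group_ring H)" and b: "b \<in> carrier (group_ring H)"
  have 1: "gr_map \<phi> (gr_monom c x \<otimes>\<^bsub>group_ring H\<^esub> b) =
      gr_monom c (\<phi> x) \<otimes>\<^bsub>group_ring K\<^esub> gr_map \<phi> b" if "x \<in> carrier H" for c x
    using b that
    by (induction rule: group_ring_induct) (simp_all add: simps monoid.m_closed[OF H])
  show "gr_map \<phi> (a \<otimes>\<^bsub>group_ring H\<^esub> b) = gr_map \<phi> a \<otimes>\<^bsub>group_ring K\<^esub> gr_map \<phi> b"
    using a b 1
    by (induction rule: group_ring_induct) (simp_all add: simps monoid.m_closed[OF H])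
qed (use assms in \<open>auto simp: gr_map_add gr_finite[of _ H] gr_finite[of _ K] gr_map_monom hom_def intro!: gr_map_closed\<close>)

text \<open>The augmentation is the map induced by the homomorphism to the trivial group, up to
  identifying the group ring of the latter with the field.\<close>

lemma augmentation_eq: "augmentation a = gr_map (\<lambda>_. ()) a ()"
  by (simp add: augmentation_def gr_map_def)

lemma augmentation_simps:
  "augmentation (\<lambda>x. 0) = 0" "augmentation (gr_monom c x) = c"
  "finite (supp a) \<Longrightarrow> finite (supp b) \<Longrightarrow>
     augmentation (\<lambda>x. a x + b x) = augmentation a + augmentation b"
  by (simp_all add: augmentation_eq gr_map_zero gr_map_monom gr_map_add) (simp add: gr_monom_def)

lemma augmentation_mult:
  assumes "monoid H" "a \<in> carrier (group_ring H)" "b \<in> carrier (group_ring H)"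
  shows "augmentation (a \<otimes>\<^bsub>group_ring H\<^esub> b) = augmentation a * augmentation b"
proof -
  note simps = augmentation_simps gr_finite[of _ H] gr_monom_mult gr_mult_add_left
    gr_mult_add_right gr_monom_closed gr_mult_closed[OF assms(1)] distrib_left distrib_right
  have 1: "augmentation (gr_monom c x \<otimes>\<^bsub>group_ring H\<^esub> b) = c * augmentation b"
    if "x \<in> carrier H" for c x
    using assms(3) that by (induction rule: group_ring_induct) (simp_all add: simps)
  show ?thesis
    using assms(2,3) 1 by (induction rule: group_ring_induct) (simp_all add: simps)
qed

lemma augmentation_gr_map:
  fixes K :: "('l, 'n) monoid_scheme"
  assumes "a \<in> carrier (group_ring H)" "\<phi> \<in> carrier H \<rightarrow> carrier K"
  shows "augmentation (gr_map \<phi> a) = augmentation a"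
  using assms(1)
proof (induction rule: group_ring_induct)
  case (add c x a)
  then show ?case
    using gr_map_closed[OF add(2) assms(2)]
    by (simp add: gr_map_add gr_finite gr_map_monom augmentation_simps)
qed (simp add: gr_map_zero augmentation_simps)

section \<open>Modules, quotients and representations\<close>

lemma additive_map_zero:
  assumes "abelian_group M" "abelian_group N" "f \<in> carrier M \<rightarrow> carrier N"
    and "\<And>v w. v \<in> carrier M \<Longrightarrow> w \<in> carrier M \<Longrightarrow> f (v \<oplus>\<^bsub>M\<^esub> w) = f v \<oplus>\<^bsub>N\<^esub> f w"
  shows "f \<zero>\<^bsub>M\<^esub> = \<zero>\<^bsub>N\<^esub>"
proof -
  interpret M: abelian_group M by fact
  interpret N: abelian_group N by fact
  have c: "f \<zero>\<^bsub>M\<^esub> \<in> carrier N" using assms(3) by auto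
  have "f \<zero>\<^bsub>M\<^esub> \<oplus>\<^bsub>N\<^esub> f \<zero>\<^bsub>M\<^esub> = f \<zero>\<^bsub>M\<^esub>"
    using assms(4)[of "\<zero>\<^bsub>M\<^esub>" "\<zero>\<^bsub>M\<^esub>"] by simp
  then show ?thesis using c N.add.l_cancel_one by metis
qed

lemma additive_map_minus:
  assumes M: "abelian_group M" and N: "abelian_group N" and f: "f \<in> carrier M \<rightarrow> carrier N"
    and add: "\<And>v w. v \<in> carrier M \<Longrightarrow> w \<in> carrier M \<Longrightarrow> f (v \<oplus>\<^bsub>M\<^esub> w) = f v \<oplus>\<^bsub>N\<^esub> f w"
    and v: "v \<in> carrier M"
  shows "f (\<ominus>\<^bsub>M\<^esub> v) = \<ominus>\<^bsub>N\<^esub> f v"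
proof -
  interpret M: abelian_group M by fact
  interpret N: abelian_group N by fact
  have "f (\<ominus>\<^bsub>M\<^esub> v) \<oplus>\<^bsub>N\<^esub> f v = \<zero>\<^bsub>N\<^esub>"
    using add[of "\<ominus>\<^bsub>M\<^esub> v" v] v additive_map_zero[OF M N f add] by (simp add: M.l_neg)
  then show ?thesis
    using f v by (intro N.minus_equality[symmetric]) auto
qed

lemma additive_map_finsum:
  assumes M: "abelian_group M" and N: "abelian_group N" and f: "f \<in> carrier M \<rightarrow> carrier N"
    and add: "\<And>v w. v \<in> carrier M \<Longrightarrow> w \<in> carrier M \<Longrightarrow> f (v \<oplus>\<^bsub>M\<^esub> w) = f v \<oplus>\<^bsub>N\<^esub> f w"
    and A: "finite A" and g: "g \<in> A \<rightarrow> carrier M"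
  shows "f (finsum M g A) = finsum N (\<lambda>x. f (g x)) A"
proof -
  interpret M: abelian_group M by fact
  interpret N: abelian_group N by fact
  show ?thesis using A g
  proof (induction A rule: finite_induct)
    case empty
    then show ?case using additive_map_zero[OF M N f add] by simp
  next
    case (insert x A)
    then have "g x \<in> carrier M" "g \<in> A \<rightarrow> carrier M" "(\<lambda>x. f (g x)) \<in> A \<rightarrow> carrier N"
      "f (g x) \<in> carrier N" "finsum M g A \<in> carrier M"
      using f by (auto intro!: M.finsum_closed)
    with insert add show ?case by simp
  qed
qed

context left_module
begin

lemma smult_r_null [simp]: "a \<in> carrier R \<Longrightarrow> a \<odot>\<^bsub>M\<^esub> \<zero>\<^bsub>M\<^esub> = \<zero>\<^bsub>M\<^esub>"
  by (rule additive_map_zero) (auto simp: smult_closed smult_r_distr intro: M.abelian_group_axioms)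

lemma smult_l_null [simp]: "v \<in> carrier M \<Longrightarrow> \<zero> \<odot>\<^bsub>M\<^esub> v = \<zero>\<^bsub>M\<^esub>"
  by (rule additive_map_zero[of R M "\<lambda>a. a \<odot>\<^bsub>M\<^esub> v"])
     (auto simp: smult_closed smult_l_distr intro: M.abelian_group_axioms R.abelian_group_axioms)

lemma smult_l_minus:
  "a \<in> carrier R \<Longrightarrow> v \<in> carrier M \<Longrightarrow> (\<ominus> a) \<odot>\<^bsub>M\<^esub> v = \<ominus>\<^bsub>M\<^esub> (a \<odot>\<^bsub>M\<^esub> v)"
  by (rule additive_map_minus[of R M "\<lambda>a. a \<odot>\<^bsub>M\<^esub> v"])
     (auto simp: smult_closed smult_l_distr intro: M.abelian_group_axioms R.abelian_group_axioms)

end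

lemma restrict_scalars_simps [simp]:
  "carrier (restrict_scalars \<phi> M) = carrier M"
  "\<zero>\<^bsub>restrict_scalars \<phi> M\<^esub> = \<zero>\<^bsub>M\<^esub>"
  "v \<oplus>\<^bsub>restrict_scalars \<phi> M\<^esub> w = v \<oplus>\<^bsub>M\<^esub> w"
  "r \<odot>\<^bsub>restrict_scalars \<phi> M\<^esub> v = \<phi> r \<odot>\<^bsub>M\<^esub> v"
  by (simp_all add: restrict_scalars_def)

lemma abelian_group_transfer:
  assumes "abelian_group M" "carrier N = carrier M" "\<zero>\<^bsub>N\<^esub> = \<zero>\<^bsub>M\<^esub>"
    "\<And>v w. v \<oplus>\<^bsub>N\<^esub> w = v \<oplus>\<^bsub>M\<^esub> w"
  shows "abelian_group N"
proof -
  interpret M: abelian_group M by fact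
  show ?thesis
    by (rule abelian_groupI)
       (auto simp: assms M.a_ac intro: M.add.l_inv_ex)
qed

lemma left_module_restrict_scalars:
  assumes "left_module S M" "ring R" "\<phi> \<in> ring_hom R S"
  shows "left_module R (restrict_scalars \<phi> M)"
proof -
  interpret M: left_module S M by fact
  have "abelian_group (restrict_scalars \<phi> M)"
    by (rule abelian_group_transfer[OF M.M.abelian_group_axioms]) simp_all
  then show ?thesis
    using assms(2) ring_hom_closed[OF assms(3)] ring_hom_add[OF assms(3)]
      ring_hom_mult[OF assms(3)] ring_hom_one[OF assms(3)]
    by (intro left_module.intro left_module_axioms.intro)
       (auto simp: M.smult_closed M.smult_l_distr M.smult_r_distr M.smult_assoc M.smult_one)
qed

lemma (in left_module) submoduleI:
  assumes "W \<subseteq> carrier M" "\<zero>\<^bsub>M\<^esub> \<in> W"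
    and "\<And>v w. v \<in> W \<Longrightarrow> w \<in> W \<Longrightarrow> v \<oplus>\<^bsub>M\<^esub> w \<in> W"
    and smult: "\<And>a v. a \<in> carrier R \<Longrightarrow> v \<in> W \<Longrightarrow> a \<odot>\<^bsub>M\<^esub> v \<in> W"
  shows "submodule W R M"
proof -
  \<comment> \<open>Closure under negation is closure under the scalar \<open>- 1\<close>.\<close>
  have "\<ominus>\<^bsub>M\<^esub> v \<in> W" if "v \<in> W" for v
    using smult[of "\<ominus> \<one>" v] that assms(1) smult_l_minus[of "\<one>" v] smult_one[of v] by auto
  then show ?thesis
    using assms
    by (intro submodule.intro subgroup.intro submodule_axioms.intro) (auto simp: a_inv_def)
qed

lemma (in left_module) submodule_props:
  assumes "submodule W R M"
  shows "W \<subseteq> carrier M" "\<zero>\<^bsub>M\<^esub> \<in> W"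
    and "v \<in> W \<Longrightarrow> w \<in> W \<Longrightarrow> v \<oplus>\<^bsub>M\<^esub> w \<in> W"
    and "a \<in> carrier R \<Longrightarrow> v \<in> W \<Longrightarrow> a \<odot>\<^bsub>M\<^esub> v \<in> W"
    and "v \<in> W \<Longrightarrow> \<ominus>\<^bsub>M\<^esub> v \<in> W"
proof -
  interpret W: submodule W R M by fact
  show "W \<subseteq> carrier M" "\<zero>\<^bsub>M\<^esub> \<in> W" "v \<in> W \<Longrightarrow> w \<in> W \<Longrightarrow> v \<oplus>\<^bsub>M\<^esub> w \<in> W"
    "a \<in> carrier R \<Longrightarrow> v \<in> W \<Longrightarrow> a \<odot>\<^bsub>M\<^esub> v \<in> W" "v \<in> W \<Longrightarrow> \<ominus>\<^bsub>M\<^esub> v \<in> W"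
    using W.subset W.one_closed W.m_closed W.smult_closed W.m_inv_closed
    by (auto simp: a_inv_def)
qed

lemma quotient_module_simps [simp]:
  "carrier (quotient_module M N) = a_rcosets\<^bsub>M\<^esub> N"
  "\<zero>\<^bsub>quotient_module M N\<^esub> = N"
  "C \<oplus>\<^bsub>quotient_module M N\<^esub> D = C <+>\<^bsub>M\<^esub> D"
  by (simp_all add: quotient_module_def)

context left_module
begin

lemma quotient_coset_eq:
  assumes N: "submodule N R M" and v: "v \<in> carrier M" and w: "w \<in> N +>\<^bsub>M\<^esub> v"
  shows "w \<in> carrier M" "N +>\<^bsub>M\<^esub> w = N +>\<^bsub>M\<^esub> v"
proof -
  interpret N: submodule N R M by fact
  note sub = N.is_subgroup
  show "w \<in> carrier M"
    using w v submodule_props(1)[OF N] by (auto simp: a_r_coset_def r_coset_def)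
  show "N +>\<^bsub>M\<^esub> w = N +>\<^bsub>M\<^esub> v"
    using M.add.repr_independence[OF w[unfolded a_r_coset_def] v sub] by (simp add: a_r_coset_def)
qed

text \<open>The scalar multiplication of the quotient is defined by acting on all elements of a coset; as the
  submodule is stable, all of them give the same coset.\<close>

lemma quotient_smult:
  assumes N: "submodule N R M" and r: "r \<in> carrier R" and v: "v \<in> carrier M"
  shows "r \<odot>\<^bsub>quotient_module M N\<^esub> (N +>\<^bsub>M\<^esub> v) = N +>\<^bsub>M\<^esub> (r \<odot>\<^bsub>M\<^esub> v)"
proof -
  have "N +>\<^bsub>M\<^esub> (r \<odot>\<^bsub>M\<^esub> w) = N +>\<^bsub>M\<^esub> (r \<odot>\<^bsub>M\<^esub> v)" if w: "w \<in> N +>\<^bsub>M\<^esub> v" for w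
  proof -
    obtain u where u: "u \<in> N" "w = u \<oplus>\<^bsub>M\<^esub> v"
      using w by (auto simp: a_r_coset_def r_coset_def)
    have uM: "u \<in> carrier M" using u submodule_props(1)[OF N] by auto
    have "r \<odot>\<^bsub>M\<^esub> w = r \<odot>\<^bsub>M\<^esub> u \<oplus>\<^bsub>M\<^esub> r \<odot>\<^bsub>M\<^esub> v"
      using u r v uM by (simp add: smult_r_distr)
    then have "r \<odot>\<^bsub>M\<^esub> w \<in> N +>\<^bsub>M\<^esub> (r \<odot>\<^bsub>M\<^esub> v)"
      using submodule_props(4)[OF N r u(1)] by (auto simp: a_r_coset_def r_coset_def)
    with N r v show ?thesis by (intro quotient_coset_eq(2)) (auto simp: smult_closed)
  qed
  moreover have "v \<in> N +>\<^bsub>M\<^esub> v"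
    using submodule_props(2)[OF N] v by (force simp: a_r_coset_def r_coset_def)
  ultimately have "(\<lambda>v. N +>\<^bsub>M\<^esub> (r \<odot>\<^bsub>M\<^esub> v)) ` (N +>\<^bsub>M\<^esub> v) = {N +>\<^bsub>M\<^esub> (r \<odot>\<^bsub>M\<^esub> v)}"
    by blast
  then show ?thesis by (simp add: quotient_module_def)
qed

lemma quotient_carrier: "a_rcosets\<^bsub>M\<^esub> N = (\<lambda>v. N +>\<^bsub>M\<^esub> v) ` carrier M"
  by (auto simp: A_RCOSETS_def RCOSETS_def a_r_coset_def)

lemma quotient_add:
  assumes N: "submodule N R M" and "v \<in> carrier M" "w \<in> carrier M"
  shows "(N +>\<^bsub>M\<^esub> v) <+>\<^bsub>M\<^esub> (N +>\<^bsub>M\<^esub> w) = N +>\<^bsub>M\<^esub> (v \<oplus>\<^bsub>M\<^esub> w)"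
proof -
  interpret N: submodule N R M by fact
  show ?thesis
    using normal.rcos_sum[OF comm_group.subgroup_imp_normal[OF M.a_comm_group N.is_subgroup], of v w] assms
    by (simp add: a_r_coset_def set_add_def)
qed

lemma left_module_quotient:
  assumes N: "submodule N R M"
  shows "left_module R (quotient_module M N)"
proof -
  interpret N: submodule N R M by fact
  let ?Q = "quotient_module M N"
  have zero: "N +>\<^bsub>M\<^esub> \<zero>\<^bsub>M\<^esub> = N"
    using submodule_props(1)[OF N] by (force simp: a_r_coset_def r_coset_def)
  note add = quotient_add[OF N]
  have "abelian_group ?Q"
  proof (rule abelian_groupI)
    fix C assume "C \<in> carrier ?Q"
    then obtain v where v: "v \<in> carrier M" "C = N +>\<^bsub>M\<^esub> v" by (auto simp: quotient_carrier)
    then show "\<exists>D\<in>carrier ?Q. D \<oplus>\<^bsub>?Q\<^esub> C = \<zero>\<^bsub>?Q\<^esub>"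
      by (intro bexI[of _ "N +>\<^bsub>M\<^esub> (\<ominus>\<^bsub>M\<^esub> v)"]) (auto simp: quotient_carrier add M.l_neg zero)
    show "\<zero>\<^bsub>?Q\<^esub> \<oplus>\<^bsub>?Q\<^esub> C = C"
      using v add[of "\<zero>\<^bsub>M\<^esub>" v] by (simp add: zero)
  next
    show "\<zero>\<^bsub>?Q\<^esub> \<in> carrier ?Q"
      using zero by (auto simp: quotient_carrier intro: image_eqI[of _ _ "\<zero>\<^bsub>M\<^esub>"])
  qed (auto simp: quotient_carrier add M.a_ac)
  then show ?thesis
    by (intro left_module.intro left_module_axioms.intro R.ring_axioms)
       (auto simp: quotient_carrier add quotient_smult[OF N] smult_closed smult_l_distr
         smult_r_distr smult_assoc smult_one)
qed

end

text \<open>A linear representation of \<open>H\<close>, given by the scalings \<open>S c\<close> and the operators \<open>A h\<close>, is the same as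
  a module over the group ring of \<open>H\<close>. The scalar field enters only through \<open>S\<close>, so that the underlying
  abelian group can be any construction that carries a scaling, such as a tensor product.\<close>

locale representation = T?: abelian_group T + H?: monoid H
  for T :: "('w, 't) ring_scheme" and H :: "('h, 'm) monoid_scheme" +
  fixes S :: "'k::field \<Rightarrow> 'w \<Rightarrow> 'w" and A :: "'h \<Rightarrow> 'w \<Rightarrow> 'w"
  assumes S_closed: "w \<in> carrier T \<Longrightarrow> S c w \<in> carrier T"
    and S_add_r: "v \<in> carrier T \<Longrightarrow> w \<in> carrier T \<Longrightarrow> S c (v \<oplus>\<^bsub>T\<^esub> w) = S c v \<oplus>\<^bsub>T\<^esub> S c w"
    and S_add_l: "w \<in> carrier T \<Longrightarrow> S (c + d) w = S c w \<oplus>\<^bsub>T\<^esub> S d w"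
    and S_mult: "w \<in> carrier T \<Longrightarrow> S (c * d) w = S c (S d w)"
    and S_one: "w \<in> carrier T \<Longrightarrow> S 1 w = w"
    and A_closed: "h \<in> carrier H \<Longrightarrow> w \<in> carrier T \<Longrightarrow> A h w \<in> carrier T"
    and A_add: "h \<in> carrier H \<Longrightarrow> v \<in> carrier T \<Longrightarrow> w \<in> carrier T \<Longrightarrow>
      A h (v \<oplus>\<^bsub>T\<^esub> w) = A h v \<oplus>\<^bsub>T\<^esub> A h w"
    and A_mult: "h \<in> carrier H \<Longrightarrow> h' \<in> carrier H \<Longrightarrow> w \<in> carrier T \<Longrightarrow>
      A (h \<otimes>\<^bsub>H\<^esub> h') w = A h (A h' w)"
    and A_one: "w \<in> carrier T \<Longrightarrow> A \<one>\<^bsub>H\<^esub> w = w"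
    and A_S: "h \<in> carrier H \<Longrightarrow> w \<in> carrier T \<Longrightarrow> A h (S c w) = S c (A h w)"
begin

definition act :: "('h \<Rightarrow> 'k) \<Rightarrow> 'w \<Rightarrow> 'w" where
  "act a w = (\<Oplus>\<^bsub>T\<^esub>h\<in>supp a. S (a h) (A h w))"

lemma S_zero: "w \<in> carrier T \<Longrightarrow> S 0 w = \<zero>\<^bsub>T\<^esub>"
  using S_add_l[of w 0 0] S_closed[of w 0] T.add.l_cancel_one by simp

lemma act_eq:
  assumes "finite B" "supp a \<subseteq> B" "B \<subseteq> carrier H" "w \<in> carrier T"
  shows "act a w = (\<Oplus>\<^bsub>T\<^esub>h\<in>B. S (a h) (A h w))"
  unfolding act_def using assms
  by (intro T.add.finprod_mono_neutral_cong_left) (auto simp: S_zero A_closed S_closed)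

lemma act_monom: "h \<in> carrier H \<Longrightarrow> w \<in> carrier T \<Longrightarrow> act (gr_monom c h) w = S c (A h w)"
  by (subst act_eq[of "{h}"]) (auto simp: gr_monom_def S_closed A_closed)

lemma act_zero: "act (\<lambda>h. 0) w = \<zero>\<^bsub>T\<^esub>"
  by (simp add: act_def)

lemma act_closed:
  assumes "a \<in> carrier (group_ring H)" "w \<in> carrier T"
  shows "act a w \<in> carrier T"
  unfolding act_def using assms
  by (intro T.finsum_closed) (auto simp: group_ring_carrier S_closed A_closed)

lemma act_add_l:
  assumes "a \<in> carrier (group_ring H)" "b \<in> carrier (group_ring H)" "w \<in> carrier T"
  shows "act (\<lambda>h. a h + b h) w = act a w \<oplus>\<^bsub>T\<^esub> act b w"
proof -
  let ?B = "supp a \<union> supp b"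
  have *: "finite ?B" "?B \<subseteq> carrier H" using assms by (auto simp: group_ring_carrier)
  have closed: "(\<lambda>h. S (c h) (A h w)) \<in> ?B \<rightarrow> carrier T" for c
    using *(2) assms(3) by (intro funcsetI S_closed A_closed) blast+
  have "act (\<lambda>h. a h + b h) w = (\<Oplus>\<^bsub>T\<^esub>h\<in>?B. S (a h + b h) (A h w))"
    using * assms by (intro act_eq) auto
  also have "\<dots> = (\<Oplus>\<^bsub>T\<^esub>h\<in>?B. S (a h) (A h w) \<oplus>\<^bsub>T\<^esub> S (b h) (A h w))"
    using * assms closed by (intro T.finsum_cong' S_add_l A_closed T.add.m_closed funcsetI) auto
  also have "\<dots> = (\<Oplus>\<^bsub>T\<^esub>h\<in>?B. S (a h) (A h w)) \<oplus>\<^bsub>T\<^esub> (\<Oplus>\<^bsub>T\<^esub>h\<in>?B. S (b h) (A h w))"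
    by (rule T.finsum_addf[OF closed closed])
  also have "\<dots> = act a w \<oplus>\<^bsub>T\<^esub> act b w"
    using * assms by (subst (1 2) act_eq[of ?B]) auto
  finally show ?thesis .
qed

lemma act_add_r:
  assumes "a \<in> carrier (group_ring H)" "v \<in> carrier T" "w \<in> carrier T"
  shows "act a (v \<oplus>\<^bsub>T\<^esub> w) = act a v \<oplus>\<^bsub>T\<^esub> act a w"
  using assms
proof (induction rule: group_ring_induct)
  case (add c h a)
  then show ?case
    by (simp add: act_add_l gr_monom_closed act_monom A_add S_add_r A_closed S_closed act_closed
        T.add.m_ac)
qed (simp add: act_zero)

lemma act_mult:
  assumes "a \<in> carrier (group_ring H)" "b \<in> carrier (group_ring H)" "w \<in> carrier T"
  shows "act (a \<otimes>\<^bsub>group_ring H\<^esub> b) w = act a (act b w)"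
proof -
  note simps = act_add_l gr_monom_closed act_monom A_add S_add_r A_closed S_closed act_closed
    gr_mult_add_left gr_mult_add_right gr_finite[of _ H] gr_monom_mult gr_mult_closed[OF H.monoid_axioms]
    act_zero A_mult S_mult A_S
  have S0: "S c \<zero>\<^bsub>T\<^esub> = \<zero>\<^bsub>T\<^esub>" for c
    by (rule additive_map_zero) (auto simp: S_closed S_add_r intro: T.abelian_group_axioms)
  have A0: "A h \<zero>\<^bsub>T\<^esub> = \<zero>\<^bsub>T\<^esub>" if "h \<in> carrier H" for h
    by (rule additive_map_zero) (auto simp: A_closed A_add that intro: T.abelian_group_axioms)
  have 1: "act (gr_monom c h \<otimes>\<^bsub>group_ring H\<^esub> b) w = S c (A h (act b w))"
    if "h \<in> carrier H" for c h
    using assms(2,3) that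
    by (induction rule: group_ring_induct) (simp_all add: simps S0 A0)
  show ?thesis
    using assms 1 by (induction rule: group_ring_induct) (simp_all add: simps)
qed

lemma left_module_act:
  "left_module (group_ring H) \<lparr>carrier = carrier T, monoid.mult = p, one = q, ring.zero = \<zero>\<^bsub>T\<^esub>,
     add = add T, smult = act\<rparr>" (is "left_module _ ?M")
proof -
  have "abelian_group ?M"
    by (rule abelian_group_transfer[OF T.abelian_group_axioms]) simp_all
  then show ?thesis
    using group_ring_is_ring[OF H.monoid_axioms]
    by (intro left_module.intro left_module_axioms.intro)
       (auto simp: act_closed act_add_l act_add_r act_mult act_monom S_one A_one)
qed

end

section \<open>Tensor products\<close>

locale tensor_product = M?: abelian_group M + N?: abelian_group N
  for R :: "('r, 'a) ring_scheme" and M :: "('r, 'u, 'b) module_scheme"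
    and N :: "('r, 'v, 'c) module_scheme" +
  assumes M_smult_closed: "r \<in> carrier R \<Longrightarrow> m \<in> carrier M \<Longrightarrow> r \<odot>\<^bsub>M\<^esub> m \<in> carrier M"
    and N_smult_closed: "r \<in> carrier R \<Longrightarrow> v \<in> carrier N \<Longrightarrow> r \<odot>\<^bsub>N\<^esub> v \<in> carrier N"
begin

abbreviation "A \<equiv> free_Abelian_group (carrier M \<times> carrier N)"
abbreviation "K \<equiv> tensor_kernel R M N"
abbreviation "T \<equiv> tensor R M N"

definition pure :: "'u \<Rightarrow> 'v \<Rightarrow> (('u \<times> 'v) \<Rightarrow>\<^sub>0 int) set" where
  "pure m v = K #>\<^bsub>A\<^esub> frag_of (m, v)"

lemma tensor_simps [simp]:
  "carrier T = rcosets\<^bsub>A\<^esub> K" "\<zero>\<^bsub>T\<^esub> = K" "C \<oplus>\<^bsub>T\<^esub> D = C <#>\<^bsub>A\<^esub> D"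
  by (simp_all add: tensor_def Let_def)

definition relators :: "(('u \<times> 'v) \<Rightarrow>\<^sub>0 int) set" where
  "relators =
     {frag_of (m \<oplus>\<^bsub>M\<^esub> m', v) - frag_of (m, v) - frag_of (m', v) | m m' v.
         m \<in> carrier M \<and> m' \<in> carrier M \<and> v \<in> carrier N} \<union>
      {frag_of (m, v \<oplus>\<^bsub>N\<^esub> v') - frag_of (m, v) - frag_of (m, v') | m v v'.
         m \<in> carrier M \<and> v \<in> carrier N \<and> v' \<in> carrier N} \<union>
      {frag_of (r \<odot>\<^bsub>M\<^esub> m, v) - frag_of (m, r \<odot>\<^bsub>N\<^esub> v) | r m v.
         r \<in> carrier R \<and> m \<in> carrier M \<and> v \<in> carrier N}"

lemma K_eq: "K = generate A relators"
  by (simp add: tensor_kernel_def relators_def)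

sublocale A: comm_group A
  by (rule abelian_free_Abelian_group)

lemma relators_in_K:
  "m \<in> carrier M \<Longrightarrow> m' \<in> carrier M \<Longrightarrow> v \<in> carrier N \<Longrightarrow>
     frag_of (m \<oplus>\<^bsub>M\<^esub> m', v) - frag_of (m, v) - frag_of (m', v) \<in> K"
  "m \<in> carrier M \<Longrightarrow> v \<in> carrier N \<Longrightarrow> v' \<in> carrier N \<Longrightarrow>
     frag_of (m, v \<oplus>\<^bsub>N\<^esub> v') - frag_of (m, v) - frag_of (m, v') \<in> K"
  "r \<in> carrier R \<Longrightarrow> m \<in> carrier M \<Longrightarrow> v \<in> carrier N \<Longrightarrow>
     frag_of (r \<odot>\<^bsub>M\<^esub> m, v) - frag_of (m, r \<odot>\<^bsub>N\<^esub> v) \<in> K"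
  unfolding K_eq relators_def by (rule generate.incl, blast)+

lemma diff_in_A: "x \<in> carrier A \<Longrightarrow> y \<in> carrier A \<Longrightarrow> x - y \<in> carrier A"
  using keys_diff[of x y] by auto

lemma frag_of_in_A: "m \<in> carrier M \<Longrightarrow> v \<in> carrier N \<Longrightarrow> frag_of (m, v) \<in> carrier A"
  by simp

lemma relators_in_A: "relators \<subseteq> carrier A"
proof -
  note [simp del] = carrier_free_Abelian_group_iff
  show ?thesis unfolding relators_def
    by (auto intro!: diff_in_A frag_of_in_A M_smult_closed N_smult_closed)
qed

lemma subgroup_K: "subgroup K A"
  unfolding K_eq by (rule A.generate_is_subgroup[OF relators_in_A])

lemma K_subset: "K \<subseteq> carrier A"
  by (rule subgroup.subset[OF subgroup_K])

lemma coset_eq: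
  assumes "x \<in> carrier A" "y \<in> carrier A" "x - y \<in> K"
  shows "K #>\<^bsub>A\<^esub> x = K #>\<^bsub>A\<^esub> y"
proof -
  have "x = (x - y) \<otimes>\<^bsub>A\<^esub> y" by simp
  then have "x \<in> K #>\<^bsub>A\<^esub> y" using assms(3) unfolding r_coset_def by blast
  then show ?thesis using A.repr_independence[OF _ assms(2) subgroup_K] by simp
qed

lemma coset_add:
  "x \<in> carrier A \<Longrightarrow> y \<in> carrier A \<Longrightarrow> (K #>\<^bsub>A\<^esub> x) \<oplus>\<^bsub>T\<^esub> (K #>\<^bsub>A\<^esub> y) = K #>\<^bsub>A\<^esub> (x + y)"
  using normal.rcos_sum[OF A.subgroup_imp_normal[OF subgroup_K]] by simp

lemma coset_closed: "x \<in> carrier A \<Longrightarrow> K #>\<^bsub>A\<^esub> x \<in> carrier T"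
  using A.rcosetsI[OF K_subset] by simp

lemma coset_of_K: "x \<in> K \<Longrightarrow> K #>\<^bsub>A\<^esub> x = K"
  using A.coset_join2 subgroup_K K_subset by blast

sublocale T: abelian_group T
proof -
  have "comm_group (A Mod K)"
    by (rule A.abelian_FactGroup[OF subgroup_K])
  then have "comm_group (add_monoid T)"
    by (simp add: FactGroup_def tensor_def Let_def)
  then show "abelian_group T"
    by (rule comm_group_abelian_groupI)
qed

lemma T_cases:
  assumes "w \<in> carrier T"
  obtains c where "c \<in> carrier A" "w = K #>\<^bsub>A\<^esub> c"
  using assms by (auto simp: RCOSETS_def)

lemma pure_closed [simp]: "m \<in> carrier M \<Longrightarrow> v \<in> carrier N \<Longrightarrow> pure m v \<in> carrier T"
  unfolding pure_def by (rule coset_closed) simp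

lemma pure_add_l:
  assumes "m \<in> carrier M" "m' \<in> carrier M" "v \<in> carrier N"
  shows "pure (m \<oplus>\<^bsub>M\<^esub> m') v = pure m v \<oplus>\<^bsub>T\<^esub> pure m' v"
proof -
  have "frag_of (m \<oplus>\<^bsub>M\<^esub> m', v) - frag_of (m, v) - frag_of (m', v) \<in> K"
    using assms by (intro relators_in_K)
  moreover have "frag_of (m, v) + frag_of (m', v) \<in> carrier A"
    using A.m_closed[OF frag_of_in_A frag_of_in_A] assms by simp
  ultimately have "K #>\<^bsub>A\<^esub> frag_of (m \<oplus>\<^bsub>M\<^esub> m', v) = K #>\<^bsub>A\<^esub> (frag_of (m, v) + frag_of (m', v))"
    using assms by (intro coset_eq) (auto simp: diff_diff_eq)
  also have "\<dots> = pure m v \<oplus>\<^bsub>T\<^esub> pure m' v"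
    unfolding pure_def by (intro coset_add[symmetric] frag_of_in_A assms)
  finally show ?thesis unfolding pure_def .
qed

lemma pure_add_r:
  assumes "m \<in> carrier M" "v \<in> carrier N" "v' \<in> carrier N"
  shows "pure m (v \<oplus>\<^bsub>N\<^esub> v') = pure m v \<oplus>\<^bsub>T\<^esub> pure m v'"
proof -
  have "frag_of (m, v \<oplus>\<^bsub>N\<^esub> v') - frag_of (m, v) - frag_of (m, v') \<in> K"
    using assms by (intro relators_in_K)
  moreover have "frag_of (m, v) + frag_of (m, v') \<in> carrier A"
    using A.m_closed[OF frag_of_in_A frag_of_in_A] assms by simp
  ultimately have "K #>\<^bsub>A\<^esub> frag_of (m, v \<oplus>\<^bsub>N\<^esub> v') = K #>\<^bsub>A\<^esub> (frag_of (m, v) + frag_of (m, v'))"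
    using assms by (intro coset_eq) (auto simp: diff_diff_eq)
  also have "\<dots> = pure m v \<oplus>\<^bsub>T\<^esub> pure m v'"
    unfolding pure_def by (intro coset_add[symmetric] frag_of_in_A assms)
  finally show ?thesis unfolding pure_def .
qed

lemma pure_balanced:
  assumes "r \<in> carrier R" "m \<in> carrier M" "v \<in> carrier N"
  shows "pure (r \<odot>\<^bsub>M\<^esub> m) v = pure m (r \<odot>\<^bsub>N\<^esub> v)"
  unfolding pure_def
proof (rule coset_eq)
  show "frag_of (r \<odot>\<^bsub>M\<^esub> m, v) - frag_of (m, r \<odot>\<^bsub>N\<^esub> v) \<in> K"
    using assms by (intro relators_in_K)
qed (use assms in \<open>auto intro: M_smult_closed N_smult_closed\<close>)

lemma tensor_induct [consumes 1, case_names zero pure diff]: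
  assumes "w \<in> carrier T" "P \<zero>\<^bsub>T\<^esub>"
    and "\<And>m v. m \<in> carrier M \<Longrightarrow> v \<in> carrier N \<Longrightarrow> P (pure m v)"
    and diff: "\<And>w w'. w \<in> carrier T \<Longrightarrow> w' \<in> carrier T \<Longrightarrow> P w \<Longrightarrow> P w' \<Longrightarrow> P (w \<ominus>\<^bsub>T\<^esub> w')"
  shows "P w"
proof -
  obtain c where c: "c \<in> carrier A" "w = K #>\<^bsub>A\<^esub> c" using assms(1) by (rule T_cases)
  have "Poly_Mapping.keys c \<subseteq> carrier M \<times> carrier N"
    using c(1) by simp
  then have "P (K #>\<^bsub>A\<^esub> c)"
  proof (rule free_Abelian_group_induct)
    show "P (K #>\<^bsub>A\<^esub> 0)"
      using assms(2) coset_of_K subgroup.one_closed[OF subgroup_K] by simp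
  next
    fix x y
    let ?x = "K #>\<^bsub>A\<^esub> x" and ?y = "K #>\<^bsub>A\<^esub> y" and ?z = "K #>\<^bsub>A\<^esub> (x - y)"
    assume keys: "Poly_Mapping.keys x \<subseteq> carrier M \<times> carrier N"
      "Poly_Mapping.keys y \<subseteq> carrier M \<times> carrier N" and P: "P ?x" "P ?y"
    then have x: "x \<in> carrier A" and y: "y \<in> carrier A" by simp_all
    have z': "?z \<oplus>\<^bsub>T\<^esub> ?y = ?x"
      using coset_add[OF diff_in_A[OF x y] y] by simp
    have z: "?z \<in> carrier T" using x y by (intro coset_closed diff_in_A)
    have y': "?y \<in> carrier T" using y by (rule coset_closed)
    have "?z = ?x \<ominus>\<^bsub>T\<^esub> ?y"
      using T.add.m_assoc[OF z y' T.a_inv_closed[OF y']] T.r_neg[OF y'] T.r_zero[OF z]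
      by (simp only: a_minus_def z'[symmetric])
    then show "P ?z" using diff[of ?x ?y] P x y coset_closed by metis
  next
    fix a assume "a \<in> carrier M \<times> carrier N"
    then show "P (K #>\<^bsub>A\<^esub> frag_of a)" using assms(3) by (auto simp: pure_def)
  qed
  with c show ?thesis by simp
qed

text \<open>The form in which the universal property is used: additive endomorphisms of the tensor product that
  agree on pure tensors are equal.\<close>

lemma tensor_maps_eq:
  assumes f: "f \<in> carrier T \<rightarrow> carrier T" and g: "g \<in> carrier T \<rightarrow> carrier T"
    and f_add: "\<And>v w. v \<in> carrier T \<Longrightarrow> w \<in> carrier T \<Longrightarrow> f (v \<oplus>\<^bsub>T\<^esub> w) = f v \<oplus>\<^bsub>T\<^esub> f w"
    and g_add: "\<And>v w. v \<in> carrier T \<Longrightarrow> w \<in> carrier T \<Longrightarrow> g (v \<oplus>\<^bsub>T\<^esub> w) = g v \<oplus>\<^bsub>T\<^esub> g w"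
    and eq: "\<And>m v. m \<in> carrier M \<Longrightarrow> v \<in> carrier N \<Longrightarrow> f (pure m v) = g (pure m v)"
    and w: "w \<in> carrier T"
  shows "f w = g w"
  using w
proof (induction rule: tensor_induct)
  case zero
  show ?case
    using additive_map_zero[OF T.abelian_group_axioms T.abelian_group_axioms f f_add]
      additive_map_zero[OF T.abelian_group_axioms T.abelian_group_axioms g g_add] by simp
next
  case (diff v w)
  then show ?case
    using f_add[OF _ T.a_inv_closed, of v w] g_add[OF _ T.a_inv_closed, of v w]
      additive_map_minus[OF T.abelian_group_axioms T.abelian_group_axioms f f_add, of w]
      additive_map_minus[OF T.abelian_group_axioms T.abelian_group_axioms g g_add, of w]
    by (simp only: a_minus_def)
qed (rule eq)

text \<open>The last condition is weaker than linearity of \<open>\<phi>\<close> and \<open>\<psi>\<close>, in order to include the semilinear maps by which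
  \<open>G\<close> acts.\<close>

definition tensor_compatible :: "('u \<Rightarrow> 'u) \<Rightarrow> ('v \<Rightarrow> 'v) \<Rightarrow> bool" where
  "tensor_compatible \<phi> \<psi> \<longleftrightarrow>
     \<phi> \<in> carrier M \<rightarrow> carrier M \<and> \<psi> \<in> carrier N \<rightarrow> carrier N \<and>
     (\<forall>m\<in>carrier M. \<forall>m'\<in>carrier M. \<phi> (m \<oplus>\<^bsub>M\<^esub> m') = \<phi> m \<oplus>\<^bsub>M\<^esub> \<phi> m') \<and>
     (\<forall>v\<in>carrier N. \<forall>v'\<in>carrier N. \<psi> (v \<oplus>\<^bsub>N\<^esub> v') = \<psi> v \<oplus>\<^bsub>N\<^esub> \<psi> v') \<and>
     (\<forall>r\<in>carrier R. \<forall>m\<in>carrier M. \<forall>v\<in>carrier N.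
        pure (\<phi> (r \<odot>\<^bsub>M\<^esub> m)) (\<psi> v) = pure (\<phi> m) (\<psi> (r \<odot>\<^bsub>N\<^esub> v)))"

context
  fixes \<phi> :: "'u \<Rightarrow> 'u" and \<psi> :: "'v \<Rightarrow> 'v"
  assumes compat: "tensor_compatible \<phi> \<psi>"
begin

definition lift :: "(('u \<times> 'v) \<Rightarrow>\<^sub>0 int) \<Rightarrow> (('u \<times> 'v) \<Rightarrow>\<^sub>0 int)" where
  "lift = frag_extend (\<lambda>(m, v). frag_of (\<phi> m, \<psi> v))"

lemma lift_in_A:
  assumes "c \<in> carrier A" shows "lift c \<in> carrier A"
proof -
  have "Poly_Mapping.keys (lift c) \<subseteq> (\<Union>x\<in>Poly_Mapping.keys c. {(\<phi> (fst x), \<psi> (snd x))})"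
    unfolding lift_def
    by (rule order.trans[OF keys_frag_extend]) (auto split: prod.splits)
  also have "\<dots> \<subseteq> carrier M \<times> carrier N"
    using assms compat by (auto simp: tensor_compatible_def)
  finally show ?thesis by simp
qed

lemma lift_diff: "lift (x - y) = lift x - lift y" and lift_add: "lift (x + y) = lift x + lift y"
  and lift_frag_of: "lift (frag_of (m, v)) = frag_of (\<phi> m, \<psi> v)"
  by (simp_all add: lift_def frag_extend_diff frag_extend_add)

lemma diff_in_K_if_coset_eq:
  assumes "K #>\<^bsub>A\<^esub> x = K #>\<^bsub>A\<^esub> y" "x \<in> carrier A" "y \<in> carrier A"
  shows "x - y \<in> K"
proof -
  have "x \<in> K #>\<^bsub>A\<^esub> y"
    using A.rcos_self[OF assms(2) subgroup_K] assms(1) by simp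
  then show ?thesis by (auto simp: r_coset_def)
qed

lemma lift_relators: "relators \<subseteq> {c \<in> carrier A. lift c \<in> K}"
proof -
  have cl: "\<And>m. m \<in> carrier M \<Longrightarrow> \<phi> m \<in> carrier M" "\<And>v. v \<in> carrier N \<Longrightarrow> \<psi> v \<in> carrier N"
    using compat unfolding tensor_compatible_def by blast+
  have additive: "\<And>m m'. m \<in> carrier M \<Longrightarrow> m' \<in> carrier M \<Longrightarrow> \<phi> (m \<oplus>\<^bsub>M\<^esub> m') = \<phi> m \<oplus>\<^bsub>M\<^esub> \<phi> m'"
    "\<And>v v'. v \<in> carrier N \<Longrightarrow> v' \<in> carrier N \<Longrightarrow> \<psi> (v \<oplus>\<^bsub>N\<^esub> v') = \<psi> v \<oplus>\<^bsub>N\<^esub> \<psi> v'"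
    using compat unfolding tensor_compatible_def by blast+
  have balanced: "pure (\<phi> (r \<odot>\<^bsub>M\<^esub> m)) (\<psi> v) = pure (\<phi> m) (\<psi> (r \<odot>\<^bsub>N\<^esub> v))"
    if "r \<in> carrier R" "m \<in> carrier M" "v \<in> carrier N" for r m v
    using compat that unfolding tensor_compatible_def by blast
  have 1: "lift (frag_of (m \<oplus>\<^bsub>M\<^esub> m', v) - frag_of (m, v) - frag_of (m', v)) \<in> K"
    if "m \<in> carrier M" "m' \<in> carrier M" "v \<in> carrier N" for m m' v
  proof -
    have "frag_of (\<phi> m \<oplus>\<^bsub>M\<^esub> \<phi> m', \<psi> v) - frag_of (\<phi> m, \<psi> v) - frag_of (\<phi> m', \<psi> v) \<in> K"
      using that cl by (intro relators_in_K)
    then show ?thesis by (simp only: lift_diff lift_frag_of additive that)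
  qed
  have 2: "lift (frag_of (m, v \<oplus>\<^bsub>N\<^esub> v') - frag_of (m, v) - frag_of (m, v')) \<in> K"
    if "m \<in> carrier M" "v \<in> carrier N" "v' \<in> carrier N" for m v v'
  proof -
    have "frag_of (\<phi> m, \<psi> v \<oplus>\<^bsub>N\<^esub> \<psi> v') - frag_of (\<phi> m, \<psi> v) - frag_of (\<phi> m, \<psi> v') \<in> K"
      using that cl by (intro relators_in_K)
    then show ?thesis by (simp only: lift_diff lift_frag_of additive that)
  qed
  have 3: "lift (frag_of (r \<odot>\<^bsub>M\<^esub> m, v) - frag_of (m, r \<odot>\<^bsub>N\<^esub> v)) \<in> K"
    if "r \<in> carrier R" "m \<in> carrier M" "v \<in> carrier N" for r m v
    unfolding lift_diff lift_frag_of
    by (rule diff_in_K_if_coset_eq[OF balanced[OF that, unfolded pure_def]])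
       (use that in \<open>auto intro!: cl M_smult_closed N_smult_closed\<close>)
  show ?thesis
  proof
    fix c assume c: "c \<in> relators"
    then have "lift c \<in> K"
      unfolding relators_def by (elim UnE CollectE exE conjE) (simp_all only: 1 2 3)
    with c relators_in_A show "c \<in> {c \<in> carrier A. lift c \<in> K}" by blast
  qed
qed

text \<open>The lift of a compatible pair to the free abelian group maps relators into the kernel, hence the
  whole kernel into itself, and therefore descends to the tensor product.\<close>

lemma lift_K: assumes "c \<in> K" shows "lift c \<in> K"
proof -
  have "subgroup {c \<in> carrier A. lift c \<in> K} A"
  proof (rule A.subgroupI)
    show "{c \<in> carrier A. lift c \<in> K} \<noteq> {}"
      using subgroup.one_closed[OF subgroup_K] by (auto simp: lift_def intro!: exI[of _ 0])
    fix x y assume xy: "x \<in> {c \<in> carrier A. lift c \<in> K}" "y \<in> {c \<in> carrier A. lift c \<in> K}"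
    show "x \<otimes>\<^bsub>A\<^esub> y \<in> {c \<in> carrier A. lift c \<in> K}"
      using xy subgroup.m_closed[OF subgroup_K, of "lift x" "lift y"] A.m_closed[of x y]
      by (simp add: lift_add)
    have "- lift x \<in> K"
      using xy subgroup.m_inv_closed[OF subgroup_K, of "lift x"] lift_in_A[of x] by simp
    then show "inv\<^bsub>A\<^esub> x \<in> {c \<in> carrier A. lift c \<in> K}"
      using xy by (simp add: lift_def frag_extend_minus)
  qed auto
  from A.generate_subgroup_incl[OF lift_relators this] assms show ?thesis
    unfolding K_eq by blast
qed

lemma tensor_map_coset:
  assumes c: "c \<in> carrier A"
  shows "tensor_map R M N \<phi> \<psi> (K #>\<^bsub>A\<^esub> c) = K #>\<^bsub>A\<^esub> lift c"
proof -
  have "K #>\<^bsub>A\<^esub> lift d = K #>\<^bsub>A\<^esub> lift c" if d: "d \<in> K #>\<^bsub>A\<^esub> c" for d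
  proof (rule coset_eq)
    from d obtain k where k: "k \<in> K" "d = k + c" by (auto simp: r_coset_def)
    then show "lift d - lift c \<in> K" using lift_K by (simp add: lift_add)
    show "lift d \<in> carrier A"
      using d A.r_coset_subset_G[OF K_subset c] by (intro lift_in_A) blast
    show "lift c \<in> carrier A" using c by (rule lift_in_A)
  qed
  moreover have "c \<in> K #>\<^bsub>A\<^esub> c" using A.rcos_self[OF c subgroup_K] .
  ultimately have "(\<lambda>d. K #>\<^bsub>A\<^esub> lift d) ` (K #>\<^bsub>A\<^esub> c) = {K #>\<^bsub>A\<^esub> lift c}" by blast
  then show ?thesis by (simp add: tensor_map_def lift_def)
qed

lemma tensor_map_pure:
  "m \<in> carrier M \<Longrightarrow> v \<in> carrier N \<Longrightarrow> tensor_map R M N \<phi> \<psi> (pure m v) = pure (\<phi> m) (\<psi> v)"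
  using tensor_map_coset[of "frag_of (m, v)"] by (simp add: pure_def lift_frag_of)

lemma tensor_map_closed:
  assumes "w \<in> carrier T" shows "tensor_map R M N \<phi> \<psi> w \<in> carrier T"
  using assms by (rule T_cases) (simp only: tensor_map_coset coset_closed lift_in_A)

lemma tensor_map_add:
  assumes "v \<in> carrier T" "w \<in> carrier T"
  shows "tensor_map R M N \<phi> \<psi> (v \<oplus>\<^bsub>T\<^esub> w) = tensor_map R M N \<phi> \<psi> v \<oplus>\<^bsub>T\<^esub> tensor_map R M N \<phi> \<psi> w"
proof -
  obtain c d where c: "c \<in> carrier A" "v = K #>\<^bsub>A\<^esub> c" and d: "d \<in> carrier A" "w = K #>\<^bsub>A\<^esub> d"
    using assms by (metis T_cases)
  have "c + d \<in> carrier A" using A.m_closed[OF c(1) d(1)] by simp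
  then show ?thesis
    unfolding c(2) d(2) by (simp only: coset_add c d tensor_map_coset lift_in_A lift_add)
qed

end

end

section \<open>Fox calculus on the augmentation ideal\<close>

definition lin_ext :: "('h \<Rightarrow> 'l \<Rightarrow> 'k) \<Rightarrow> ('h \<Rightarrow> 'k) \<Rightarrow> 'l \<Rightarrow> 'k::field" where
  "lin_ext F a = (\<lambda>z. \<Sum>x\<in>supp a. a x * F x z)"

lemma lin_ext_eq:
  assumes "finite A" "supp a \<subseteq> A"
  shows "lin_ext F a z = (\<Sum>x\<in>A. a x * F x z)"
  unfolding lin_ext_def using assms by (intro sum.mono_neutral_cong_left) auto

lemma lin_ext_monom: "lin_ext F (gr_monom c x) = (\<lambda>z. c * F x z)"
proof
  fix z show "lin_ext F (gr_monom c x) z = c * F x z"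
    by (subst lin_ext_eq[of "{x}"]) (auto simp: gr_monom_def)
qed

lemma lin_ext_zero: "lin_ext F (\<lambda>x. 0) = (\<lambda>z. 0)"
  by (simp add: lin_ext_def)

lemma lin_ext_add:
  assumes "finite (supp a)" "finite (supp b)"
  shows "lin_ext F (\<lambda>x. a x + b x) = (\<lambda>z. lin_ext F a z + lin_ext F b z)"
proof
  fix z show "lin_ext F (\<lambda>x. a x + b x) z = lin_ext F a z + lin_ext F b z"
    using assms by (subst (1 2 3) lin_ext_eq[of "supp a \<union> supp b"])
      (auto simp: sum.distrib[symmetric] distrib_right intro!: sum.cong)
qed

text \<open>From here on words are treated as abstract group elements, and the index sets keep the form
  \<open>{1..n}\<close>.\<close>

declare free_group_simps [simp del] One_nat_def [simp del]

text \<open>Together with the distributive laws these rules suffice for the ring identities below: summands \<open>x\<close>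
  and \<open>\<ominus> x\<close> cancel also when up to two other summands stand between them.\<close>

context abelian_group
begin

lemma cancel_deep2:
  "\<lbrakk>x \<in> carrier G; y \<in> carrier G; z \<in> carrier G\<rbrakk> \<Longrightarrow> x \<oplus> (y \<oplus> (\<ominus> x \<oplus> z)) = y \<oplus> z"
  "\<lbrakk>x \<in> carrier G; y \<in> carrier G; z \<in> carrier G\<rbrakk> \<Longrightarrow> \<ominus> x \<oplus> (y \<oplus> (x \<oplus> z)) = y \<oplus> z"
  using a_lcomm[of x y "\<ominus> x \<oplus> z"] a_lcomm[of "\<ominus> x" y "x \<oplus> z"] by (simp_all add: r_neg1 r_neg2)

lemma cancel_deep3:
  "\<lbrakk>x \<in> carrier G; y \<in> carrier G; z \<in> carrier G; u \<in> carrier G\<rbrakk> \<Longrightarrow>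
     x \<oplus> (y \<oplus> (z \<oplus> (\<ominus> x \<oplus> u))) = y \<oplus> (z \<oplus> u)"
  "\<lbrakk>x \<in> carrier G; y \<in> carrier G; z \<in> carrier G; u \<in> carrier G\<rbrakk> \<Longrightarrow>
     \<ominus> x \<oplus> (y \<oplus> (z \<oplus> (x \<oplus> u))) = y \<oplus> (z \<oplus> u)"
  using cancel_deep2[of x "y \<oplus> z" u] by (simp_all add: a_assoc)

lemma cancel_deep_end:
  "\<lbrakk>x \<in> carrier G; y \<in> carrier G\<rbrakk> \<Longrightarrow> x \<oplus> (y \<oplus> \<ominus> x) = y"
  "\<lbrakk>x \<in> carrier G; y \<in> carrier G\<rbrakk> \<Longrightarrow> \<ominus> x \<oplus> (y \<oplus> x) = y"
  "\<lbrakk>x \<in> carrier G; y \<in> carrier G; z \<in> carrier G\<rbrakk> \<Longrightarrow> x \<oplus> (y \<oplus> (z \<oplus> \<ominus> x)) = y \<oplus> z"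
  "\<lbrakk>x \<in> carrier G; y \<in> carrier G; z \<in> carrier G\<rbrakk> \<Longrightarrow> \<ominus> x \<oplus> (y \<oplus> (z \<oplus> x)) = y \<oplus> z"
  using cancel_deep2[of x y \<zero>] cancel_deep3[of x y z \<zero>] by simp_all

lemmas cancel_deep = cancel_deep2 cancel_deep3 cancel_deep_end

end

lemmas (in ring) ring_norm = a_minus_def l_distr r_distr l_minus r_minus m_assoc a_ac r_neg l_neg
  r_neg1 r_neg2 minus_add cancel_deep

text \<open>The group ring of the free group is a parameter that only satisfies an equation, not an
  abbreviation: its operations then stay opaque, and calculations take place in an abstract ring.
  Below, \<open>mon w\<close> is the group element \<open>w\<close>, \<open>C c\<close> the central scalar \<open>c\<close>, and \<open>e j\<close> is \<open>x\<^sub>j - 1\<close>.\<close>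

locale Fn_ring =
  fixes n :: nat and R :: "(nat gword \<Rightarrow> 'k::field) ring" (structure)
  assumes R_def: "R = group_ring (Fn n)"
begin

sublocale F: group "Fn n" by (rule group_free_group)

sublocale ring R unfolding R_def by (rule group_ring_is_ring) (rule F.monoid_axioms)

definition mon :: "nat gword \<Rightarrow> nat gword \<Rightarrow> 'k" where
  "mon w = gr_monom 1 w"

definition C :: "'k \<Rightarrow> nat gword \<Rightarrow> 'k" where
  "C c = gr_monom c []"

definition e :: "nat \<Rightarrow> nat gword \<Rightarrow> 'k" where
  "e j = gminus1 n j"

abbreviation AI :: "(nat gword \<Rightarrow> 'k, nat gword \<Rightarrow> 'k) module" where
  "AI \<equiv> aug_ideal (Fn n)"

abbreviation I :: "(nat gword \<Rightarrow> 'k) set" where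
  "I \<equiv> carrier (AI)"

lemma add_R: "a \<oplus> b = (\<lambda>x. a x + b x)" and zero_R: "\<zero> = (\<lambda>x. 0)"
  by (simp_all add: R_def)

lemma mon_closed [simp]: "w \<in> carrier (Fn n) \<Longrightarrow> mon w \<in> carrier R"
  unfolding mon_def R_def by (rule gr_monom_closed)

lemma mon_mult: "mon u \<otimes> mon v = mon (u \<otimes>\<^bsub>Fn n\<^esub> v)"
  by (simp add: mon_def R_def gr_monom_mult)

lemma mon_one: "mon [] = \<one>"
  by (simp add: mon_def R_def free_group_simps)

lemma C_closed [simp]: "C c \<in> carrier R"
  unfolding C_def R_def by (rule gr_monom_closed) (simp add: free_group_simps)

lemma C_add: "C (c + d) = C c \<oplus> C d" and C_mult: "C (c * d) = C c \<otimes> C d"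
  and C_one: "C 1 = \<one>" and C_zero: "C 0 = \<zero>"
  by (simp_all add: C_def R_def gr_monom_add gr_monom_mult free_group_simps)

lemma C_scale:
  assumes "a \<in> carrier R"
  shows "C c \<otimes> a = (\<lambda>x. c * a x)" "a \<otimes> C c = (\<lambda>x. c * a x)"
  using gr_scalar_mult[OF F.monoid_axioms, of a c] assms by (simp_all add: C_def R_def free_group_simps)

lemma C_commute: "a \<in> carrier R \<Longrightarrow> a \<otimes> C c = C c \<otimes> a"
  by (simp add: C_scale)

lemma C_minus_one: "C (c - 1) = C c \<ominus> \<one>"
proof -
  have "C c = C (c - 1) \<oplus> \<one>" using C_add[of "c - 1" 1] by (simp add: C_one)
  then show ?thesis by (simp add: a_minus_def a_assoc r_neg)
qed

lemma monom_eq: "w \<in> carrier (Fn n) \<Longrightarrow> gr_monom c w = C c \<otimes> mon w"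
  using gr_monom_mult[where c = c and d = 1 and x = "[]" and y = w and H = "Fn n"] F.l_one[of w]
  by (simp add: C_def mon_def R_def free_group_simps(3))

lemma R_induct [consumes 1, case_names zero add]:
  assumes "a \<in> carrier R" "P \<zero>"
    and "\<And>c w a. w \<in> carrier (Fn n) \<Longrightarrow> a \<in> carrier R \<Longrightarrow> P a \<Longrightarrow> P (C c \<otimes> mon w \<oplus> a)"
  shows "P a"
  using assms(1)[unfolded R_def]
proof (induction rule: group_ring_induct)
  case zero
  show ?case using assms(2) by (simp add: zero_R)
next
  case (add c w a)
  then show ?case using assms(3)[of w a c] by (simp add: R_def[symmetric] add_R monom_eq)
qed

lemma gen_closed [simp]: "j \<in> {1..n} \<Longrightarrow> gen j \<in> carrier (Fn n)"
  by (rule gen_in_free_group)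

lemma e_eq: "e j = mon (gen j) \<ominus> \<one>"
  by (simp add: e_def gminus1_def mon_def R_def)

lemma e_closed [simp]: "j \<in> {1..n} \<Longrightarrow> e j \<in> carrier R"
  by (simp add: e_eq)

lemma aug_ideal_simps [simp]:
  "\<zero>\<^bsub>AI\<^esub> = \<zero>" "a \<oplus>\<^bsub>AI\<^esub> b = a \<oplus> b"
  "r \<odot>\<^bsub>AI\<^esub> f = f \<otimes> r"
  by (simp_all add: aug_ideal_def R_def)

lemma in_I: "f \<in> I \<longleftrightarrow> f \<in> carrier R \<and> augmentation f = 0"
  by (simp add: aug_ideal_def R_def)

lemma I_closed [simp]: "f \<in> I \<Longrightarrow> f \<in> carrier R"
  by (simp add: in_I)

lemma aug_add: "a \<in> carrier R \<Longrightarrow> b \<in> carrier R \<Longrightarrow> augmentation (a \<oplus> b) = augmentation a + augmentation b"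
  by (simp add: R_def augmentation_simps gr_finite[of _ "Fn n"])

lemma aug_mult: "a \<in> carrier R \<Longrightarrow> b \<in> carrier R \<Longrightarrow> augmentation (a \<otimes> b) = augmentation a * augmentation b"
  unfolding R_def by (rule augmentation_mult[OF F.monoid_axioms])

lemma aug_zero: "augmentation \<zero> = 0" and aug_mon: "augmentation (mon w) = 1"
  and aug_C: "augmentation (C c) = c"
  by (simp_all add: zero_R mon_def C_def augmentation_simps)

lemma aug_one: "augmentation \<one> = 1"
  using aug_C[of 1] by (simp add: C_one)

lemma aug_minus: "a \<in> carrier R \<Longrightarrow> augmentation (\<ominus> a) = - augmentation a"
  using aug_add[of a "\<ominus> a"] by (simp add: r_neg aug_zero add_eq_0_iff2)

lemma I_add [simp]: "f \<in> I \<Longrightarrow> g \<in> I \<Longrightarrow> f \<oplus> g \<in> I"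
  and I_uminus [simp]: "f \<in> I \<Longrightarrow> \<ominus> f \<in> I"
  and I_mult_r [simp]: "f \<in> I \<Longrightarrow> r \<in> carrier R \<Longrightarrow> f \<otimes> r \<in> I"
  and I_mult_l [simp]: "f \<in> I \<Longrightarrow> r \<in> carrier R \<Longrightarrow> r \<otimes> f \<in> I"
  and I_zero [simp]: "\<zero> \<in> I"
  unfolding in_I by (auto simp: aug_add aug_mult aug_minus aug_zero)

lemma I_minus [simp]: "f \<in> I \<Longrightarrow> g \<in> I \<Longrightarrow> f \<ominus> g \<in> I"
  by (simp add: a_minus_def)

lemma e_in_I [simp]: "j \<in> {1..n} \<Longrightarrow> e j \<in> I"
  unfolding in_I by (simp add: e_eq a_minus_def aug_add aug_mon aug_minus aug_one)

lemma abelian_group_I: "abelian_group (AI)"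
proof (rule abelian_groupI)
  fix f assume "f \<in> I"
  then show "\<exists>g\<in>I. g \<oplus>\<^bsub>AI\<^esub> f = \<zero>\<^bsub>AI\<^esub>"
    by (intro bexI[of _ "\<ominus> f"]) (auto simp: l_neg)
qed (auto simp: a_ac)

lemma scaled_mon_minus_one_in_I: "w \<in> carrier (Fn n) \<Longrightarrow> C c \<otimes> (mon w \<ominus> \<one>) \<in> I"
  unfolding in_I by (simp add: aug_mult a_minus_def aug_add aug_mon aug_minus aug_one)

lemma C_left_commute: "a \<in> carrier R \<Longrightarrow> b \<in> carrier R \<Longrightarrow> a \<otimes> (C c \<otimes> b) = C c \<otimes> (a \<otimes> b)"
  by (simp add: m_assoc[symmetric] C_commute)

lemma mon_inv_mult:
  "w \<in> carrier (Fn n) \<Longrightarrow> mon w \<otimes> mon (inv\<^bsub>Fn n\<^esub> w) = \<one>"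
  "w \<in> carrier (Fn n) \<Longrightarrow> mon (inv\<^bsub>Fn n\<^esub> w) \<otimes> mon w = \<one>"
  using F.r_inv[of w] F.l_inv[of w] by (simp_all add: mon_mult free_group_simps(3) mon_one)

text \<open>A word minus one lies in the right ideal generated by the \<open>e j\<close>, as \<open>x\<^sub>iw - 1 = e\<^sub>iw + (w - 1)\<close> and
  \<open>x\<^sub>i\<inverse>w - 1 = - e\<^sub>ix\<^sub>i\<inverse>w + (w - 1)\<close>.\<close>

lemma word_minus_one:
  assumes "w \<in> carrier (Fn n)"
    and zero: "P \<zero>" and e: "\<And>j r. j \<in> {1..n} \<Longrightarrow> r \<in> carrier R \<Longrightarrow> P (e j \<otimes> r)"
    and add: "\<And>f g. f \<in> I \<Longrightarrow> g \<in> I \<Longrightarrow> P f \<Longrightarrow> P g \<Longrightarrow> P (f \<oplus> g)"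
  shows "P (C c \<otimes> (mon w \<ominus> \<one>))"
  using assms(1)
proof (induction rule: free_group_induct)
  case one
  have "C c \<otimes> (mon [] \<ominus> \<one>) = \<zero>" by (simp add: mon_one a_minus_def r_neg)
  then show ?case using zero by simp
next
  case (gen i w)
  let ?g = "C c \<otimes> (mon w \<ominus> \<one>)"
  have cl: "mon w \<in> carrier R" "mon (gen i) \<in> carrier R" "C c \<in> carrier R"
    and g: "?g \<in> I" and ei: "e i \<in> carrier R"
    using gen scaled_mon_minus_one_in_I by simp_all
  have "C c \<otimes> (mon (gen i \<otimes>\<^bsub>Fn n\<^esub> w) \<ominus> \<one>) = C c \<otimes> (e i \<otimes> mon w) \<oplus> ?g"
    unfolding mon_mult[symmetric] e_eq using cl by (simp add: ring_norm)
  also have "C c \<otimes> (e i \<otimes> mon w) = e i \<otimes> (C c \<otimes> mon w)"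
    using cl ei by (simp add: C_left_commute)
  finally show ?case
    using add[OF _ g, of "e i \<otimes> (C c \<otimes> mon w)"] e[of i "C c \<otimes> mon w"] gen cl by simp
next
  case (inv i w)
  let ?g = "C c \<otimes> (mon w \<ominus> \<one>)" and ?y = "inv\<^bsub>Fn n\<^esub> (gen i)"
  define x y b where "x = mon (gen i)" and "y = mon ?y" and "b = mon w"
  have "?y \<in> carrier (Fn n)" using inv gen_closed F.inv_closed by blast
  then have cl: "x \<in> carrier R" "y \<in> carrier R" "b \<in> carrier R" "C c \<in> carrier R"
    and g: "?g \<in> I" and ei: "e i \<in> carrier R"
    using inv scaled_mon_minus_one_in_I by (simp_all add: x_def y_def b_def)
  have xy: "x \<otimes> (y \<otimes> b) = b"
    using cl mon_inv_mult(1)[of "gen i"] inv by (simp add: m_assoc[symmetric] x_def y_def)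
  let ?r = "\<ominus> (C c \<otimes> (y \<otimes> b))"
  have r: "?r \<in> carrier R" using cl by simp
  have "x \<otimes> (C c \<otimes> (y \<otimes> b)) = C c \<otimes> b"
    using C_left_commute[of x "y \<otimes> b" c] cl xy by simp
  moreover have "(x \<ominus> \<one>) \<otimes> (\<ominus> z) \<oplus> C c \<otimes> (b \<ominus> \<one>) =
      \<ominus> (x \<otimes> z) \<oplus> z \<oplus> C c \<otimes> b \<ominus> C c" if "z \<in> carrier R" for z
    using cl that by (simp add: ring_norm)
  ultimately have "e i \<otimes> ?r \<oplus> C c \<otimes> (b \<ominus> \<one>) =
      \<ominus> (C c \<otimes> b) \<oplus> C c \<otimes> (y \<otimes> b) \<oplus> C c \<otimes> b \<ominus> C c"
    using cl by (simp add: e_eq x_def)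
  also have "\<dots> = C c \<otimes> (y \<otimes> b \<ominus> \<one>)" using cl by (simp add: ring_norm)
  finally have "e i \<otimes> ?r \<oplus> C c \<otimes> (b \<ominus> \<one>) = C c \<otimes> (y \<otimes> b \<ominus> \<one>)" .
  then have "e i \<otimes> ?r \<oplus> ?g = C c \<otimes> (mon (?y \<otimes>\<^bsub>Fn n\<^esub> w) \<ominus> \<one>)"
    by (simp only: mon_mult[symmetric] b_def y_def)
  then show ?case
    using add[OF _ g, of "e i \<otimes> ?r"] e[of i ?r] inv r by simp
qed

text \<open>The \<open>e j\<close> generate the augmentation ideal as a right ideal: an element \<open>a\<close> of augmentation zero is
  the sum of the multiples of \<open>w - 1\<close> by the coefficients of \<open>a\<close>.\<close>

lemma I_induct [consumes 1, case_names zero e add]: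
  assumes "f \<in> I"
    and zero: "P \<zero>" and e: "\<And>j r. j \<in> {1..n} \<Longrightarrow> r \<in> carrier R \<Longrightarrow> P (e j \<otimes> r)"
    and add: "\<And>f g. f \<in> I \<Longrightarrow> g \<in> I \<Longrightarrow> P f \<Longrightarrow> P g \<Longrightarrow> P (f \<oplus> g)"
  shows "P f"
proof -
  have "P (a \<ominus> C (augmentation a)) \<and> a \<ominus> C (augmentation a) \<in> I" if "a \<in> carrier R" for a
    using that
  proof (induction rule: R_induct)
    case zero
    then show ?case using assms(2) by (simp add: aug_zero C_zero a_minus_def)
  next
    case (add c w a)
    let ?f = "C c \<otimes> (mon w \<ominus> \<one>)" and ?g = "a \<ominus> C (augmentation a)"
    have f: "?f \<in> I"
      using add by (simp add: scaled_mon_minus_one_in_I)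
    have cl: "mon w \<in> carrier R" "a \<in> carrier R" "C c \<in> carrier R" "C (augmentation a) \<in> carrier R"
      using add by simp_all
    have "P ?f" using word_minus_one[of w P c] add assms by blast
    then have "P (?f \<oplus> ?g)" "?f \<oplus> ?g \<in> I"
      using assms(4)[OF f, of ?g] add f by simp_all
    moreover have "?f \<oplus> ?g = (C c \<otimes> mon w \<oplus> a) \<ominus> C (augmentation (C c \<otimes> mon w \<oplus> a))"
    proof -
      have *: "augmentation (C c \<otimes> mon w \<oplus> a) = c + augmentation a"
        using cl by (simp add: aug_add aug_mult aug_C aug_mon)
      show ?thesis unfolding * C_add using cl by (simp add: ring_norm)
    qed
    ultimately show ?case by simp
  qed
  from this[of f] assms(1) show ?thesis unfolding in_I by (simp add: C_zero a_minus_def)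
qed

text \<open>The \<open>e j\<close> are free generators: any values \<open>d j\<close> extend to a right linear map on the augmentation
  ideal. The extension is the Fox derivation of the whole group ring, that is, the additive map with
  \<open>der (ab) = der a \<cdot> b + \<epsilon>(a) \<cdot> der b\<close>, where \<open>\<epsilon>\<close> is the augmentation. It is computed on words letter
  by letter, the value on \<open>x\<^sub>j\<close> being \<open>d\<^sub>j\<close> and the value on \<open>x\<^sub>j\<inverse>\<close> being \<open>- d\<^sub>jx\<^sub>j\<inverse>\<close>.\<close>

context
  fixes d :: "nat \<Rightarrow> nat gword \<Rightarrow> 'k"
  assumes d: "\<And>j. j \<in> {1..n} \<Longrightarrow> d j \<in> carrier R"
begin

text \<open>The contribution of the letter \<open>a\<close> in front of the word \<open>w\<close>, already multiplied by \<open>w\<close>.\<close>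

definition letter_der :: "nat \<times> bool \<Rightarrow> nat gword \<Rightarrow> nat gword \<Rightarrow> 'k" where
  "letter_der a w = (if snd a then d (fst a) \<otimes> mon w else \<ominus> (d (fst a) \<otimes> mon (push a w)))"

primrec word_der :: "nat gword \<Rightarrow> nat gword \<Rightarrow> 'k" where
  "word_der [] = \<zero>"
| "word_der (a # w) = letter_der a w \<oplus> word_der w"

definition der :: "(nat gword \<Rightarrow> 'k) \<Rightarrow> nat gword \<Rightarrow> 'k" where
  "der = lin_ext word_der"

lemma push_closed:
  assumes "fst a \<in> {1..n}" "w \<in> carrier (Fn n)"
  shows "push a w \<in> carrier (Fn n)"
  using assms order.trans[OF push_letters[of a w], of "{1..n}"] push_reduced[of w a]
  by (simp add: free_group_simps)

lemma letter_der_closed: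
  assumes "fst a \<in> {1..n}" "w \<in> carrier (Fn n)"
  shows "letter_der a w \<in> carrier R"
  using d[OF assms(1)] mon_closed[OF assms(2)] mon_closed[OF push_closed[OF assms]]
  by (simp add: letter_der_def)

lemma tail_closed: "a # w \<in> carrier (Fn n) \<Longrightarrow> fst a \<in> {1..n} \<and> w \<in> carrier (Fn n)"
  by (auto simp: free_group_simps reduced_Cons)

lemma word_der_closed: "w \<in> carrier (Fn n) \<Longrightarrow> word_der w \<in> carrier R"
proof (induction w)
  case (Cons a w)
  then show ?case using tail_closed[OF Cons.prems] letter_der_closed by simp
qed simp

text \<open>The recursion for \<open>word_der\<close> follows words as lists. It also holds when the new letter cancels, as
  the contributions of the two cancelling letters add up to zero.\<close>

lemma word_der_push:
  assumes a: "fst a \<in> {1..n}" and w: "w \<in> carrier (Fn n)"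
  shows "word_der (push a w) = letter_der a w \<oplus> word_der w"
proof (cases "\<exists>u. w = flip a # u")
  case True
  then obtain u where u: "w = flip a # u" by blast
  have uc: "u \<in> carrier (Fn n)" using tail_closed w u by blast
  have push: "push a w = u" "push (flip a) u = w"
    using w u push_Cons_reduced[of "flip a" u] by (auto simp: free_group_simps cancels_iff_flip)
  have dc: "d (fst a) \<otimes> mon w \<in> carrier R" "d (fst a) \<otimes> mon u \<in> carrier R"
    using d[OF a] w uc by simp_all
  then have "letter_der a w \<oplus> letter_der (flip a) u = \<zero>"
    using push by (cases "snd a") (simp_all add: letter_der_def r_neg l_neg flip_def)
  then have "letter_der a w \<oplus> (letter_der (flip a) u \<oplus> word_der u) = word_der u"
    using letter_der_closed[OF a w] letter_der_closed[of "flip a" u] a uc word_der_closed[OF uc]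
    by (simp add: a_assoc[symmetric])
  then show ?thesis unfolding push(1) by (simp add: u)
next
  case False
  then have "push a w = a # w" by (cases w) (auto simp: cancels_iff_flip)
  then show ?thesis by simp
qed

lemma word_der_mult:
  assumes "u \<in> carrier (Fn n)" and v: "v \<in> carrier (Fn n)"
  shows "word_der (u \<otimes>\<^bsub>Fn n\<^esub> v) = word_der u \<otimes> mon v \<oplus> word_der v"
  using assms(1)
proof (induction u)
  case Nil
  show ?case using v word_der_closed[OF v] F.l_one[OF v] by (simp add: free_group_simps(3))
next
  case (Cons a u)
  then have a: "fst a \<in> {1..n}" and u: "u \<in> carrier (Fn n)" using tail_closed by blast+
  have uv: "u \<otimes>\<^bsub>Fn n\<^esub> v \<in> carrier (Fn n)" using u v by (rule F.m_closed)
  have "push a (u \<otimes>\<^bsub>Fn n\<^esub> v) = push a u \<otimes>\<^bsub>Fn n\<^esub> v"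
    using v by (simp add: free_group_simps gmul_push)
  then have *: "letter_der a (u \<otimes>\<^bsub>Fn n\<^esub> v) = letter_der a u \<otimes> mon v"
    using d[OF a] u v push_closed[OF a u]
    by (simp add: letter_der_def mon_mult[symmetric] m_assoc l_minus)
  have "(a # u) \<otimes>\<^bsub>Fn n\<^esub> v = push a (u \<otimes>\<^bsub>Fn n\<^esub> v)" by (simp add: free_group_simps)
  then have "word_der ((a # u) \<otimes>\<^bsub>Fn n\<^esub> v) = letter_der a u \<otimes> mon v \<oplus> word_der (u \<otimes>\<^bsub>Fn n\<^esub> v)"
    using word_der_push[OF a uv] * by simp
  then show ?case
    using Cons.IH[OF u] letter_der_closed[OF a u] word_der_closed[OF u] word_der_closed[OF v] v
    by (simp add: l_distr a_assoc)
qed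

lemma der_add:
  "a \<in> carrier R \<Longrightarrow> b \<in> carrier R \<Longrightarrow> der (a \<oplus> b) = der a \<oplus> der b"
  unfolding der_def add_R
  by (intro lin_ext_add gr_finite[of _ "Fn n"]) (simp_all add: R_def)

lemma der_monom: "w \<in> carrier (Fn n) \<Longrightarrow> der (C c \<otimes> mon w) = C c \<otimes> word_der w"
  unfolding der_def monom_eq[symmetric] by (simp only: lin_ext_monom C_scale word_der_closed)

lemma der_zero: "der \<zero> = \<zero>"
  by (simp add: der_def zero_R lin_ext_zero)

lemma der_closed: "a \<in> carrier R \<Longrightarrow> der a \<in> carrier R"
  by (induction rule: R_induct) (simp_all add: der_zero der_add der_monom word_der_closed)

lemma der_mult:
  assumes "a \<in> carrier R" and b: "b \<in> carrier R"
  shows "der (a \<otimes> b) = der a \<otimes> b \<oplus> C (augmentation a) \<otimes> der b"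
proof -
  note closed = word_der_closed der_closed
  have 1: "der (C c \<otimes> mon u \<otimes> b) = C c \<otimes> word_der u \<otimes> b \<oplus> C c \<otimes> der b"
    if u: "u \<in> carrier (Fn n)" for c u
    using b
  proof (induction rule: R_induct)
    case zero
    then show ?case using u by (simp add: der_zero closed)
  next
    case (add c' v b)
    have "C c \<otimes> mon u \<otimes> (C c' \<otimes> mon v) = C (c * c') \<otimes> mon (u \<otimes>\<^bsub>Fn n\<^esub> v)"
      using u add C_commute[of "mon u" c'] 
      by (simp add: C_mult mon_mult[symmetric] m_assoc)
         (simp add: m_assoc[symmetric])
    then have "der (C c \<otimes> mon u \<otimes> (C c' \<otimes> mon v)) = C (c * c') \<otimes> (word_der u \<otimes> mon v \<oplus> word_der v)"
      using u add F.m_closed[of u v] by (simp only: der_monom word_der_mult)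
    also have "\<dots> = C c \<otimes> word_der u \<otimes> (C c' \<otimes> mon v) \<oplus> C c \<otimes> (C c' \<otimes> word_der v)"
      using u add C_commute[of "word_der u" c']
      by (simp add: closed C_mult r_distr m_assoc)
         (simp add: closed m_assoc[symmetric])
    finally show ?case
      using u add by (simp add: r_distr der_add der_monom closed a_ac)
  qed
  from assms(1) show ?thesis
  proof (induction rule: R_induct)
    case zero
    then show ?case using b by (simp add: der_zero aug_zero C_zero closed)
  next
    case (add c u a)
    then show ?case
      using b by (simp add: l_distr der_add 1 der_monom closed aug_add aug_mult aug_C aug_mon C_add a_ac
         )
  qed
qed

lemma der_right_linear: "f \<in> I \<Longrightarrow> r \<in> carrier R \<Longrightarrow> der (f \<otimes> r) = der f \<otimes> r"
  unfolding in_I by (simp add: der_mult C_zero der_closed)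

lemma der_e:
  assumes "j \<in> {1..n}"
  shows "der (e j) = d j"
proof -
  have word: "der (mon w) = word_der w" if "w \<in> carrier (Fn n)" for w
    using der_monom[OF that, of 1] that by (simp add: C_one word_der_closed)
  have "der \<one> = \<zero>"
    using word[of "[]"] F.one_closed by (simp add: free_group_simps(3) mon_one)
  then have "der (\<ominus> \<one>) = \<zero>"
    using additive_map_minus[of R R der \<one>] abelian_group_axioms der_closed der_add by auto
  moreover have "der (e j) = der (mon (gen j)) \<oplus> der (\<ominus> \<one>)"
    using assms by (simp add: e_eq a_minus_def der_add)
  moreover have "word_der (gen j) = d j"
    using assms d by (simp add: gen_def letter_der_def mon_one)
  ultimately show ?thesis
    using assms d word[of "gen j"] by simp
qed

end

text \<open>With \<open>s\<close> the identity these are right linear maps; for the ring automorphism \<open>s\<close> induced by an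
  automorphism of the free group, they are the two sides of an equivariance law. In both cases it is
  enough to compare them on the generators \<open>e j\<close>.\<close>

lemma semilinear_maps_eq:
  assumes s: "s \<in> carrier R \<rightarrow> carrier R"
    and "\<Phi> \<in> I \<rightarrow> carrier R" "\<Psi> \<in> I \<rightarrow> carrier R"
    and "\<And>f g. f \<in> I \<Longrightarrow> g \<in> I \<Longrightarrow> \<Phi> (f \<oplus> g) = \<Phi> f \<oplus> \<Phi> g"
    and "\<And>f g. f \<in> I \<Longrightarrow> g \<in> I \<Longrightarrow> \<Psi> (f \<oplus> g) = \<Psi> f \<oplus> \<Psi> g"
    and "\<And>f r. f \<in> I \<Longrightarrow> r \<in> carrier R \<Longrightarrow> \<Phi> (f \<otimes> r) = \<Phi> f \<otimes> s r"
    and "\<And>f r. f \<in> I \<Longrightarrow> r \<in> carrier R \<Longrightarrow> \<Psi> (f \<otimes> r) = \<Psi> f \<otimes> s r"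
    and "\<And>j. j \<in> {1..n} \<Longrightarrow> \<Phi> (e j) = \<Psi> (e j)"
    and "f \<in> I"
  shows "\<Phi> f = \<Psi> f"
  using \<open>f \<in> I\<close>
proof (induction rule: I_induct)
  case zero
  show ?case
    using additive_map_zero[OF abelian_group_I abelian_group_axioms, of \<Phi>]
      additive_map_zero[OF abelian_group_I abelian_group_axioms, of \<Psi>] assms(2-5) by simp
qed (use assms in auto)

end

section \<open>The twisted action\<close>

lemma module_Aut_group:
  assumes add: "\<And>m m'. m \<in> carrier M \<Longrightarrow> m' \<in> carrier M \<Longrightarrow> m \<oplus>\<^bsub>M\<^esub> m' \<in> carrier M"
    and smult: "\<And>r m. r \<in> carrier R \<Longrightarrow> m \<in> carrier M \<Longrightarrow> r \<odot>\<^bsub>M\<^esub> m \<in> carrier M"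
  shows "group (module_Aut R M)"
proof -
  let ?S = "carrier M"
  interpret B: group "BijGroup ?S" by (rule group_BijGroup)
  have "subgroup (carrier (module_Aut R M)) (BijGroup ?S)"
  proof (rule B.subgroupI)
    show "carrier (module_Aut R M) \<subseteq> carrier (BijGroup ?S)"
      by (auto simp: module_Aut_def BijGroup_def)
    have "(\<lambda>x\<in>?S. x) \<in> carrier (module_Aut R M)"
      using add smult by (auto simp: module_Aut_def id_Bij)
    then show "carrier (module_Aut R M) \<noteq> {}" by auto
  next
    fix \<phi> assume \<phi>: "\<phi> \<in> carrier (module_Aut R M)"
    then have B: "\<phi> \<in> Bij ?S" by (simp add: module_Aut_def)
    let ?\<psi> = "inv_into ?S \<phi>"
    have bij: "bij_betw \<phi> ?S ?S" using B by (simp add: Bij_def)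
    then have im: "?\<psi> m \<in> ?S" "\<phi> (?\<psi> m) = m" if "m \<in> ?S" for m
      using that by (auto simp: bij_betw_def inv_into_into f_inv_into_f)
    have inv: "?\<psi> (\<phi> m) = m" if "m \<in> ?S" for m
      using bij that by (simp add: bij_betw_def)
    have "?\<psi> (m \<oplus>\<^bsub>M\<^esub> m') = ?\<psi> m \<oplus>\<^bsub>M\<^esub> ?\<psi> m'" if "m \<in> ?S" "m' \<in> ?S" for m m'
      using \<phi> inv[of "?\<psi> m \<oplus>\<^bsub>M\<^esub> ?\<psi> m'"] im that add by (simp add: module_Aut_def)
    moreover have "?\<psi> (r \<odot>\<^bsub>M\<^esub> m) = r \<odot>\<^bsub>M\<^esub> ?\<psi> m" if "r \<in> carrier R" "m \<in> ?S" for r m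
      using \<phi> inv[of "r \<odot>\<^bsub>M\<^esub> ?\<psi> m"] im that smult by (simp add: module_Aut_def)
    ultimately show "inv\<^bsub>BijGroup ?S\<^esub> \<phi> \<in> carrier (module_Aut R M)"
      using B add smult restrict_inv_into_Bij[OF B]
      by (simp add: inv_BijGroup[OF B] module_Aut_def)
  next
    fix \<phi> \<psi> assume "\<phi> \<in> carrier (module_Aut R M)" "\<psi> \<in> carrier (module_Aut R M)"
    moreover from this have "\<phi> \<in> ?S \<rightarrow> ?S" "\<psi> \<in> ?S \<rightarrow> ?S"
      by (auto simp: module_Aut_def dest: Bij_imp_funcset)
    ultimately show "\<phi> \<otimes>\<^bsub>BijGroup ?S\<^esub> \<psi> \<in> carrier (module_Aut R M)"
      using add smult by (auto simp: module_Aut_def BijGroup_def compose_Bij compose_eq Pi_def)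
  qed
  from subgroup.subgroup_is_group[OF this B.is_group] show ?thesis
    by (simp add: module_Aut_def)
qed

lemma module_Aut_simps:
  "\<phi> \<in> carrier (module_Aut R M) \<longleftrightarrow> \<phi> \<in> Bij (carrier M) \<and>
     (\<forall>m\<in>carrier M. \<forall>m'\<in>carrier M. \<phi> (m \<oplus>\<^bsub>M\<^esub> m') = \<phi> m \<oplus>\<^bsub>M\<^esub> \<phi> m') \<and>
     (\<forall>r\<in>carrier R. \<forall>m\<in>carrier M. \<phi> (r \<odot>\<^bsub>M\<^esub> m) = r \<odot>\<^bsub>M\<^esub> \<phi> m)"
  "\<lbrakk>\<phi> \<in> carrier (module_Aut R M); \<psi> \<in> carrier (module_Aut R M); m \<in> carrier M\<rbrakk> \<Longrightarrow>
     (\<phi> \<otimes>\<^bsub>module_Aut R M\<^esub> \<psi>) m = \<phi> (\<psi> m)"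
  "\<one>\<^bsub>module_Aut R M\<^esub> = (\<lambda>m\<in>carrier M. m)"
  by (auto simp: module_Aut_def BijGroup_def compose_eq)

locale twisted_Fn_ring = Fn_ring n R for n and R :: "(nat gword \<Rightarrow> 'k::field) ring" (structure) +
  fixes lam :: 'k
  assumes lam_nz: "lam \<noteq> 0"
begin

text \<open>In the form \<open>x\<^sub>k \<circ> f = f + e\<^sub>k D\<^sub>k(f)\<close> with a right linear functional \<open>D\<^sub>k\<close>, the twisted action is by
  pseudo-reflections. Splitting \<open>D\<^sub>k(f) = f + (\<lambda> - 1) P\<^sub>k(f)\<close> isolates the dependence on \<open>\<lambda>\<close>; here
  \<open>P\<^sub>k\<close> is the functional with \<open>P\<^sub>k(e\<^sub>j) = e\<^sub>j\<close> for \<open>j < k\<close>, \<open>P\<^sub>k(e\<^sub>k) = x\<^sub>k\<close> and \<open>P\<^sub>k(e\<^sub>j) = 0\<close> for \<open>j > k\<close>.\<close>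

definition P_val :: "nat \<Rightarrow> nat \<Rightarrow> nat gword \<Rightarrow> 'k" where
  "P_val k j = (if j < k then e j else if j = k then mon (gen k) else \<zero>)"

definition P :: "nat \<Rightarrow> (nat gword \<Rightarrow> 'k) \<Rightarrow> nat gword \<Rightarrow> 'k" where
  "P k = der (P_val k)"

definition D :: "nat \<Rightarrow> (nat gword \<Rightarrow> 'k) \<Rightarrow> nat gword \<Rightarrow> 'k" where
  "D k f = f \<oplus> C (lam - 1) \<otimes> P k f"

definition tw :: "nat \<Rightarrow> (nat gword \<Rightarrow> 'k) \<Rightarrow> nat gword \<Rightarrow> 'k" where
  "tw k f = f \<oplus> e k \<otimes> D k f"

lemma P_val_closed: "j \<in> {1..n} \<Longrightarrow> P_val k j \<in> carrier R"
  by (auto simp: P_val_def)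

lemma P_closed [simp]: "f \<in> carrier R \<Longrightarrow> P k f \<in> carrier R"
  unfolding P_def by (rule der_closed[OF P_val_closed])

lemma P_add: "f \<in> carrier R \<Longrightarrow> g \<in> carrier R \<Longrightarrow> P k (f \<oplus> g) = P k f \<oplus> P k g"
  unfolding P_def by (rule der_add[OF P_val_closed])

lemma P_right: "f \<in> I \<Longrightarrow> r \<in> carrier R \<Longrightarrow> P k (f \<otimes> r) = P k f \<otimes> r"
  unfolding P_def by (rule der_right_linear[OF P_val_closed])

lemma P_e: "j \<in> {1..n} \<Longrightarrow> P k (e j) = (if j < k then e j else if j = k then mon (gen k) else \<zero>)"
  unfolding P_def using der_e[of "P_val k" j] P_val_closed by (simp add: P_val_def)

lemma D_closed [simp]: "f \<in> carrier R \<Longrightarrow> D k f \<in> carrier R"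
  by (simp add: D_def)

lemma D_add: "f \<in> carrier R \<Longrightarrow> g \<in> carrier R \<Longrightarrow> D k (f \<oplus> g) = D k f \<oplus> D k g"
  by (simp add: D_def P_add r_distr a_ac)

lemma D_right: "f \<in> I \<Longrightarrow> r \<in> carrier R \<Longrightarrow> D k (f \<otimes> r) = D k f \<otimes> r"
  by (simp add: D_def P_right l_distr m_assoc)

lemma add_C_minus_one: "a \<in> carrier R \<Longrightarrow> a \<oplus> C (lam - 1) \<otimes> a = C lam \<otimes> a"
  unfolding C_minus_one by (simp add: ring_norm)

lemma D_e:
  assumes j: "j \<in> {1..n}"
  shows "j < k \<Longrightarrow> D k (e j) = C lam \<otimes> e j"
    and "D j (e j) = C lam \<otimes> mon (gen j) \<ominus> \<one>"
    and "k < j \<Longrightarrow> D k (e j) = e j"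
proof -
  show "j < k \<Longrightarrow> D k (e j) = C lam \<otimes> e j" "k < j \<Longrightarrow> D k (e j) = e j"
    using j by (simp_all add: D_def P_e add_C_minus_one)
  have "mon (gen j) \<in> carrier R" using j by simp
  then show "D j (e j) = C lam \<otimes> mon (gen j) \<ominus> \<one>"
    using j by (simp add: D_def P_e) (simp add: e_eq C_minus_one ring_norm)
qed

lemma tw_in_I [simp]: "k \<in> {1..n} \<Longrightarrow> f \<in> I \<Longrightarrow> tw k f \<in> I"
  by (simp add: tw_def)

lemma tw_add: "k \<in> {1..n} \<Longrightarrow> f \<in> I \<Longrightarrow> g \<in> I \<Longrightarrow> tw k (f \<oplus> g) = tw k f \<oplus> tw k g"
  by (simp add: tw_def D_add r_distr a_ac)

lemma tw_right: "k \<in> {1..n} \<Longrightarrow> f \<in> I \<Longrightarrow> r \<in> carrier R \<Longrightarrow> tw k (f \<otimes> r) = tw k f \<otimes> r"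
  by (simp add: tw_def D_right l_distr m_assoc)

lemma tw_e:
  assumes i: "i \<in> {1..n}" and j: "j \<in> {1..n}"
  shows "tw i (e j) = C (lam_ge lam i j) \<otimes> mon (gen i) \<otimes> e j \<ominus> C (lam_ge lam (i - 1) j - 1) \<otimes> e j"
proof -
  have cl: "mon (gen i) \<in> carrier R" "mon (gen j) \<in> carrier R" "C lam \<in> carrier R"
    using i j by simp_all
  consider "j < i" | "j = i" | "i < j" by linarith
  then show ?thesis
  proof cases
    case 1
    have "(mon (gen i) \<ominus> \<one>) \<otimes> (C lam \<otimes> e j) = C lam \<otimes> ((mon (gen i) \<ominus> \<one>) \<otimes> e j)"
      using cl j by (intro C_left_commute) auto
    then have "tw i (e j) = e j \<oplus> C lam \<otimes> ((mon (gen i) \<ominus> \<one>) \<otimes> e j)"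
      using 1 j by (simp add: tw_def D_e e_eq[of i])
    also have "\<dots> = C lam \<otimes> mon (gen i) \<otimes> e j \<ominus> (C lam \<ominus> \<one>) \<otimes> e j"
      using cl e_closed[OF j] by (simp add: ring_norm)
    also have "lam_ge lam i j = lam" "lam_ge lam (i - 1) j = lam"
      using 1 by (auto simp: lam_ge_def)
    ultimately show ?thesis by (simp add: C_minus_one)
  next
    case 2
    let ?x = "mon (gen i)"
    have "?x \<otimes> (C lam \<otimes> ?x) = C lam \<otimes> (?x \<otimes> ?x)"
      using cl by (intro C_left_commute) auto
    then have "(?x \<ominus> \<one>) \<oplus> (?x \<ominus> \<one>) \<otimes> (C lam \<otimes> ?x \<ominus> \<one>) = C lam \<otimes> ?x \<otimes> (?x \<ominus> \<one>)"
      using cl by (simp add: ring_norm)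
    moreover have "lam_ge lam i j = lam" "lam_ge lam (i - 1) j = 1"
      using 2 i by (auto simp: lam_ge_def)
    ultimately show ?thesis
      using 2 i cl by (simp add: tw_def D_e C_zero) (simp add: e_eq a_minus_def)
  next
    case 3
    then have "lam_ge lam i j = 1" "lam_ge lam (i - 1) j = 1"
      using i by (auto simp: lam_ge_def)
    moreover have "e j \<oplus> (mon (gen i) \<ominus> \<one>) \<otimes> e j = mon (gen i) \<otimes> e j"
      using cl e_closed[OF j] by (simp add: ring_norm)
    ultimately show ?thesis
      using 3 j cl e_closed[OF j] by (simp add: tw_def D_e C_zero C_one e_eq[of i] a_minus_def)
  qed
qed

text \<open>The pseudo-reflection \<open>f + e\<^sub>k D\<^sub>k(f)\<close> is invertible because \<open>v = 1 + D\<^sub>k(e\<^sub>k) = \<lambda>x\<^sub>k\<close> is a unit; its inverse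
  is \<open>f - e\<^sub>k v\<inverse> D\<^sub>k(f)\<close>.\<close>

lemma tw_bij:
  assumes k: "k \<in> {1..n}"
  shows "bij_betw (tw k) I I"
proof -
  define v u where "v = C lam \<otimes> mon (gen k)" and "u = C (1 / lam) \<otimes> mon (inv\<^bsub>Fn n\<^esub> (gen k))"
  have x: "mon (gen k) \<in> carrier R" and y: "mon (inv\<^bsub>Fn n\<^esub> (gen k)) \<in> carrier R"
    using k F.inv_closed[OF gen_closed[OF k]] by simp_all
  have cl: "v \<in> carrier R" "u \<in> carrier R" "e k \<in> carrier R"
    using x y k by (simp_all add: v_def u_def)
  have CC: "C lam \<otimes> C (1 / lam) = \<one>" "C (1 / lam) \<otimes> C lam = \<one>"
    using lam_nz by (simp_all add: C_mult[symmetric] C_one)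
  have "v \<otimes> u = C lam \<otimes> (C (1 / lam) \<otimes> (mon (gen k) \<otimes> mon (inv\<^bsub>Fn n\<^esub> (gen k))))"
    using x y by (simp add: v_def u_def m_assoc C_left_commute[of "mon (gen k)"])
  then have vu: "v \<otimes> u = \<one>"
    using mon_inv_mult(1)[of "gen k"] k CC by simp
  have "u \<otimes> v = C (1 / lam) \<otimes> (C lam \<otimes> (mon (inv\<^bsub>Fn n\<^esub> (gen k)) \<otimes> mon (gen k)))"
    using x y by (simp add: v_def u_def m_assoc C_left_commute[of "mon (inv\<^bsub>Fn n\<^esub> (gen k))"])
  then have uv: "u \<otimes> v = \<one>"
    using mon_inv_mult(2)[of "gen k"] k CC by simp
  define g where "g f = f \<oplus> e k \<otimes> (\<ominus> (u \<otimes> D k f))" for f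
  have De: "D k (f \<oplus> e k \<otimes> q) = D k f \<oplus> (v \<ominus> \<one>) \<otimes> q" if "f \<in> I" "q \<in> carrier R" for f q
    using that k D_right[of "e k" q k] D_e(2)[OF k] by (simp add: D_add v_def)
  have tg: "tw k (g f) = f" if f: "f \<in> I" for f
  proof -
    define q where "q = u \<otimes> D k f"
    have q: "q \<in> carrier R" "v \<otimes> q = D k f" "f \<in> carrier R" "D k f \<in> carrier R"
      using f cl vu by (simp_all add: q_def m_assoc[symmetric])
    have "tw k (g f) = f \<oplus> e k \<otimes> (\<ominus> q) \<oplus> e k \<otimes> (D k f \<oplus> (v \<ominus> \<one>) \<otimes> (\<ominus> q))"
      using f q unfolding tw_def g_def q_def[symmetric] by (simp add: De)
    also have "(v \<ominus> \<one>) \<otimes> (\<ominus> q) = \<ominus> (v \<otimes> q) \<oplus> q"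
      using cl q(1) by (simp add: ring_norm)
    finally show ?thesis
      unfolding q(2) using cl q(1,3,4) by (simp add: ring_norm)
  qed
  have gt: "g (tw k f) = f" if f: "f \<in> I" for f
  proof -
    have q: "f \<in> carrier R" "D k f \<in> carrier R" using f by simp_all
    have "D k (tw k f) = v \<otimes> D k f"
      using f q cl unfolding tw_def by (simp add: De) (simp add: ring_norm)
    then have "u \<otimes> D k (tw k f) = D k f"
      using cl q uv by (simp add: m_assoc[symmetric])
    then show ?thesis
      using cl q unfolding g_def by (simp add: tw_def ring_norm)
  qed
  have "g f \<in> I" if "f \<in> I" for f
    using that k cl by (simp add: g_def)
  then show ?thesis
    using tg gt k by (intro bij_betwI[of _ _ _ g]) auto
qed

abbreviation "MA \<equiv> module_Aut R AI"

lemma group_MA: "group MA"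
  by (rule module_Aut_group) simp_all

lemma tw_in_MA: "k \<in> {1..n} \<Longrightarrow> restrict (tw k) I \<in> carrier MA"
  using tw_bij[of k]
  by (auto simp: module_Aut_simps(1) Bij_def tw_add tw_right intro: bij_betw_cong[THEN iffD1, rotated])

abbreviation tact :: "nat gword \<Rightarrow> (nat gword \<Rightarrow> 'k) \<Rightarrow> nat gword \<Rightarrow> 'k" where
  "tact \<equiv> twisted_action n lam"

text \<open>Existence comes from the universal property of the free group. Uniqueness holds as a homomorphism
  is determined by the generators \<open>x\<^sub>i\<close>, and a right linear map by the generators \<open>e\<^sub>j\<close>.\<close>

lemma twisted_action_characterization:
  "tact \<in> hom (Fn n) MA \<and> tact \<in> extensional (carrier (Fn n)) \<and>
   (\<forall>i\<in>{1..n}. \<forall>j\<in>{1..n}. tact (gen i) (e j) = tw i (e j))"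
proof -
  let ?Q = "\<lambda>\<rho>. \<rho> \<in> hom (Fn n) MA \<and> \<rho> \<in> extensional (carrier (Fn n)) \<and>
    (\<forall>i\<in>{1..n}. \<forall>j\<in>{1..n}. \<rho> (gen i) (e j) = tw i (e j))"
  have tw_frozen: "tw i (e j) = (gr_monom (lam_ge lam i j) (gen i) \<otimes> gminus1 n j) \<ominus>
      (gr_monom (lam_ge lam (i - 1) j - 1) \<one>\<^bsub>Fn n\<^esub> \<otimes> gminus1 n j)"
    if "i \<in> {1..n}" "j \<in> {1..n}" for i j
    using tw_e[OF that]
    by (simp only: monom_eq[OF gen_closed[OF that(1)]] C_def[symmetric] free_group_simps(3)
        e_def[symmetric])
  have "tact = (THE \<rho>. ?Q \<rho>)"
    unfolding twisted_action_def R_def[symmetric]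
    by (rule arg_cong[of _ _ The], rule ext, intro conj_cong ball_cong refl)
       (simp only: e_def[symmetric] tw_frozen)
  moreover have "\<exists>!\<rho>. ?Q \<rho>"
  proof -
    interpret MA: group MA by (rule group_MA)
    let ?h = "word_val MA (\<lambda>k. restrict (tw k) I)"
    have h: "?h \<in> hom (Fn n) MA"
      by (rule MA.word_val_hom) (rule tw_in_MA)
    let ?\<rho> = "restrict ?h (carrier (Fn n))"
    have "?\<rho> \<in> hom (Fn n) MA"
      using h by (auto simp: hom_def)
    moreover have gen: "?\<rho> (gen i) = restrict (tw i) I" if "i \<in> {1..n}" for i
      using that MA.word_val_gen[of "\<lambda>k. restrict (tw k) I" i] tw_in_MA[OF that] by simp
    ultimately have Q: "?Q ?\<rho>" by simp
    moreover have "\<rho> = ?\<rho>" if \<rho>: "?Q \<rho>" for \<rho>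
    proof (rule extensionalityI[of _ "carrier (Fn n)"])
      fix w assume w: "w \<in> carrier (Fn n)"
      show "\<rho> w = ?\<rho> w"
      proof (rule free_group_hom_eq[OF group_MA _ _ _ w])
        fix i assume i: "i \<in> {1..n}"
        have 1: "\<rho> (gen i) \<in> carrier MA"
          using \<rho> hom_in_carrier[of \<rho> "Fn n" MA] i by simp
        have 2: "restrict (tw i) I \<in> carrier MA" using i by (rule tw_in_MA)
        have "\<rho> (gen i) = restrict (tw i) I"
        proof (rule extensionalityI[of _ I])
          show "\<rho> (gen i) \<in> extensional I" using 1 by (simp add: module_Aut_simps Bij_def)
          show "restrict (tw i) I \<in> extensional I" by simp
          have "\<rho> (gen i) \<in> I \<rightarrow> I"
            using 1 by (intro Bij_imp_funcset) (simp add: module_Aut_simps(1))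
          then have cl: "\<rho> (gen i) \<in> I \<rightarrow> carrier R"
            by (auto simp: Pi_iff)
          fix f assume f: "f \<in> I"
          have "\<rho> (gen i) f = tw i f"
            by (rule semilinear_maps_eq[where s = "\<lambda>r. r", OF _ _ _ _ _ _ _ _ f])
               (use cl 1 i \<rho> in \<open>auto simp: module_Aut_simps(1) tw_add tw_right\<close>)
          with f show "\<rho> (gen i) f = restrict (tw i) I f" by simp
        qed
        then show "\<rho> (gen i) = ?\<rho> (gen i)" using gen[OF i] by simp
      qed (use \<rho> Q in blast)+
    qed (use \<rho> in auto)
    ultimately show ?thesis by (intro ex1I[of _ ?\<rho>])
  qed
  ultimately show ?thesis using theI'[of ?Q] by simp
qed

lemma tact_hom: "tact \<in> hom (Fn n) MA"
  using twisted_action_characterization by blast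

lemma tact_in_MA: "x \<in> carrier (Fn n) \<Longrightarrow> tact x \<in> carrier MA"
  using hom_in_carrier[OF tact_hom] .

lemma tact_in_I [simp]: "x \<in> carrier (Fn n) \<Longrightarrow> f \<in> I \<Longrightarrow> tact x f \<in> I"
  using tact_in_MA[of x] Bij_imp_funcset[of "tact x" I] by (auto simp: module_Aut_simps(1))

lemma tact_add: "x \<in> carrier (Fn n) \<Longrightarrow> f \<in> I \<Longrightarrow> g \<in> I \<Longrightarrow> tact x (f \<oplus> g) = tact x f \<oplus> tact x g"
  using tact_in_MA[of x] by (simp add: module_Aut_simps(1))

lemma tact_right: "x \<in> carrier (Fn n) \<Longrightarrow> f \<in> I \<Longrightarrow> r \<in> carrier R \<Longrightarrow> tact x (f \<otimes> r) = tact x f \<otimes> r"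
  using tact_in_MA[of x] by (simp add: module_Aut_simps(1))

lemma tact_mult:
  assumes "x \<in> carrier (Fn n)" "y \<in> carrier (Fn n)" "f \<in> I"
  shows "tact (x \<otimes>\<^bsub>Fn n\<^esub> y) f = tact x (tact y f)"
  using hom_mult[OF tact_hom assms(1,2)] module_Aut_simps(2)[OF tact_in_MA tact_in_MA] assms by simp

lemma tact_one:
  assumes "f \<in> I" shows "tact \<one>\<^bsub>Fn n\<^esub> f = f"
proof -
  have "tact \<one>\<^bsub>Fn n\<^esub> = \<one>\<^bsub>MA\<^esub>"
    by (rule hom_one[OF tact_hom F.is_group group_MA])
  then show ?thesis using assms by (simp add: module_Aut_simps(3))
qed

lemma tact_gen:
  assumes i: "i \<in> {1..n}" and f: "f \<in> I"
  shows "tact (gen i) f = tw i f"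
  by (rule semilinear_maps_eq[where s = "\<lambda>r. r", OF _ _ _ _ _ _ _ _ f])
     (use i twisted_action_characterization in \<open>auto simp: tw_add tw_right tact_add tact_right\<close>)

end

section \<open>Equivariance under the braid group\<close>

lemma (in group) normal_Inter:
  assumes "\<And>N. N \<in> \<N> \<Longrightarrow> N \<lhd> G" "\<N> \<noteq> {}"
  shows "\<Inter>\<N> \<lhd> G"
  using assms subgroups_Inter[of \<N>] by (auto simp: normal_inv_iff)

lemma (in group) normal_closure_normal:
  assumes "S \<subseteq> carrier G"
  shows "normal_closure G S \<lhd> G"
proof -
  have "carrier G \<lhd> G"
    by (simp add: normal_inv_iff subgroup_self)
  then show ?thesis
    unfolding normal_closure_def using assms by (intro normal_Inter) auto
qed

lemma braid_relators_closed: "braid_relators n \<subseteq> carrier (free_group {1..n - 1})"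
proof -
  interpret F: group "free_group {1..n - 1}" by (rule group_free_group)
  show ?thesis
    unfolding braid_relators_def Let_def
    by (auto simp del: free_group_simps One_nat_def
        intro!: F.m_closed F.inv_closed gen_in_free_group)
qed

lemma AutoGroup_simps:
  "\<phi> \<in> carrier (AutoGroup H) \<longleftrightarrow> \<phi> \<in> hom H H \<and> \<phi> \<in> Bij (carrier H)"
  "\<lbrakk>\<phi> \<in> carrier (AutoGroup H); \<psi> \<in> carrier (AutoGroup H); x \<in> carrier H\<rbrakk> \<Longrightarrow>
     (\<phi> \<otimes>\<^bsub>AutoGroup H\<^esub> \<psi>) x = \<phi> (\<psi> x)"
  "x \<in> carrier H \<Longrightarrow> \<one>\<^bsub>AutoGroup H\<^esub> x = x"
  by (auto simp: AutoGroup_def auto_def BijGroup_def compose_eq)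

text \<open>The \<open>\<sigma>\<^sub>i\<close> generate the braid group, so a property that defines a subgroup of the automorphism group
  has to be checked only on their images.\<close>

lemma braid_image_in_subgroup:
  assumes artin: "is_artin_hom n \<theta>" and S: "subgroup S (AutoGroup (Fn n))"
    and gens: "\<And>i. i \<in> {1..n - 1} \<Longrightarrow> \<theta> (sigma n i) \<in> S"
    and b: "b \<in> carrier (braid_group n)"
  shows "\<theta> b \<in> S"
proof -
  let ?F = "free_group {1..n - 1}"
  interpret F: group ?F by (rule group_free_group)
  interpret Fn: group "Fn n" by (rule group_free_group)
  let ?N = "normal_closure ?F (braid_relators n)"
  interpret N: normal ?N ?F
    by (rule F.normal_closure_normal[OF braid_relators_closed])
  interpret A: group "AutoGroup (Fn n)" by (rule Fn.AutoGroup)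
  interpret S: subgroup S "AutoGroup (Fn n)" by (rule S)
  let ?h = "\<lambda>w. \<theta> (?N #>\<^bsub>?F\<^esub> w)"
  have \<theta>: "\<theta> \<in> hom (?F Mod ?N) (AutoGroup (Fn n))"
    using artin by (simp add: is_artin_hom_def braid_group_def)
  have h: "?h \<in> hom ?F (AutoGroup (Fn n))"
    using hom_compose[OF N.r_coset_hom_Mod \<theta>] by (simp add: o_def)
  interpret h: group_hom ?F "AutoGroup (Fn n)" ?h
    by (simp add: group_hom_def group_hom_axioms_def F.is_group A.is_group h)
  have "?h w \<in> S" if "w \<in> carrier ?F" for w
    using that
  proof (induction rule: free_group_induct)
    case one
    have "?h \<one>\<^bsub>?F\<^esub> = \<one>\<^bsub>AutoGroup (Fn n)\<^esub>" by (rule h.hom_one)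
    then show ?case using S.one_closed by (simp only: free_group_simps(3))
  next
    case (gen i w)
    have "?h (gen i) \<in> S" using gens[OF gen(1)] by (simp add: sigma_def)
    then show ?case
      using gen S.m_closed h.hom_mult[OF gen_in_free_group[OF gen(1)] gen(2)] by metis
  next
    case (inv i w)
    have "?h (gen i) \<in> S" using gens[OF inv(1)] by (simp add: sigma_def)
    moreover have "gen i \<in> carrier ?F" using inv(1) by (rule gen_in_free_group)
    ultimately show ?case
      using inv S.m_closed S.m_inv_closed h.hom_mult[OF F.inv_closed inv(2)] h.hom_inv by metis
  qed
  moreover obtain w where "w \<in> carrier ?F" "b = ?N #>\<^bsub>?F\<^esub> w"
    using b by (auto simp: braid_group_def FactGroup_def RCOSETS_def simp del: free_group_simps)
  ultimately show ?thesis by simp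
qed

context twisted_Fn_ring
begin

abbreviation "Aut \<equiv> AutoGroup (Fn n)"

lemma group_Aut: "group Aut"
  by (rule F.AutoGroup)

lemma tact_inv_cancel:
  assumes "x \<in> carrier (Fn n)" "f \<in> I"
  shows "tact (inv\<^bsub>Fn n\<^esub> x) (tact x f) = f" "tact x (tact (inv\<^bsub>Fn n\<^esub> x) f) = f"
proof -
  have "inv\<^bsub>Fn n\<^esub> x \<in> carrier (Fn n)" using assms(1) by (rule F.inv_closed)
  then show "tact (inv\<^bsub>Fn n\<^esub> x) (tact x f) = f" "tact x (tact (inv\<^bsub>Fn n\<^esub> x) f) = f"
    using assms tact_one[OF assms(2)] by (simp_all add: tact_mult[symmetric])
qed

text \<open>The compatibility with the twisted action that makes the two actions one action of the semidirect
  product.\<close>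

definition equivariant :: "(nat gword \<Rightarrow> nat gword) \<Rightarrow> bool" where
  "equivariant \<phi> \<longleftrightarrow> (\<forall>x\<in>carrier (Fn n). \<forall>f\<in>I. gr_map \<phi> (tact x f) = tact (\<phi> x) (gr_map \<phi> f))"

text \<open>Automorphisms that send generators to conjugates of generators will permute the eigenspaces.\<close>

definition conj_permutes :: "(nat gword \<Rightarrow> nat gword) \<Rightarrow> bool" where
  "conj_permutes \<phi> \<longleftrightarrow> (\<exists>\<pi>. bij_betw \<pi> {1..n} {1..n} \<and> (\<forall>j\<in>{1..n}. \<exists>y\<in>carrier (Fn n).
     \<phi> (gen j) = y \<otimes>\<^bsub>Fn n\<^esub> gen (\<pi> j) \<otimes>\<^bsub>Fn n\<^esub> inv\<^bsub>Fn n\<^esub> y))"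

context
  fixes \<phi> assumes \<phi>: "\<phi> \<in> carrier Aut"
begin

lemma aut_hom: "\<phi> \<in> hom (Fn n) (Fn n)" and aut_Bij: "\<phi> \<in> Bij (carrier (Fn n))"
  using \<phi> by (auto simp: AutoGroup_simps)

lemma aut_funcset: "\<phi> \<in> carrier (Fn n) \<rightarrow> carrier (Fn n)"
  using aut_hom by (simp add: hom_def)

lemma aut_closed [simp]: "x \<in> carrier (Fn n) \<Longrightarrow> \<phi> x \<in> carrier (Fn n)"
  using aut_funcset by auto

lemma aut_one: "\<phi> \<one>\<^bsub>Fn n\<^esub> = \<one>\<^bsub>Fn n\<^esub>"
  by (rule hom_one[OF aut_hom F.is_group F.is_group])

lemma aut_mult: "x \<in> carrier (Fn n) \<Longrightarrow> y \<in> carrier (Fn n) \<Longrightarrow>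
    \<phi> (x \<otimes>\<^bsub>Fn n\<^esub> y) = \<phi> x \<otimes>\<^bsub>Fn n\<^esub> \<phi> y"
  by (rule hom_mult[OF aut_hom])

lemma aut_inv: "x \<in> carrier (Fn n) \<Longrightarrow> \<phi> (inv\<^bsub>Fn n\<^esub> x) = inv\<^bsub>Fn n\<^esub> (\<phi> x)"
  using group_hom.hom_inv[of "Fn n" "Fn n" \<phi> x] aut_hom F.is_group
  by (simp add: group_hom_def group_hom_axioms_def)

lemma aut_ring_hom: "gr_map \<phi> \<in> ring_hom R R"
  unfolding R_def by (rule gr_map_ring_hom[OF F.monoid_axioms F.monoid_axioms aut_hom aut_one])

lemmas aut_ring =
  ring_hom_closed[OF aut_ring_hom] ring_hom_add[OF aut_ring_hom] ring_hom_mult[OF aut_ring_hom]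
  ring_hom_one[OF aut_ring_hom]

lemma aut_zero: "gr_map \<phi> \<zero> = \<zero>"
  by (simp add: zero_R gr_map_zero)

lemma aut_mon: "gr_map \<phi> (mon w) = mon (\<phi> w)"
  by (simp add: mon_def gr_map_monom)

lemma aut_C: "gr_map \<phi> (C c) = C c"
  using aut_one by (simp add: C_def gr_map_monom free_group_simps(3))

lemma aut_uminus: "a \<in> carrier R \<Longrightarrow> gr_map \<phi> (\<ominus> a) = \<ominus> gr_map \<phi> a"
  by (rule additive_map_minus[OF abelian_group_axioms abelian_group_axioms])
     (auto simp: aut_ring)

lemma aut_I [simp]: "f \<in> I \<Longrightarrow> gr_map \<phi> f \<in> I"
  using aut_ring(1)[of f] augmentation_gr_map[OF _ aut_funcset, of f]
  unfolding in_I by (simp add: R_def)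

lemma aut_e: "j \<in> {1..n} \<Longrightarrow> gr_map \<phi> (e j) = mon (\<phi> (gen j)) \<ominus> \<one>"
  unfolding e_eq a_minus_def by (simp add: aut_ring aut_uminus aut_mon)

lemma equivariant_if_on_gens:
  assumes gens: "\<And>k f. k \<in> {1..n} \<Longrightarrow> f \<in> I \<Longrightarrow>
    gr_map \<phi> (tact (gen k) f) = tact (\<phi> (gen k)) (gr_map \<phi> f)"
  shows "equivariant \<phi>"
proof -
  let ?eq = "\<lambda>x. \<forall>f\<in>I. gr_map \<phi> (tact x f) = tact (\<phi> x) (gr_map \<phi> f)"
  have mult: "?eq (x \<otimes>\<^bsub>Fn n\<^esub> y)"
    if "x \<in> carrier (Fn n)" "y \<in> carrier (Fn n)" "?eq x" "?eq y" for x y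
    using that by (simp add: aut_mult tact_mult)
  have inv: "?eq (inv\<^bsub>Fn n\<^esub> x)" if x: "x \<in> carrier (Fn n)" "?eq x" for x
  proof
    fix f assume f: "f \<in> I"
    have x': "inv\<^bsub>Fn n\<^esub> x \<in> carrier (Fn n)" using x by simp
    let ?g = "tact (inv\<^bsub>Fn n\<^esub> x) f"
    have g: "?g \<in> I" using x' f by simp
    have "gr_map \<phi> f = tact (\<phi> x) (gr_map \<phi> ?g)"
      using x(2) g tact_inv_cancel(2)[OF x(1) f] by metis
    then show "gr_map \<phi> ?g = tact (\<phi> (inv\<^bsub>Fn n\<^esub> x)) (gr_map \<phi> f)"
      using x g by (simp add: aut_inv tact_inv_cancel)
  qed
  have "?eq x" if "x \<in> carrier (Fn n)" for x
    using that
  proof (induction rule: free_group_induct)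
    case one
    show ?case using tact_one aut_one by (simp add: free_group_simps(3))
  next
    case (gen k w)
    then show ?case using mult[of "gen k" w] gens by simp
  next
    case (inv k w)
    then show ?case
      using mult[of "inv\<^bsub>Fn n\<^esub> (gen k)" w] \<open>\<And>x. x \<in> carrier (Fn n) \<Longrightarrow> ?eq x \<Longrightarrow> ?eq (inv\<^bsub>Fn n\<^esub> x)\<close>[of "gen k"]
        gens gen_closed F.inv_closed by metis
  qed
  then show ?thesis by (simp add: equivariant_def)
qed

end

lemma P_uminus: "f \<in> carrier R \<Longrightarrow> P k (\<ominus> f) = \<ominus> P k f"
  by (rule additive_map_minus[OF abelian_group_axioms abelian_group_axioms]) (auto simp: P_add)

text \<open>The image \<open>\<phi>\<close> of the generator \<open>\<sigma>\<^sub>i\<close> of the braid group, and the ring automorphism \<open>s\<close> that it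
  induces. The letters \<open>a\<close>, \<open>b\<close>, \<open>b'\<close> stand for \<open>x\<^sub>i\<close>, \<open>x\<^bsub>i+1\<^esub>\<close> and \<open>x\<^bsub>i+1\<^esub>\<inverse>\<close>, and \<open>E = b'ab - 1\<close> is
  the image of \<open>e\<^bsub>i+1\<^esub>\<close>.\<close>

context
  fixes \<phi> i assumes \<phi>: "\<phi> \<in> carrier Aut" and i: "i \<in> {1..n - 1}"
    and \<phi>_i: "\<phi> (gen i) = gen (i + 1)"
    and \<phi>_Suc: "\<phi> (gen (i + 1)) = inv\<^bsub>Fn n\<^esub> (gen (i + 1)) \<otimes>\<^bsub>Fn n\<^esub> gen i \<otimes>\<^bsub>Fn n\<^esub> gen (i + 1)"
    and \<phi>_else: "\<And>j. j \<in> {1..n} - {i, i + 1} \<Longrightarrow> \<phi> (gen j) = gen j"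
begin

abbreviation s :: "(nat gword \<Rightarrow> 'k) \<Rightarrow> nat gword \<Rightarrow> 'k" where "s \<equiv> gr_map \<phi>"
definition a :: "nat gword \<Rightarrow> 'k" where "a = mon (gen i)"
definition b :: "nat gword \<Rightarrow> 'k" where "b = mon (gen (i + 1))"
definition b' :: "nat gword \<Rightarrow> 'k" where "b' = mon (inv\<^bsub>Fn n\<^esub> (gen (i + 1)))"
text \<open>The expansion of \<open>b'ab - 1\<close> in the generators, from which right linear maps can be evaluated.\<close>

definition E :: "nat gword \<Rightarrow> 'k" where "E = e i \<otimes> b \<ominus> e (i + 1) \<otimes> (b' \<otimes> (a \<ominus> \<one>) \<otimes> b)"

lemma i_range: "i \<in> {1..n}" "i + 1 \<in> {1..n}"
  using i by auto

lemma letters_closed [simp]: "a \<in> carrier R" "b \<in> carrier R" "b' \<in> carrier R"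
  using i_range F.inv_closed[of "gen (i + 1)"] gen_closed[of i] gen_closed[of "i + 1"]
  unfolding a_def b_def b'_def by (blast intro: mon_closed)+

lemma bb': "b \<otimes> b' = \<one>" "b' \<otimes> b = \<one>"
  using mon_inv_mult[of "gen (i + 1)"] gen_closed[OF i_range(2)] by (simp_all add: b_def b'_def)

lemma bb'_assoc: "r \<in> carrier R \<Longrightarrow> b \<otimes> (b' \<otimes> r) = r"
  by (simp add: m_assoc[symmetric] bb')

lemma e_i: "e i = a \<ominus> \<one>" and e_Suc: "e (i + 1) = b \<ominus> \<one>"
  by (simp_all add: e_eq a_def b_def)

lemma E_eq: "E = b' \<otimes> a \<otimes> b \<ominus> \<one>"
  unfolding E_def e_i e_Suc by (simp add: ring_norm bb' bb'_assoc)

lemma E_in_I: "E \<in> I"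
  unfolding E_def using e_in_I[OF i_range(1)] e_in_I[OF i_range(2)] by simp

lemma E_closed [simp]: "E \<in> carrier R"
  using E_in_I by simp

lemma s_e: "s (e i) = e (i + 1)" "s (e (i + 1)) = E"
  "j \<in> {1..n} \<Longrightarrow> j \<noteq> i \<Longrightarrow> j \<noteq> i + 1 \<Longrightarrow> s (e j) = e j"
proof -
  show "s (e i) = e (i + 1)"
    using aut_e[OF \<phi> i_range(1)] by (simp only: \<phi>_i e_eq)
  show "s (e (i + 1)) = E"
    using aut_e[OF \<phi> i_range(2)]
    by (simp only: \<phi>_Suc mon_mult[symmetric] E_eq a_def[symmetric] b_def[symmetric] b'_def[symmetric])
  show "j \<in> {1..n} \<Longrightarrow> j \<noteq> i \<Longrightarrow> j \<noteq> i + 1 \<Longrightarrow> s (e j) = e j"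
    using aut_e[OF \<phi>] \<phi>_else[of j] by (simp add: e_eq)
qed

lemma s_mon: "s a = b" "s b = b' \<otimes> a \<otimes> b"
  by (simp_all only: a_def b_def b'_def aut_mon[OF \<phi>] \<phi>_i \<phi>_Suc mon_mult)

lemma s_simps:
  "r \<in> carrier R \<Longrightarrow> s r \<in> carrier R"
  "r \<in> carrier R \<Longrightarrow> r' \<in> carrier R \<Longrightarrow> s (r \<oplus> r') = s r \<oplus> s r'"
  "r \<in> carrier R \<Longrightarrow> r' \<in> carrier R \<Longrightarrow> s (r \<otimes> r') = s r \<otimes> s r'"
  "f \<in> I \<Longrightarrow> s f \<in> I"
  using aut_ring[OF \<phi>] aut_I[OF \<phi>] by simp_all

lemma P_E:
  "k < i \<Longrightarrow> P k E = \<zero>" "P i E = a \<otimes> b" "P (i + 1) E = \<zero>" "i + 1 < k \<Longrightarrow> P k E = E"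
proof -
  let ?c = "b' \<otimes> (a \<ominus> \<one>) \<otimes> b"
  note ei = e_in_I[OF i_range(1)] and eS = e_in_I[OF i_range(2)]
  have "P k (e i \<otimes> b \<oplus> \<ominus> (e (i + 1) \<otimes> ?c)) = P k (e i) \<otimes> b \<oplus> \<ominus> (P k (e (i + 1)) \<otimes> ?c)" for k
    using ei eS by (simp add: P_add P_uminus P_right)
  then have eq: "P k E = P k (e i) \<otimes> b \<ominus> P k (e (i + 1)) \<otimes> ?c" for k
    by (simp only: E_def a_minus_def)
  show "k < i \<Longrightarrow> P k E = \<zero>"
    unfolding eq by (simp add: P_e[OF i_range(1)] P_e[OF i_range(2)] a_minus_def)
  show "P i E = a \<otimes> b"
    unfolding eq by (simp add: P_e[OF i_range(1)] P_e[OF i_range(2)] a_minus_def a_def[symmetric])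
  show "P (i + 1) E = \<zero>"
    unfolding eq
    by (simp add: P_e[OF i_range(1)] P_e[OF i_range(2)] b_def[symmetric])
       (simp add: e_i ring_norm bb'_assoc)
  show "i + 1 < k \<Longrightarrow> P k E = E"
    unfolding eq by (simp add: P_e[OF i_range(1)] P_e[OF i_range(2)] E_def)
qed

text \<open>Equivariance is a statement about the functionals \<open>P\<^sub>k\<close>. For \<open>k \<noteq> i, i + 1\<close> they commute with \<open>s\<close>; for
  the other two values of \<open>k\<close> there are the next two relations, which correspond to \<open>\<phi>(x\<^sub>i) = x\<^bsub>i+1\<^esub>\<close> and
  to \<open>x\<^bsub>i+1\<^esub>\<phi>(x\<^bsub>i+1\<^esub>) = x\<^sub>ix\<^bsub>i+1\<^esub>\<close>.\<close>

lemma P_s: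
  assumes k: "k \<in> {1..n}" "k \<noteq> i" "k \<noteq> i + 1" and f: "f \<in> I"
  shows "P k (s f) = s (P k f)"
proof (rule semilinear_maps_eq[where s = s, OF _ _ _ _ _ _ _ _ f])
  fix j assume j: "j \<in> {1..n}"
  have sk: "s (mon (gen k)) = mon (gen k)"
    using \<phi>_else[of k] k by (simp add: aut_mon[OF \<phi>])
  consider "j = i" | "j = i + 1" | "j \<noteq> i" "j \<noteq> i + 1" by blast
  then show "P k (s (e j)) = s (P k (e j))"
  proof cases
    case 1
    then show ?thesis
      using k by (cases "k < i") (auto simp: s_e P_e[OF i_range(1)] P_e[OF i_range(2)] aut_zero[OF \<phi>])
  next
    case 2
    then show ?thesis
      using k by (cases "k < i") (auto simp: s_e P_E P_e[OF i_range(2)] aut_zero[OF \<phi>])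
  next
    case 3
    then show ?thesis
      using j by (simp add: s_e P_e sk aut_zero[OF \<phi>])
  qed
qed (auto simp: s_simps P_add P_right)

lemma P_Suc_s:
  assumes f: "f \<in> I"
  shows "P (i + 1) (s f) = s (P i f)"
proof (rule semilinear_maps_eq[where s = s, OF _ _ _ _ _ _ _ _ f])
  fix j assume j: "j \<in> {1..n}"
  consider "j = i" | "j = i + 1" | "j \<noteq> i" "j \<noteq> i + 1" by blast
  then show "P (i + 1) (s (e j)) = s (P i (e j))"
  proof cases
    case 1
    then show ?thesis
      using s_mon by (simp add: s_e P_e[OF i_range(1)] P_e[OF i_range(2)] a_def b_def)
  next
    case 2
    then show ?thesis
      by (simp add: s_e P_E P_e[OF i_range(2)] aut_zero[OF \<phi>])
  next
    case 3
    then show ?thesis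
      using j by (auto simp: s_e P_e aut_zero[OF \<phi>])
  qed
qed (auto simp: s_simps P_add P_right)

lemma P_pred_s:
  assumes f: "f \<in> I"
  shows "b \<otimes> s (P (i + 1) f) = P i (s f) \<oplus> e (i + 1) \<otimes> P (i + 1) (s f)"
proof (rule semilinear_maps_eq[where s = s and \<Phi> = "\<lambda>f. b \<otimes> s (P (i + 1) f)"
      and \<Psi> = "\<lambda>f. P i (s f) \<oplus> e (i + 1) \<otimes> P (i + 1) (s f)", OF _ _ _ _ _ _ _ _ f])
  fix j assume j: "j \<in> {1..n}"
  have ej: "e j \<in> carrier R" using j by simp
  consider "j = i" | "j = i + 1" | "j < i" | "j > i + 1" by linarith
  then show "b \<otimes> s (P (i + 1) (e j)) = P i (s (e j)) \<oplus> e (i + 1) \<otimes> P (i + 1) (s (e j))"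
  proof cases
    case 1
    have "b \<otimes> e (i + 1) = e (i + 1) \<otimes> b" unfolding e_Suc by (simp add: ring_norm)
    with 1 show ?thesis
      by (simp add: s_e P_e[OF i_range(1)] P_e[OF i_range(2)] b_def[symmetric] e_closed[OF i_range(2)])
  next
    case 2
    then show ?thesis
      by (simp add: s_e P_e[OF i_range(2)] P_E b_def[symmetric] s_mon e_closed[OF i_range(2)] m_assoc bb'_assoc)
  next
    case 3
    have "b \<otimes> e j = e j \<oplus> (b \<ominus> \<one>) \<otimes> e j" using ej by (simp add: ring_norm)
    with 3 show ?thesis using j by (simp add: s_e P_e e_Suc)
  next
    case 4
    then show ?thesis using j by (simp add: s_e P_e aut_zero[OF \<phi>] e_closed[OF i_range(2)])
  qed
qed (use e_closed[OF i_range(2)] in \<open>auto simp: s_simps P_add P_right r_distr l_distr m_assoc a_ac\<close>)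

lemma s_D: "f \<in> I \<Longrightarrow> s (D k f) = s f \<oplus> C (lam - 1) \<otimes> s (P k f)"
  by (simp add: D_def s_simps aut_C[OF \<phi>])

lemma s_tw: "k \<in> {1..n} \<Longrightarrow> f \<in> I \<Longrightarrow> s (tw k f) = s f \<oplus> s (e k) \<otimes> s (D k f)"
  by (simp add: tw_def s_simps)

text \<open>Equivariance for \<open>x\<^bsub>i+1\<^esub>\<close>, with \<open>\<phi>(x\<^bsub>i+1\<^esub>) = x\<^bsub>i+1\<^esub>\<inverse>x\<^sub>ix\<^bsub>i+1\<^esub>\<close> cleared of its inverse. Both sides are
  \<open>g + e\<^bsub>i+1\<^esub>q + e\<^sub>i(D\<^sub>i(g) + e\<^bsub>i+1\<^esub>q)\<close> with \<open>g = s f\<close> and \<open>q = D\<^bsub>i+1\<^esub>(g)\<close>.\<close>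

lemma tw_sigma_Suc:
  assumes f: "f \<in> I"
  shows "tw i (tw (i + 1) (s f)) = tw (i + 1) (s (tw (i + 1) f))"
proof -
  define g q d where "g = s f" and "q = D (i + 1) g" and "d = s (D (i + 1) f)"
  note ei = e_in_I[OF i_range(1)] and eS = e_in_I[OF i_range(2)]
  have cl: "g \<in> I" "q \<in> carrier R" "d \<in> carrier R"
    using f by (simp_all add: g_def q_def d_def s_simps)
  have D_E: "D (i + 1) E = E" by (simp add: D_def P_E)
  have bE: "b \<otimes> E = e i \<otimes> b"
    unfolding E_eq e_i by (simp add: ring_norm bb'_assoc)
  have bd: "b \<otimes> d = D i g \<oplus> e (i + 1) \<otimes> q"
  proof -
    have "b \<otimes> d = b \<otimes> g \<oplus> C (lam - 1) \<otimes> (b \<otimes> s (P (i + 1) f))"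
      using f cl by (simp add: d_def s_D g_def[symmetric] r_distr s_simps C_left_commute)
    also have "\<dots> = b \<otimes> g \<oplus> C (lam - 1) \<otimes> (P i g \<oplus> e (i + 1) \<otimes> P (i + 1) g)"
      using P_pred_s[OF f] by (simp add: g_def)
    also have "\<dots> = g \<oplus> C (lam - 1) \<otimes> P i g \<oplus> (e (i + 1) \<otimes> g \<oplus> e (i + 1) \<otimes> (C (lam - 1) \<otimes> P (i + 1) g))"
    proof -
      have "e (i + 1) \<otimes> (C (lam - 1) \<otimes> P (i + 1) g) = C (lam - 1) \<otimes> (e (i + 1) \<otimes> P (i + 1) g)"
        using cl eS by (intro C_left_commute) auto
      moreover have "b \<otimes> g = g \<oplus> e (i + 1) \<otimes> g"
        unfolding e_Suc using I_closed[OF cl(1)] by (simp add: ring_norm)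
      ultimately show ?thesis using I_closed[OF cl(1)] I_closed[OF eS] by (simp add: r_distr a_ac)
    qed
    finally show ?thesis
      using I_closed[OF cl(1)] I_closed[OF eS] by (simp add: D_def q_def r_distr)
  qed
  have "tw i (tw (i + 1) g) = g \<oplus> e (i + 1) \<otimes> q \<oplus> e i \<otimes> (D i g \<oplus> e (i + 1) \<otimes> q)"
    using cl eS D_e(3)[OF i_range(2), of i]
    by (simp add: tw_def q_def[symmetric] D_add D_right)
  also have "\<dots> = g \<oplus> e (i + 1) \<otimes> q \<oplus> b \<otimes> E \<otimes> d"
    using cl ei by (simp add: bE m_assoc bd)
  also have "\<dots> = (g \<oplus> E \<otimes> d) \<oplus> e (i + 1) \<otimes> (q \<oplus> E \<otimes> d)"
    unfolding e_Suc using I_closed[OF cl(1)] cl(2,3) by (simp add: ring_norm)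
  also have "\<dots> = tw (i + 1) (g \<oplus> E \<otimes> d)"
    using cl E_in_I by (simp add: tw_def D_add D_right D_E q_def)
  also have "g \<oplus> E \<otimes> d = s (tw (i + 1) f)"
    using f i_range by (simp add: s_tw s_e g_def d_def)
  finally show ?thesis by (simp add: g_def)
qed

lemma sigma_equivariant: "equivariant \<phi>"
proof (rule equivariant_if_on_gens[OF \<phi>])
  fix k f assume k: "k \<in> {1..n}" and f: "f \<in> I"
  note sf = s_simps(4)[OF f]
  consider "k = i" | "k = i + 1" | "k \<noteq> i" "k \<noteq> i + 1" by blast
  then show "s (tact (gen k) f) = tact (\<phi> (gen k)) (s f)"
  proof cases
    case 1
    have "s (D i f) = D (i + 1) (s f)"
      using P_Suc_s[OF f] unfolding s_D[OF f] by (simp add: D_def)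
    then show ?thesis
      using 1 f sf i_range by (simp add: \<phi>_i tact_gen s_tw s_e) (simp add: tw_def)
  next
    case 3
    have "s (D k f) = D k (s f)"
      using P_s[OF k 3 f] unfolding s_D[OF f] by (simp add: D_def)
    then show ?thesis
      using 3 k f sf by (simp add: \<phi>_else tact_gen s_tw s_e) (simp add: tw_def)
  next
    case 2
    let ?x = "gen (i + 1)" and ?h = "s (tact (gen (i + 1)) f)"
    have x: "?x \<in> carrier (Fn n)" "gen i \<in> carrier (Fn n)" "inv\<^bsub>Fn n\<^esub> ?x \<in> carrier (Fn n)"
      using gen_closed[OF i_range(1)] gen_closed[OF i_range(2)] by simp_all
    have h: "?h \<in> I" using x f by (simp add: s_simps)
    have "tact (gen i) (tact ?x (s f)) = tact ?x ?h"
      using tw_sigma_Suc[OF f] f sf x s_simps(4)[of "tw (i + 1) f"] i_range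
      by (simp add: tact_gen)
    then have "tact (\<phi> ?x) (s f) = tact (inv\<^bsub>Fn n\<^esub> ?x) (tact ?x ?h)"
      unfolding \<phi>_Suc using x sf by (simp add: tact_mult)
    also have "\<dots> = ?h"
      using tact_inv_cancel(1)[OF x(1) h] .
    finally show ?thesis using 2 by simp
  qed
qed

lemma sigma_conj_permutes: "conj_permutes \<phi>"
proof -
  let ?\<pi> = "\<lambda>j. if j = i then i + 1 else if j = i + 1 then i else j"
  have "bij_betw ?\<pi> {1..n} {1..n}"
    using i by (intro bij_betwI[of _ _ _ ?\<pi>]) auto
  moreover have "\<exists>y\<in>carrier (Fn n). \<phi> (gen j) = y \<otimes>\<^bsub>Fn n\<^esub> gen (?\<pi> j) \<otimes>\<^bsub>Fn n\<^esub> inv\<^bsub>Fn n\<^esub> y"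
    if j: "j \<in> {1..n}" for j
  proof (cases "j = i + 1")
    case True
    then show ?thesis
      using \<phi>_Suc gen_closed[OF i_range(2)]
      by (intro bexI[of _ "inv\<^bsub>Fn n\<^esub> (gen (i + 1))"]) simp_all
  next
    case False
    then show ?thesis
      using \<phi>_i \<phi>_else[of j] j gen_closed[OF j] gen_closed[OF i_range(2)]
      by (intro bexI[of _ "\<one>\<^bsub>Fn n\<^esub>"]) auto
  qed
  ultimately show ?thesis unfolding conj_permutes_def by blast
qed

end

text \<open>Both properties pass to products and inverses, so that they extend from the \<open>\<sigma>\<^sub>i\<close> to the braid group
  and to every Artin representation.\<close>

lemma equivariant_conj_permutes_subgroup:
  "subgroup {\<phi> \<in> carrier Aut. equivariant \<phi> \<and> conj_permutes \<phi>} Aut" (is "subgroup ?S Aut")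
proof -
  interpret A: group Aut by (rule group_Aut)
  show ?thesis
  proof (rule A.subgroupI)
    have "equivariant \<one>\<^bsub>Aut\<^esub>"
    proof -
      have "gr_map \<one>\<^bsub>Aut\<^esub> f = f" if "f \<in> I" for f
        using gr_map_cong[of f "Fn n" "\<one>\<^bsub>Aut\<^esub>" "\<lambda>x. x"] gr_map_ident[of f "Fn n"] I_closed[OF that]
        by (simp add: R_def AutoGroup_simps)
      then show ?thesis by (simp add: equivariant_def AutoGroup_simps)
    qed
    moreover have "conj_permutes \<one>\<^bsub>Aut\<^esub>"
      unfolding conj_permutes_def
      by (intro exI[of _ "\<lambda>j. j"] conjI ballI bexI[of _ "\<one>\<^bsub>Fn n\<^esub>"])
         (auto simp: bij_betw_def AutoGroup_simps)
    ultimately show "?S \<noteq> {}" using A.one_closed by blast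
  next
    fix \<phi> assume "\<phi> \<in> ?S"
    then have \<phi>: "\<phi> \<in> carrier Aut" "equivariant \<phi>" "conj_permutes \<phi>" by auto
    define \<psi> where "\<psi> = inv\<^bsub>Aut\<^esub> \<phi>"
    have \<psi>: "\<psi> \<in> carrier Aut" using \<phi>(1) by (simp add: \<psi>_def)
    have inv: "\<phi> (\<psi> x) = x" "\<psi> (\<phi> x) = x" if "x \<in> carrier (Fn n)" for x
      using that AutoGroup_simps(2)[OF \<phi>(1) \<psi> that] AutoGroup_simps(2)[OF \<psi> \<phi>(1) that]
        A.r_inv[OF \<phi>(1)] A.l_inv[OF \<phi>(1)] by (simp_all add: \<psi>_def AutoGroup_simps(3))
    have gr_inv: "gr_map \<phi> (gr_map \<psi> f) = f" "gr_map \<psi> (gr_map \<phi> f) = f" if "f \<in> I" for f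
    proof -
      have f: "f \<in> carrier (group_ring (Fn n))" using I_closed[OF that] by (simp add: R_def)
      show "gr_map \<phi> (gr_map \<psi> f) = f"
        using gr_map_comp[OF f aut_funcset[OF \<psi>], of \<phi>] gr_map_ident[OF f]
          gr_map_cong[OF f, of "\<lambda>x. \<phi> (\<psi> x)" "\<lambda>x. x"] inv by simp
      show "gr_map \<psi> (gr_map \<phi> f) = f"
        using gr_map_comp[OF f aut_funcset[OF \<phi>(1)], of \<psi>] gr_map_ident[OF f]
          gr_map_cong[OF f, of "\<lambda>x. \<psi> (\<phi> x)" "\<lambda>x. x"] inv by simp
    qed
    have "gr_map \<psi> (tact x f) = tact (\<psi> x) (gr_map \<psi> f)"
      if x: "x \<in> carrier (Fn n)" and f: "f \<in> I" for x f
    proof -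
      have c: "\<psi> x \<in> carrier (Fn n)" "gr_map \<psi> f \<in> I"
        using aut_closed[OF \<psi> x] aut_I[OF \<psi> f] .
      have "gr_map \<phi> (tact (\<psi> x) (gr_map \<psi> f)) = tact (\<phi> (\<psi> x)) (gr_map \<phi> (gr_map \<psi> f))"
        using \<phi>(2) c by (simp add: equivariant_def)
      also have "\<dots> = tact x f" using inv(1)[OF x] gr_inv(1)[OF f] by simp
      finally show ?thesis using gr_inv(2)[of "tact (\<psi> x) (gr_map \<psi> f)"] c by simp
    qed
    moreover have "conj_permutes \<psi>"
    proof -
      obtain \<pi> where \<pi>: "bij_betw \<pi> {1..n} {1..n}" and conj: "\<And>j. j \<in> {1..n} \<Longrightarrow>
        \<exists>y\<in>carrier (Fn n). \<phi> (gen j) = y \<otimes>\<^bsub>Fn n\<^esub> gen (\<pi> j) \<otimes>\<^bsub>Fn n\<^esub> inv\<^bsub>Fn n\<^esub> y"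
        using \<phi>(3) unfolding conj_permutes_def by blast
      let ?\<rho> = "inv_into {1..n} \<pi>"
      have "bij_betw ?\<rho> {1..n} {1..n}" using \<pi> by (rule bij_betw_inv_into)
      moreover have "\<exists>z\<in>carrier (Fn n). \<psi> (gen k) = z \<otimes>\<^bsub>Fn n\<^esub> gen (?\<rho> k) \<otimes>\<^bsub>Fn n\<^esub> inv\<^bsub>Fn n\<^esub> z"
        if k: "k \<in> {1..n}" for k
      proof -
        define j where "j = ?\<rho> k"
        have j: "j \<in> {1..n}" "\<pi> j = k"
          using \<pi> k bij_betw_inv_into_right[OF \<pi> k] bij_betwE[OF bij_betw_inv_into[OF \<pi>]]
          by (auto simp: j_def)
        obtain y where y: "y \<in> carrier (Fn n)"
          "\<phi> (gen j) = y \<otimes>\<^bsub>Fn n\<^esub> gen k \<otimes>\<^bsub>Fn n\<^esub> inv\<^bsub>Fn n\<^esub> y"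
          using conj[OF j(1)] j(2) by auto
        note gj = gen_closed[OF j(1)] and gk = gen_closed[OF k]
        let ?z = "inv\<^bsub>Fn n\<^esub> (\<psi> y)"
        have py: "\<psi> y \<in> carrier (Fn n)" "\<psi> (gen k) \<in> carrier (Fn n)"
          using aut_closed[OF \<psi>] y(1) gk by blast+
        have "gen j = \<psi> y \<otimes>\<^bsub>Fn n\<^esub> \<psi> (gen k) \<otimes>\<^bsub>Fn n\<^esub> inv\<^bsub>Fn n\<^esub> (\<psi> y)"
          using inv(2)[OF gj] y gk aut_mult[OF \<psi>] aut_inv[OF \<psi>] by simp
        then have "\<psi> (gen k) = ?z \<otimes>\<^bsub>Fn n\<^esub> gen j \<otimes>\<^bsub>Fn n\<^esub> inv\<^bsub>Fn n\<^esub> ?z"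
          using py by (simp add: F.m_assoc F.inv_solve_left)
        then show ?thesis using F.inv_closed[OF py(1)] by (auto simp: j_def)
      qed
      ultimately show ?thesis unfolding conj_permutes_def by blast
    qed
    ultimately show "inv\<^bsub>Aut\<^esub> \<phi> \<in> ?S" using \<psi> by (simp add: equivariant_def \<psi>_def)
  next
    fix \<phi> \<psi> assume "\<phi> \<in> ?S" "\<psi> \<in> ?S"
    then have \<phi>: "\<phi> \<in> carrier Aut" "equivariant \<phi>" "conj_permutes \<phi>"
      and \<psi>: "\<psi> \<in> carrier Aut" "equivariant \<psi>" "conj_permutes \<psi>" by auto
    define \<chi> where "\<chi> = \<phi> \<otimes>\<^bsub>Aut\<^esub> \<psi>"
    have \<chi>: "\<chi> \<in> carrier Aut" using \<phi>(1) \<psi>(1) by (simp add: \<chi>_def)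
    have comp: "\<chi> x = \<phi> (\<psi> x)" if "x \<in> carrier (Fn n)" for x
      using AutoGroup_simps(2)[OF \<phi>(1) \<psi>(1) that] by (simp add: \<chi>_def)
    have gr_comp: "gr_map \<chi> f = gr_map \<phi> (gr_map \<psi> f)" if "f \<in> I" for f
    proof -
      have f: "f \<in> carrier (group_ring (Fn n))" using I_closed[OF that] by (simp add: R_def)
      show ?thesis
        using gr_map_comp[OF f aut_funcset[OF \<psi>(1)], of \<phi>]
          gr_map_cong[OF f, of \<chi> "\<lambda>x. \<phi> (\<psi> x)"] comp by simp
    qed
    have "equivariant \<chi>"
      unfolding equivariant_def
    proof (intro ballI)
      fix x f assume x: "x \<in> carrier (Fn n)" and f: "f \<in> I"
      show "gr_map \<chi> (tact x f) = tact (\<chi> x) (gr_map \<chi> f)"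
        using \<phi>(2) \<psi>(2) x f aut_closed[OF \<psi>(1) x] aut_I[OF \<psi>(1) f]
        by (simp add: gr_comp comp equivariant_def)
    qed
    moreover have "conj_permutes \<chi>"
    proof -
      obtain \<pi> where \<pi>: "bij_betw \<pi> {1..n} {1..n}" and conj: "\<And>j. j \<in> {1..n} \<Longrightarrow>
        \<exists>y\<in>carrier (Fn n). \<phi> (gen j) = y \<otimes>\<^bsub>Fn n\<^esub> gen (\<pi> j) \<otimes>\<^bsub>Fn n\<^esub> inv\<^bsub>Fn n\<^esub> y"
        using \<phi>(3) unfolding conj_permutes_def by blast
      obtain \<rho> where \<rho>: "bij_betw \<rho> {1..n} {1..n}" and conj': "\<And>j. j \<in> {1..n} \<Longrightarrow>
        \<exists>y\<in>carrier (Fn n). \<psi> (gen j) = y \<otimes>\<^bsub>Fn n\<^esub> gen (\<rho> j) \<otimes>\<^bsub>Fn n\<^esub> inv\<^bsub>Fn n\<^esub> y"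
        using \<psi>(3) unfolding conj_permutes_def by blast
      have "\<exists>w\<in>carrier (Fn n). \<chi> (gen j) = w \<otimes>\<^bsub>Fn n\<^esub> gen (\<pi> (\<rho> j)) \<otimes>\<^bsub>Fn n\<^esub> inv\<^bsub>Fn n\<^esub> w"
        if j: "j \<in> {1..n}" for j
      proof -
        have \<rho>j: "\<rho> j \<in> {1..n}" "\<pi> (\<rho> j) \<in> {1..n}" using \<pi> \<rho> j by (meson bij_betwE)+
        obtain y where y: "y \<in> carrier (Fn n)"
          "\<psi> (gen j) = y \<otimes>\<^bsub>Fn n\<^esub> gen (\<rho> j) \<otimes>\<^bsub>Fn n\<^esub> inv\<^bsub>Fn n\<^esub> y"
          using conj'[OF j] by auto
        obtain z where z: "z \<in> carrier (Fn n)"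
          "\<phi> (gen (\<rho> j)) = z \<otimes>\<^bsub>Fn n\<^esub> gen (\<pi> (\<rho> j)) \<otimes>\<^bsub>Fn n\<^esub> inv\<^bsub>Fn n\<^esub> z"
          using conj[OF \<rho>j(1)] by auto
        note g = gen_closed[OF \<rho>j(1)] gen_closed[OF \<rho>j(2)]
        have py: "\<phi> y \<in> carrier (Fn n)" using aut_closed[OF \<phi>(1) y(1)] .
        have "\<chi> (gen j) = \<phi> y \<otimes>\<^bsub>Fn n\<^esub> \<phi> (gen (\<rho> j)) \<otimes>\<^bsub>Fn n\<^esub> inv\<^bsub>Fn n\<^esub> (\<phi> y)"
          using y g comp[OF gen_closed[OF j]] aut_mult[OF \<phi>(1)] aut_inv[OF \<phi>(1)] by simp
        also have "\<dots> = (\<phi> y \<otimes>\<^bsub>Fn n\<^esub> z) \<otimes>\<^bsub>Fn n\<^esub> gen (\<pi> (\<rho> j)) \<otimes>\<^bsub>Fn n\<^esub> inv\<^bsub>Fn n\<^esub> (\<phi> y \<otimes>\<^bsub>Fn n\<^esub> z)"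
          using py z g by (simp add: F.m_assoc F.inv_mult_group)
        finally show ?thesis using F.m_closed[OF py z(1)] by blast
      qed
      then show ?thesis
        unfolding conj_permutes_def using bij_betw_trans[OF \<rho> \<pi>]
        by (intro exI[of _ "\<lambda>j. \<pi> (\<rho> j)"]) (simp add: o_def)
    qed
    ultimately show "\<phi> \<otimes>\<^bsub>Aut\<^esub> \<psi> \<in> ?S" using \<chi> by (simp add: \<chi>_def)
  qed auto
qed

lemma artin_representation_good:
  assumes "artin_representation n G \<alpha>" and g: "g \<in> carrier G"
  shows "\<alpha> g \<in> carrier Aut" "equivariant (\<alpha> g)" "conj_permutes (\<alpha> g)"
proof -
  obtain \<theta> \<beta> where artin: "is_artin_hom n \<theta>" and \<beta>: "\<beta> \<in> hom G (braid_group n)"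
    and \<alpha>: "\<alpha> g = \<theta> (\<beta> g)"
    using assms by (auto simp: artin_representation_def)
  interpret FB: group "free_group {1..n - 1}" by (rule group_free_group)
  interpret N: normal "normal_closure (free_group {1..n - 1}) (braid_relators n)" "free_group {1..n - 1}"
    by (rule FB.normal_closure_normal[OF braid_relators_closed])
  have "\<theta> (sigma n i) \<in> {\<phi> \<in> carrier Aut. equivariant \<phi> \<and> conj_permutes \<phi>}"
    if i: "i \<in> {1..n - 1}" for i
  proof -
    have "sigma n i \<in> carrier (braid_group n)"
      unfolding sigma_def braid_group_def
      using hom_in_carrier[OF N.r_coset_hom_Mod gen_in_free_group[OF i]] .
    then have \<phi>: "\<theta> (sigma n i) \<in> carrier Aut"
      using artin hom_in_carrier[of \<theta> "braid_group n" Aut] by (simp add: is_artin_hom_def)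
    have "equivariant (\<theta> (sigma n i))" "conj_permutes (\<theta> (sigma n i))"
      using artin i unfolding is_artin_hom_def
      by (auto intro!: sigma_equivariant[OF \<phi> i] sigma_conj_permutes[OF \<phi> i] simp del: atLeastAtMost_iff)
    with \<phi> show ?thesis by simp
  qed
  from braid_image_in_subgroup[OF artin equivariant_conj_permutes_subgroup this, of "\<beta> g"]
  show "\<alpha> g \<in> carrier Aut" "equivariant (\<alpha> g)" "conj_permutes (\<alpha> g)"
    using hom_in_carrier[OF \<beta> g] \<alpha> by auto
qed

end

section \<open>The Long--Moody module\<close>

lemma semidirect_simps:
  "p \<in> carrier (semidirect H G \<alpha>) \<longleftrightarrow> fst p \<in> carrier H \<and> snd p \<in> carrier G"
  "(x, g) \<otimes>\<^bsub>semidirect H G \<alpha>\<^esub> (y, h) = (x \<otimes>\<^bsub>H\<^esub> \<alpha> g y, g \<otimes>\<^bsub>G\<^esub> h)"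
  "\<one>\<^bsub>semidirect H G \<alpha>\<^esub> = (\<one>\<^bsub>H\<^esub>, \<one>\<^bsub>G\<^esub>)"
  by (cases p; auto simp: semidirect_def)+

locale LM_setup = twisted_Fn_ring n R lam
  for n and R :: "(nat gword \<Rightarrow> 'k::field) ring" (structure) and lam +
  fixes G :: "('g, 'c) monoid_scheme" and \<alpha> :: "'g \<Rightarrow> nat gword \<Rightarrow> nat gword"
    and V :: "(nat gword \<times> 'g \<Rightarrow> 'k, 'v) module"
  assumes artin: "artin_representation n G \<alpha>"
    and V_module: "left_module (FG_ring n G \<alpha>) V"
begin

abbreviation "H \<equiv> semidirect (Fn n) G \<alpha>"
abbreviation "RH \<equiv> group_ring H :: (nat gword \<times> 'g \<Rightarrow> 'k) ring"
abbreviation "Vr \<equiv> restrict_Fn G V"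

sublocale G: group G
  using artin by (simp add: artin_representation_def)

sublocale V: left_module RH V
  by (rule V_module)

lemma \<alpha>_Aut: "g \<in> carrier G \<Longrightarrow> \<alpha> g \<in> carrier Aut"
  and \<alpha>_equivariant: "g \<in> carrier G \<Longrightarrow> equivariant (\<alpha> g)"
  and \<alpha>_conj: "g \<in> carrier G \<Longrightarrow> conj_permutes (\<alpha> g)"
  using artin_representation_good[OF artin] by blast+

lemma \<alpha>_hom: "\<alpha> \<in> hom G Aut"
  using artin by (simp add: artin_representation_def)

lemma \<alpha>_closed: "g \<in> carrier G \<Longrightarrow> x \<in> carrier (Fn n) \<Longrightarrow> \<alpha> g x \<in> carrier (Fn n)"
  by (rule aut_closed[OF \<alpha>_Aut])

lemma \<alpha>_mult:
  "g \<in> carrier G \<Longrightarrow> h \<in> carrier G \<Longrightarrow> x \<in> carrier (Fn n) \<Longrightarrow> \<alpha> (g \<otimes>\<^bsub>G\<^esub> h) x = \<alpha> g (\<alpha> h x)"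
  by (simp add: hom_mult[OF \<alpha>_hom] AutoGroup_simps(2) \<alpha>_Aut)

lemma \<alpha>_one: "x \<in> carrier (Fn n) \<Longrightarrow> \<alpha> \<one>\<^bsub>G\<^esub> x = x"
  by (simp add: hom_one[OF \<alpha>_hom G.is_group group_Aut] AutoGroup_simps(3))

lemma \<alpha>_inv: "g \<in> carrier G \<Longrightarrow> x \<in> carrier (Fn n) \<Longrightarrow> \<alpha> g (\<alpha> (inv\<^bsub>G\<^esub> g) x) = x"
  using \<alpha>_mult[of g "inv\<^bsub>G\<^esub> g" x] by (simp add: \<alpha>_one)

lemma monoid_H: "monoid H"
proof (rule monoidI)
  fix p q r assume "p \<in> carrier H" "q \<in> carrier H" "r \<in> carrier H"
  then show "p \<otimes>\<^bsub>H\<^esub> q \<otimes>\<^bsub>H\<^esub> r = p \<otimes>\<^bsub>H\<^esub> (q \<otimes>\<^bsub>H\<^esub> r)"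
    by (cases p; cases q; cases r)
       (simp add: semidirect_simps \<alpha>_closed \<alpha>_mult aut_mult[OF \<alpha>_Aut] F.m_assoc G.m_assoc)
next
  fix p q assume "p \<in> carrier H" "q \<in> carrier H"
  then show "p \<otimes>\<^bsub>H\<^esub> q \<in> carrier H"
    by (cases p; cases q) (simp add: semidirect_simps \<alpha>_closed)
next
  fix p assume "p \<in> carrier H"
  then show "\<one>\<^bsub>H\<^esub> \<otimes>\<^bsub>H\<^esub> p = p" "p \<otimes>\<^bsub>H\<^esub> \<one>\<^bsub>H\<^esub> = p"
    by (cases p; simp add: semidirect_simps \<alpha>_one aut_one[OF \<alpha>_Aut])+
qed (simp add: semidirect_simps)

abbreviation \<iota> :: "nat gword \<Rightarrow> nat gword \<times> 'g" where
  "\<iota> x \<equiv> (x, \<one>\<^bsub>G\<^esub>)"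

lemma \<iota>_hom: "\<iota> \<in> hom (Fn n) H"
  by (auto simp: hom_def semidirect_simps \<alpha>_one)

lemma \<iota>_ring_hom: "gr_map \<iota> \<in> ring_hom R RH"
  unfolding R_def
  by (rule gr_map_ring_hom[OF F.monoid_axioms monoid_H \<iota>_hom]) (simp add: semidirect_simps)

lemma Vr_simps [simp]:
  "carrier Vr = carrier V" "\<zero>\<^bsub>Vr\<^esub> = \<zero>\<^bsub>V\<^esub>" "v \<oplus>\<^bsub>Vr\<^esub> w = v \<oplus>\<^bsub>V\<^esub> w"
  "r \<odot>\<^bsub>Vr\<^esub> v = gr_map \<iota> r \<odot>\<^bsub>V\<^esub> v"
  by (simp_all add: restrict_Fn_def)

lemma Vr_module: "left_module R Vr"
  unfolding restrict_Fn_def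
  by (rule left_module_restrict_scalars[OF V_module ring_axioms \<iota>_ring_hom])

sublocale Vr: left_module R Vr
  by (rule Vr_module)

sublocale TP: tensor_product R AI Vr
proof -
  interpret A: abelian_group AI by (rule abelian_group_I)
  show "tensor_product R AI Vr"
    by unfold_locales
       (use Vr.smult_closed in \<open>simp_all del: Vr_simps(4)\<close>)
qed

abbreviation "T \<equiv> TP.T"
abbreviation "pure \<equiv> TP.pure"

lemma LM_space_eq: "LM_space n G V = T"
  by (simp add: LM_space_def R_def)

definition vact :: "'g \<Rightarrow> 'v \<Rightarrow> 'v" where
  "vact g v = gr_monom 1 (\<one>\<^bsub>Fn n\<^esub>, g) \<odot>\<^bsub>V\<^esub> v"

lemma vact_monom_closed: "g \<in> carrier G \<Longrightarrow> gr_monom 1 (\<one>\<^bsub>Fn n\<^esub>, g) \<in> carrier RH"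
  by (rule gr_monom_closed) (simp add: semidirect_simps)

lemma vact_closed: "g \<in> carrier G \<Longrightarrow> v \<in> carrier V \<Longrightarrow> vact g v \<in> carrier V"
  unfolding vact_def by (rule V.smult_closed[OF vact_monom_closed])

lemma vact_add: "g \<in> carrier G \<Longrightarrow> v \<in> carrier V \<Longrightarrow> w \<in> carrier V \<Longrightarrow>
    vact g (v \<oplus>\<^bsub>V\<^esub> w) = vact g v \<oplus>\<^bsub>V\<^esub> vact g w"
  unfolding vact_def by (rule V.smult_r_distr[OF vact_monom_closed])

lemma vact_mult:
  assumes "g \<in> carrier G" "h \<in> carrier G" "v \<in> carrier V"
  shows "vact (g \<otimes>\<^bsub>G\<^esub> h) v = vact g (vact h v)"
proof -
  have "gr_monom 1 (\<one>\<^bsub>Fn n\<^esub>, g) \<otimes>\<^bsub>RH\<^esub> gr_monom 1 (\<one>\<^bsub>Fn n\<^esub>, h) = gr_monom 1 (\<one>\<^bsub>Fn n\<^esub>, g \<otimes>\<^bsub>G\<^esub> h)"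
    using assms by (simp add: gr_monom_mult semidirect_simps aut_one[OF \<alpha>_Aut])
  then show ?thesis
    using V.smult_assoc[OF vact_monom_closed[OF assms(1)] vact_monom_closed[OF assms(2)] assms(3)]
    by (simp add: vact_def)
qed

lemma vact_one: "v \<in> carrier V \<Longrightarrow> vact \<one>\<^bsub>G\<^esub> v = v"
  using V.smult_one[of v] by (simp add: vact_def semidirect_simps)

text \<open>In the semidirect product \<open>g x = \<alpha>(g)(x) g\<close>.\<close>

lemma vact_semilinear:
  assumes g: "g \<in> carrier G" and r: "r \<in> carrier R" and v: "v \<in> carrier V"
  shows "vact g (r \<odot>\<^bsub>Vr\<^esub> v) = gr_map (\<alpha> g) r \<odot>\<^bsub>Vr\<^esub> vact g v"
proof -
  let ?g = "gr_monom 1 (\<one>\<^bsub>Fn n\<^esub>, g) :: nat gword \<times> 'g \<Rightarrow> 'k"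
  note gc = vact_monom_closed[OF g]
  note \<iota>c = ring_hom_closed[OF \<iota>_ring_hom]
  have "?g \<otimes>\<^bsub>RH\<^esub> gr_map \<iota> r = gr_map \<iota> (gr_map (\<alpha> g) r) \<otimes>\<^bsub>RH\<^esub> ?g"
    using r
  proof (induction rule: R_induct)
    case zero
    show ?case by (simp add: zero_R gr_map_zero)
  next
    case (add c w a)
    have 1: "?g \<otimes>\<^bsub>RH\<^esub> gr_map \<iota> (C c \<otimes> mon w) = gr_map \<iota> (gr_map (\<alpha> g) (C c \<otimes> mon w)) \<otimes>\<^bsub>RH\<^esub> ?g"
      using add g unfolding monom_eq[OF add(1), symmetric]
      by (simp add: gr_map_monom gr_monom_mult semidirect_simps \<alpha>_closed \<alpha>_one)
    have cl: "C c \<otimes> mon w \<in> carrier R" using add by simp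
    note s = aut_ring[OF \<alpha>_Aut[OF g]]
    show ?case
      using cl add(2,3) s(1)[OF cl] s(1)[OF add(2)] gc 1
      by (simp only: s(2) ring_hom_add[OF \<iota>_ring_hom] V.R.r_distr V.R.l_distr \<iota>c)
  qed
  then show ?thesis
    using V.smult_assoc[OF gc \<iota>c[OF r] v]
      V.smult_assoc[OF \<iota>c[OF aut_ring(1)[OF \<alpha>_Aut[OF g] r]] gc v]
    by (simp add: vact_def)
qed

lemma right_linear_compatible:
  assumes "\<And>f. f \<in> I \<Longrightarrow> \<phi> f \<in> I"
    and "\<And>f g. f \<in> I \<Longrightarrow> g \<in> I \<Longrightarrow> \<phi> (f \<oplus> g) = \<phi> f \<oplus> \<phi> g"
    and "\<And>f r. f \<in> I \<Longrightarrow> r \<in> carrier R \<Longrightarrow> \<phi> (f \<otimes> r) = \<phi> f \<otimes> r"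
  shows "TP.tensor_compatible \<phi> (\<lambda>v. v)"
  unfolding TP.tensor_compatible_def
  using assms TP.pure_balanced[of _ "\<phi> _"] by (auto simp del: Vr_simps(4))

lemma scale_eq: "f \<in> I \<Longrightarrow> (\<lambda>x. c * f x) = C c \<otimes> f"
  by (simp add: C_scale)

lemma scale_compatible: "TP.tensor_compatible (\<lambda>f x. c * f x) (\<lambda>v. v)"
  by (rule right_linear_compatible) (simp_all add: scale_eq r_distr m_assoc)

lemma tact_compatible: "x \<in> carrier (Fn n) \<Longrightarrow> TP.tensor_compatible (tact x) (\<lambda>v. v)"
  by (rule right_linear_compatible) (simp_all add: tact_add tact_right)

text \<open>Both sides of the balancing condition are \<open>\<alpha>(g)(f) \<otimes> \<alpha>(g)(r)gv\<close>, since \<open>\<alpha>(g)\<close> is a ring automorphism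
  and \<open>g\<close> acts semilinearly on \<open>V\<close>.\<close>

lemma G_compatible:
  assumes g: "g \<in> carrier G"
  shows "TP.tensor_compatible (gr_map (\<alpha> g)) (vact g)"
proof -
  note s = aut_ring[OF \<alpha>_Aut[OF g]] aut_I[OF \<alpha>_Aut[OF g]]
  have "pure (gr_map (\<alpha> g) (f \<otimes> r)) (vact g v) = pure (gr_map (\<alpha> g) f) (vact g (r \<odot>\<^bsub>Vr\<^esub> v))"
    if "f \<in> I" "r \<in> carrier R" "v \<in> carrier V" for f r v
    using TP.pure_balanced[of "gr_map (\<alpha> g) r" "gr_map (\<alpha> g) f" "vact g v"] that s g
    by (simp add: vact_semilinear vact_closed del: Vr_simps(4))
  then show ?thesis
    unfolding TP.tensor_compatible_def
    using s g by (auto simp: vact_closed vact_add simp del: Vr_simps(4))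
qed

abbreviation "S \<equiv> LM_scale n G V"
abbreviation "Fa \<equiv> LM_F_act n G lam V"
abbreviation "Ga \<equiv> LM_G_act n G \<alpha> V"

lemma S_eq: "S c = tensor_map R AI Vr (\<lambda>f x. c * f x) (\<lambda>v. v)"
  and Fa_eq: "Fa x = tensor_map R AI Vr (tact x) (\<lambda>v. v)"
  and Ga_eq: "Ga g = tensor_map R AI Vr (gr_map (\<alpha> g)) (vact g)"
  by (simp_all add: LM_scale_def LM_F_act_def LM_G_act_def LM_map_def R_def vact_def[abs_def])

lemma S_closed [simp]: "w \<in> carrier T \<Longrightarrow> S c w \<in> carrier T"
  and S_add: "u \<in> carrier T \<Longrightarrow> w \<in> carrier T \<Longrightarrow> S c (u \<oplus>\<^bsub>T\<^esub> w) = S c u \<oplus>\<^bsub>T\<^esub> S c w"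
  and S_pure: "f \<in> I \<Longrightarrow> v \<in> carrier V \<Longrightarrow> S c (pure f v) = pure (C c \<otimes> f) v"
  unfolding S_eq
  using TP.tensor_map_closed[OF scale_compatible] TP.tensor_map_add[OF scale_compatible]
    TP.tensor_map_pure[OF scale_compatible, of f v c] by (simp_all add: scale_eq del: TP.tensor_simps)

lemma Fa_closed [simp]: "x \<in> carrier (Fn n) \<Longrightarrow> w \<in> carrier T \<Longrightarrow> Fa x w \<in> carrier T"
  and Fa_add: "x \<in> carrier (Fn n) \<Longrightarrow> u \<in> carrier T \<Longrightarrow> w \<in> carrier T \<Longrightarrow>
    Fa x (u \<oplus>\<^bsub>T\<^esub> w) = Fa x u \<oplus>\<^bsub>T\<^esub> Fa x w"
  and Fa_pure: "x \<in> carrier (Fn n) \<Longrightarrow> f \<in> I \<Longrightarrow> v \<in> carrier V \<Longrightarrow> Fa x (pure f v) = pure (tact x f) v"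
  unfolding Fa_eq
  using TP.tensor_map_closed[OF tact_compatible] TP.tensor_map_add[OF tact_compatible]
    TP.tensor_map_pure[OF tact_compatible, of x f v] by (simp_all del: TP.tensor_simps)

lemma Ga_closed [simp]: "g \<in> carrier G \<Longrightarrow> w \<in> carrier T \<Longrightarrow> Ga g w \<in> carrier T"
  and Ga_add: "g \<in> carrier G \<Longrightarrow> u \<in> carrier T \<Longrightarrow> w \<in> carrier T \<Longrightarrow>
    Ga g (u \<oplus>\<^bsub>T\<^esub> w) = Ga g u \<oplus>\<^bsub>T\<^esub> Ga g w"
  and Ga_pure: "g \<in> carrier G \<Longrightarrow> f \<in> I \<Longrightarrow> v \<in> carrier V \<Longrightarrow>
    Ga g (pure f v) = pure (gr_map (\<alpha> g) f) (vact g v)"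
  unfolding Ga_eq
  using TP.tensor_map_closed[OF G_compatible] TP.tensor_map_add[OF G_compatible]
    TP.tensor_map_pure[OF G_compatible, of g f v] by (simp_all del: TP.tensor_simps)

declare TP.tensor_simps [simp del]

lemma maps_eqI:
  assumes "\<And>w. w \<in> carrier T \<Longrightarrow> p w \<in> carrier T" "\<And>w. w \<in> carrier T \<Longrightarrow> q w \<in> carrier T"
    and "\<And>v w. v \<in> carrier T \<Longrightarrow> w \<in> carrier T \<Longrightarrow> p (v \<oplus>\<^bsub>T\<^esub> w) = p v \<oplus>\<^bsub>T\<^esub> p w"
    and "\<And>v w. v \<in> carrier T \<Longrightarrow> w \<in> carrier T \<Longrightarrow> q (v \<oplus>\<^bsub>T\<^esub> w) = q v \<oplus>\<^bsub>T\<^esub> q w"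
    and "\<And>f v. f \<in> I \<Longrightarrow> v \<in> carrier V \<Longrightarrow> p (pure f v) = q (pure f v)"
    and "w \<in> carrier T"
  shows "p w = q w"
  by (rule TP.tensor_maps_eq[OF _ _ _ _ _ assms(6)]) (use assms in auto)

lemma pure_closed [simp]: "f \<in> I \<Longrightarrow> v \<in> carrier V \<Longrightarrow> pure f v \<in> carrier T"
  by (rule TP.pure_closed) simp_all

lemma pure_add_l: "f \<in> I \<Longrightarrow> g \<in> I \<Longrightarrow> v \<in> carrier V \<Longrightarrow> pure (f \<oplus> g) v = pure f v \<oplus>\<^bsub>T\<^esub> pure g v"
  using TP.pure_add_l[of f g v] by simp

lemma pure_add_r: "f \<in> I \<Longrightarrow> v \<in> carrier V \<Longrightarrow> w \<in> carrier V \<Longrightarrow>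
    pure f (v \<oplus>\<^bsub>V\<^esub> w) = pure f v \<oplus>\<^bsub>T\<^esub> pure f w"
  using TP.pure_add_r[of f v w] by simp

lemma pure_balanced: "f \<in> I \<Longrightarrow> r \<in> carrier R \<Longrightarrow> v \<in> carrier V \<Longrightarrow>
    pure (f \<otimes> r) v = pure f (r \<odot>\<^bsub>Vr\<^esub> v)"
  using TP.pure_balanced[of r f v] by simp

lemma tact_C: "x \<in> carrier (Fn n) \<Longrightarrow> f \<in> I \<Longrightarrow> tact x (C c \<otimes> f) = C c \<otimes> tact x f"
  using tact_right[of x f "C c"] by (simp add: C_commute)

lemma \<alpha>_gr_map_mult:
  assumes "g \<in> carrier G" "h \<in> carrier G" "f \<in> I"
  shows "gr_map (\<alpha> (g \<otimes>\<^bsub>G\<^esub> h)) f = gr_map (\<alpha> g) (gr_map (\<alpha> h) f)"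
proof -
  have f: "f \<in> carrier (group_ring (Fn n))" using I_closed[OF assms(3)] by (simp add: R_def)
  show ?thesis
    using gr_map_comp[OF f aut_funcset[OF \<alpha>_Aut[OF assms(2)]], of "\<alpha> g"]
      gr_map_cong[OF f, of "\<alpha> (g \<otimes>\<^bsub>G\<^esub> h)" "\<lambda>x. \<alpha> g (\<alpha> h x)"] \<alpha>_mult assms by simp
qed

lemma \<alpha>_gr_map_one:
  assumes "f \<in> I" shows "gr_map (\<alpha> \<one>\<^bsub>G\<^esub>) f = f"
proof -
  have f: "f \<in> carrier (group_ring (Fn n))" using I_closed[OF assms] by (simp add: R_def)
  show ?thesis
    using gr_map_cong[OF f, of "\<alpha> \<one>\<^bsub>G\<^esub>" "\<lambda>x. x"] gr_map_ident[OF f] \<alpha>_one by simp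
qed

lemma \<alpha>_gr_map_in_I [simp]: "g \<in> carrier G \<Longrightarrow> f \<in> I \<Longrightarrow> gr_map (\<alpha> g) f \<in> I"
  by (rule aut_I[OF \<alpha>_Aut])

lemma Fa_mult: "x \<in> carrier (Fn n) \<Longrightarrow> y \<in> carrier (Fn n) \<Longrightarrow> w \<in> carrier T \<Longrightarrow>
    Fa (x \<otimes>\<^bsub>Fn n\<^esub> y) w = Fa x (Fa y w)"
  by (rule maps_eqI[of "Fa (x \<otimes>\<^bsub>Fn n\<^esub> y)" "\<lambda>w. Fa x (Fa y w)"])
     (simp_all add: Fa_add Fa_pure tact_mult)

lemma Fa_one: "w \<in> carrier T \<Longrightarrow> Fa \<one>\<^bsub>Fn n\<^esub> w = w"
  by (rule maps_eqI[of "Fa \<one>\<^bsub>Fn n\<^esub>" "\<lambda>w. w"]) (simp_all add: Fa_add Fa_pure tact_one)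

lemma Fa_S: "x \<in> carrier (Fn n) \<Longrightarrow> w \<in> carrier T \<Longrightarrow> Fa x (S c w) = S c (Fa x w)"
  by (rule maps_eqI[of "\<lambda>w. Fa x (S c w)" "\<lambda>w. S c (Fa x w)"])
     (simp_all add: Fa_add Fa_pure S_add S_pure tact_C)

lemma Ga_mult: "g \<in> carrier G \<Longrightarrow> h \<in> carrier G \<Longrightarrow> w \<in> carrier T \<Longrightarrow>
    Ga (g \<otimes>\<^bsub>G\<^esub> h) w = Ga g (Ga h w)"
  by (rule maps_eqI[of "Ga (g \<otimes>\<^bsub>G\<^esub> h)" "\<lambda>w. Ga g (Ga h w)"])
     (simp_all add: Ga_add Ga_pure \<alpha>_gr_map_mult vact_mult vact_closed)

lemma Ga_one: "w \<in> carrier T \<Longrightarrow> Ga \<one>\<^bsub>G\<^esub> w = w"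
  by (rule maps_eqI[of "Ga \<one>\<^bsub>G\<^esub>" "\<lambda>w. w"])
     (simp_all add: Ga_add Ga_pure \<alpha>_gr_map_one vact_one)

lemma Ga_S: "g \<in> carrier G \<Longrightarrow> w \<in> carrier T \<Longrightarrow> Ga g (S c w) = S c (Ga g w)"
  by (rule maps_eqI[of "\<lambda>w. Ga g (S c w)" "\<lambda>w. S c (Ga g w)"])
     (simp_all add: Ga_add Ga_pure S_add S_pure vact_closed aut_ring[OF \<alpha>_Aut] aut_C[OF \<alpha>_Aut])

text \<open>The relation of the semidirect product; it is the equivariance of the twisted action.\<close>

lemma Ga_Fa: "g \<in> carrier G \<Longrightarrow> x \<in> carrier (Fn n) \<Longrightarrow> w \<in> carrier T \<Longrightarrow>
    Ga g (Fa x w) = Fa (\<alpha> g x) (Ga g w)"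
  by (rule maps_eqI[of "\<lambda>w. Ga g (Fa x w)" "\<lambda>w. Fa (\<alpha> g x) (Ga g w)"])
     (use \<alpha>_equivariant[of g] in \<open>simp_all add: Ga_add Ga_pure Fa_add Fa_pure vact_closed \<alpha>_closed equivariant_def\<close>)

lemma S_add_scalar: "w \<in> carrier T \<Longrightarrow> S (c + d) w = S c w \<oplus>\<^bsub>T\<^esub> S d w"
  by (rule maps_eqI[of "S (c + d)" "\<lambda>w. S c w \<oplus>\<^bsub>T\<^esub> S d w"])
     (simp_all add: S_add S_pure C_add l_distr pure_add_l TP.T.add.m_ac)

lemma S_mult: "w \<in> carrier T \<Longrightarrow> S (c * d) w = S c (S d w)"
  by (rule maps_eqI[of "S (c * d)" "\<lambda>w. S c (S d w)"])
     (simp_all add: S_add S_pure C_mult m_assoc)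

lemma S_one: "w \<in> carrier T \<Longrightarrow> S 1 w = w"
  by (rule maps_eqI[of "S 1" "\<lambda>w. w"]) (simp_all add: S_add S_pure C_one)

sublocale rep: representation T H S "\<lambda>h w. Fa (fst h) (Ga (snd h) w)"
proof -
  interpret H: monoid H by (rule monoid_H)
  show "representation T H S (\<lambda>h w. Fa (fst h) (Ga (snd h) w))"
  proof (unfold_locales, goal_cases)
    case (8 h h' w)
    then show ?case
      by (cases h; cases h')
         (simp add: semidirect_simps Fa_mult Ga_mult Ga_Fa \<alpha>_closed)
  qed (simp_all add: semidirect_simps S_add S_add_scalar S_mult S_one Fa_one Ga_one Fa_S Ga_S Fa_add Ga_add)
qed

abbreviation "L \<equiv> LM n G \<alpha> lam V"

lemma L_eq: "L = \<lparr>carrier = carrier T, monoid.mult = monoid.mult T, one = monoid.one T,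
    ring.zero = \<zero>\<^bsub>T\<^esub>, add = add T, smult = rep.act\<rparr>"
  unfolding LM_def Let_def LM_space_eq rep.act_def[abs_def] by simp

lemma L_simps [simp]: "carrier L = carrier T" "\<zero>\<^bsub>L\<^esub> = \<zero>\<^bsub>T\<^esub>" "v \<oplus>\<^bsub>L\<^esub> w = v \<oplus>\<^bsub>T\<^esub> w"
  by (simp_all add: L_eq)

lemma L_module: "left_module RH L"
  unfolding L_eq by (rule rep.left_module_act)

lemma L_monom: "x \<in> carrier (Fn n) \<Longrightarrow> g \<in> carrier G \<Longrightarrow> w \<in> carrier T \<Longrightarrow>
    gr_monom c (x, g) \<odot>\<^bsub>L\<^esub> w = S c (Fa x (Ga g w))"
  by (simp add: L_eq rep.act_monom semidirect_simps)

text \<open>The pseudo-reflection \<open>x\<^sub>i\<close> on the spanning elements \<open>e\<^sub>j \<otimes> v\<close>. The argument for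
  irreducibility uses the twisted action only through this formula.\<close>

lemma Fa_gen_pure_e:
  assumes i: "i \<in> {1..n}" and j: "j \<in> {1..n}" and v: "v \<in> carrier V"
  shows "Fa (gen i) (pure (e j) v) = pure (e j) v \<oplus>\<^bsub>T\<^esub> pure (e i) (D i (e j) \<odot>\<^bsub>Vr\<^esub> v)"
proof -
  have "Fa (gen i) (pure (e j) v) = pure (tw i (e j)) v"
    using assms by (simp add: Fa_pure tact_gen)
  also have "\<dots> = pure (e j) v \<oplus>\<^bsub>T\<^esub> pure (e i \<otimes> D i (e j)) v"
    using assms by (simp add: tw_def pure_add_l)
  finally show ?thesis using assms by (simp add: pure_balanced)
qed

end

section \<open>The kernel of the Katz quotient\<close>

context LM_setup
begin

sublocale L: left_module RH L
  by (rule L_module)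

lemma abelian_T: "abelian_group T" by (rule TP.T.abelian_group_axioms)

lemma finsum_L: "finsum L f A = finsum T f A"
  unfolding L_eq finsum_def finprod_def by simp

lemma finsum_mem:
  assumes "finite A" "\<And>i. i \<in> A \<Longrightarrow> u i \<in> B" "B \<subseteq> carrier T" "\<zero>\<^bsub>T\<^esub> \<in> B"
    and "\<And>v w. v \<in> B \<Longrightarrow> w \<in> B \<Longrightarrow> v \<oplus>\<^bsub>T\<^esub> w \<in> B"
  shows "finsum T u A \<in> B"
  using assms(1,2)
proof (induction A rule: finite_induct)
  case (insert i A)
  then have "u i \<in> carrier T" "u \<in> A \<rightarrow> carrier T" using assms(3) by auto
  with insert show ?case using assms(5) by simp
qed (simp add: assms(4))

lemma finsum_single:
  assumes "i \<in> {1..n}" "w \<in> carrier T"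
  shows "(\<Oplus>\<^bsub>T\<^esub>j\<in>{1..n}. if i = j then w else \<zero>\<^bsub>T\<^esub>) = w"
  using TP.T.add.finprod_singleton[of i "{1..n}" "\<lambda>j. w"] assms by simp

lemma S_zero: "S c \<zero>\<^bsub>T\<^esub> = \<zero>\<^bsub>T\<^esub>"
  by (rule additive_map_zero[OF abelian_T abelian_T]) (auto simp: S_add)

lemma Fa_zero: "x \<in> carrier (Fn n) \<Longrightarrow> Fa x \<zero>\<^bsub>T\<^esub> = \<zero>\<^bsub>T\<^esub>"
  by (rule additive_map_zero[OF abelian_T abelian_T]) (auto simp: Fa_add)

lemma S_uminus: "w \<in> carrier T \<Longrightarrow> S (- 1) w = \<ominus>\<^bsub>T\<^esub> w"
  using S_add_scalar[of w "- 1" 1] rep.S_zero[of w] S_one[of w]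
  by (intro TP.T.minus_equality[symmetric]) simp_all

lemma pure_zero: "f \<in> I \<Longrightarrow> pure f \<zero>\<^bsub>V\<^esub> = \<zero>\<^bsub>T\<^esub>"
  by (rule additive_map_zero[OF V.M.abelian_group_axioms abelian_T]) (auto simp: pure_add_r)

lemma Fa_inv_cancel:
  assumes "x \<in> carrier (Fn n)" "w \<in> carrier T"
  shows "Fa (inv\<^bsub>Fn n\<^esub> x) (Fa x w) = w" "Fa x (Fa (inv\<^bsub>Fn n\<^esub> x) w) = w"
proof -
  have "inv\<^bsub>Fn n\<^esub> x \<in> carrier (Fn n)" using assms(1) by (rule F.inv_closed)
  then show "Fa (inv\<^bsub>Fn n\<^esub> x) (Fa x w) = w" "Fa x (Fa (inv\<^bsub>Fn n\<^esub> x) w) = w"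
    using assms Fa_one[OF assms(2)] by (simp_all add: Fa_mult[symmetric])
qed

definition Inv :: "(((nat gword \<Rightarrow> 'k) \<times> 'v) \<Rightarrow>\<^sub>0 int) set set" where
  "Inv = {w \<in> carrier T. \<forall>x\<in>carrier (Fn n). Fa x w = w}"

text \<open>The eigenvalue of \<open>x\<^sub>j\<close> on the \<open>i\<close>-th eigenspace.\<close>

definition mu :: "nat \<Rightarrow> nat \<Rightarrow> 'k" where
  "mu i j = (if j = i then lam else 1)"

definition eig :: "nat \<Rightarrow> (((nat gword \<Rightarrow> 'k) \<times> 'v) \<Rightarrow>\<^sub>0 int) set set" where
  "eig i = {w \<in> carrier T. \<forall>j\<in>{1..n}. Fa (gen j) w = S (mu i j) w}"

definition N :: "(((nat gword \<Rightarrow> 'k) \<times> 'v) \<Rightarrow>\<^sub>0 int) set set" where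
  "N = {finsum T u {1..n} \<oplus>\<^bsub>T\<^esub> w | u w. (\<forall>i\<in>{1..n}. u i \<in> eig i) \<and> w \<in> Inv}"

lemma KLM_kernel_eq: "KLM_kernel n G lam L = N"
proof -
  have 1: "Fn_invariants n G L = Inv"
    unfolding Fn_invariants_def Inv_def by (auto simp: L_monom Ga_one S_one)
  have "Fn_eigen n G lam L i = eig i" if i: "i \<in> {1..n}" for i
  proof -
    have "w \<in> Fn_eigen n G lam L i \<longleftrightarrow> w \<in> eig i" for w
    proof (cases "w \<in> carrier T")
      case True
      have "w \<in> Fn_eigen n G lam L i \<longleftrightarrow>
          Fa (gen i) w = S lam w \<and> (\<forall>j\<in>{1..n} - {i}. Fa (gen j) w = w)"
        using True i by (auto simp: Fn_eigen_def L_monom Ga_one S_one Fa_one)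
      also have "\<dots> \<longleftrightarrow> w \<in> eig i"
        using True i by (auto simp: eig_def mu_def S_one)
      finally show ?thesis .
    qed (simp add: Fn_eigen_def eig_def)
    then show ?thesis by blast
  qed
  then have "(\<forall>i\<in>{1..n}. u i \<in> Fn_eigen n G lam L i) \<longleftrightarrow> (\<forall>i\<in>{1..n}. u i \<in> eig i)" for u
    by blast
  with 1 show ?thesis
    unfolding KLM_kernel_def N_def finsum_L L_simps(3) by simp
qed

lemma eig_closed: "w \<in> eig i \<Longrightarrow> w \<in> carrier T" and Inv_closed: "w \<in> Inv \<Longrightarrow> w \<in> carrier T"
  by (auto simp: eig_def Inv_def)

lemma zero_in_eig: "\<zero>\<^bsub>T\<^esub> \<in> eig i" and zero_in_Inv: "\<zero>\<^bsub>T\<^esub> \<in> Inv"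
  by (simp_all add: eig_def Inv_def Fa_zero S_zero)

lemma eig_add: "v \<in> eig i \<Longrightarrow> w \<in> eig i \<Longrightarrow> v \<oplus>\<^bsub>T\<^esub> w \<in> eig i"
  and Inv_add: "v \<in> Inv \<Longrightarrow> w \<in> Inv \<Longrightarrow> v \<oplus>\<^bsub>T\<^esub> w \<in> Inv"
  by (simp_all add: eig_def Inv_def Fa_add S_add)

lemma N_closed: "N \<subseteq> carrier T"
  unfolding N_def by (auto intro!: TP.T.a_closed TP.T.finsum_closed dest: eig_closed Inv_closed)

lemma N_add:
  assumes "v \<in> N" "w \<in> N" shows "v \<oplus>\<^bsub>T\<^esub> w \<in> N"
proof -
  obtain u v' where u: "\<And>i. i \<in> {1..n} \<Longrightarrow> u i \<in> eig i" "v' \<in> Inv" "v = finsum T u {1..n} \<oplus>\<^bsub>T\<^esub> v'"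
    using assms(1) unfolding N_def by blast
  obtain t w' where t: "\<And>i. i \<in> {1..n} \<Longrightarrow> t i \<in> eig i" "w' \<in> Inv" "w = finsum T t {1..n} \<oplus>\<^bsub>T\<^esub> w'"
    using assms(2) unfolding N_def by blast
  have ut: "u \<in> {1..n} \<rightarrow> carrier T" "t \<in> {1..n} \<rightarrow> carrier T" using u(1) t(1) eig_closed by blast+
  then have c: "finsum T u {1..n} \<in> carrier T" "finsum T t {1..n} \<in> carrier T" "v' \<in> carrier T" "w' \<in> carrier T"
    using u t by (auto intro: TP.T.finsum_closed dest: Inv_closed)
  have "v \<oplus>\<^bsub>T\<^esub> w = (finsum T u {1..n} \<oplus>\<^bsub>T\<^esub> finsum T t {1..n}) \<oplus>\<^bsub>T\<^esub> (v' \<oplus>\<^bsub>T\<^esub> w')"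
    using c by (simp add: u(3) t(3) TP.T.a_ac)
  also have "finsum T u {1..n} \<oplus>\<^bsub>T\<^esub> finsum T t {1..n} = finsum T (\<lambda>i. u i \<oplus>\<^bsub>T\<^esub> t i) {1..n}"
    using TP.T.finsum_addf[OF ut] by simp
  finally show ?thesis
    unfolding N_def using u t eig_add Inv_add by blast
qed

lemma Inv_subset_N: "Inv \<subseteq> N"
proof
  fix w assume w: "w \<in> Inv"
  have "w = finsum T (\<lambda>i. \<zero>\<^bsub>T\<^esub>) {1..n} \<oplus>\<^bsub>T\<^esub> w"
    using Inv_closed[OF w] by simp
  then show "w \<in> N" unfolding N_def using w zero_in_eig by blast
qed

lemma eig_subset_N:
  assumes i: "i \<in> {1..n}" shows "eig i \<subseteq> N"
proof
  fix w assume w: "w \<in> eig i"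
  have "w = finsum T (\<lambda>j. if i = j then w else \<zero>\<^bsub>T\<^esub>) {1..n} \<oplus>\<^bsub>T\<^esub> \<zero>\<^bsub>T\<^esub>"
    using eig_closed[OF w] finsum_single[OF i] by simp
  moreover have "\<forall>j\<in>{1..n}. (if i = j then w else \<zero>\<^bsub>T\<^esub>) \<in> eig j"
    using w zero_in_eig by auto
  ultimately show "w \<in> N" unfolding N_def using zero_in_Inv by blast
qed

text \<open>The kernel is the additive group generated by the eigenspaces and the invariants, so an additive map
  preserves it when it maps each of these into it.\<close>

lemma additive_map_N:
  assumes "\<Phi> \<in> carrier T \<rightarrow> carrier T"
    and "\<And>v w. v \<in> carrier T \<Longrightarrow> w \<in> carrier T \<Longrightarrow> \<Phi> (v \<oplus>\<^bsub>T\<^esub> w) = \<Phi> v \<oplus>\<^bsub>T\<^esub> \<Phi> w"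
    and "\<And>i w. i \<in> {1..n} \<Longrightarrow> w \<in> eig i \<Longrightarrow> \<Phi> w \<in> N" and "\<And>w. w \<in> Inv \<Longrightarrow> \<Phi> w \<in> N"
    and "w \<in> N"
  shows "\<Phi> w \<in> N"
proof -
  obtain u v where u: "\<And>i. i \<in> {1..n} \<Longrightarrow> u i \<in> eig i" "v \<in> Inv" "w = finsum T u {1..n} \<oplus>\<^bsub>T\<^esub> v"
    using assms(5) unfolding N_def by blast
  have uc: "u \<in> {1..n} \<rightarrow> carrier T" using u(1) eig_closed by blast
  then have "\<Phi> w = \<Phi> (finsum T u {1..n}) \<oplus>\<^bsub>T\<^esub> \<Phi> v"
    using u Inv_closed by (simp add: assms(2))
  also have "\<Phi> (finsum T u {1..n}) = finsum T (\<lambda>i. \<Phi> (u i)) {1..n}"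
    by (rule additive_map_finsum[where f = \<Phi> and g = u, OF abelian_T abelian_T assms(1,2) _ uc]) simp_all
  also have "\<dots> \<oplus>\<^bsub>T\<^esub> \<Phi> v \<in> N"
  proof (rule N_add)
    have "\<zero>\<^bsub>T\<^esub> \<in> N" using Inv_subset_N zero_in_Inv by blast
    moreover have "\<Phi> (u i) \<in> N" if "i \<in> {1..n}" for i using assms(3) u(1) that by blast
    ultimately show "finsum T (\<lambda>i. \<Phi> (u i)) {1..n} \<in> N"
      by (intro finsum_mem N_closed N_add) auto
    show "\<Phi> v \<in> N" using assms(4) u(2) .
  qed
  finally show ?thesis .
qed

lemma mu_nz: "mu i j \<noteq> 0"
  using lam_nz by (simp add: mu_def)

lemma S_commute: "w \<in> carrier T \<Longrightarrow> S c (S d w) = S d (S c w)"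
  by (simp add: S_mult[symmetric] mult.commute)

lemma scalar_inv:
  assumes x: "x \<in> carrier (Fn n)" and w: "w \<in> carrier T" and c: "c \<noteq> 0" and eq: "Fa x w = S c w"
  shows "Fa (inv\<^bsub>Fn n\<^esub> x) w = S (1 / c) w"
proof -
  have xi: "inv\<^bsub>Fn n\<^esub> x \<in> carrier (Fn n)" using x by (rule F.inv_closed)
  have "w = S c (Fa (inv\<^bsub>Fn n\<^esub> x) w)"
    using Fa_inv_cancel(1)[OF x w] Fa_S[OF xi w] by (simp add: eq)
  then have "S (1 / c) w = S (1 / c) (S c (Fa (inv\<^bsub>Fn n\<^esub> x) w))" by simp
  also have "\<dots> = Fa (inv\<^bsub>Fn n\<^esub> x) w"
    using c w xi by (simp add: S_mult[symmetric] S_one)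
  finally show ?thesis ..
qed

text \<open>The generators act on an eigenvector by nonzero scalars, hence so does every word.\<close>

lemma eig_scalar:
  assumes w: "w \<in> eig i" and x: "x \<in> carrier (Fn n)"
  shows "\<exists>c. Fa x w = S c w"
proof -
  note wT = eig_closed[OF w]
  have mult: "\<exists>c. Fa (x \<otimes>\<^bsub>Fn n\<^esub> y) w = S c w"
    if xy: "x \<in> carrier (Fn n)" "y \<in> carrier (Fn n)" "Fa x w = S c w" "\<exists>d. Fa y w = S d w" for x y c
  proof -
    obtain d where d: "Fa y w = S d w" using xy(4) by blast
    have "Fa (x \<otimes>\<^bsub>Fn n\<^esub> y) w = S (d * c) w"
      using xy(1-3) wT by (simp add: Fa_mult d Fa_S S_mult)
    then show ?thesis by blast
  qed
  from x show ?thesis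
  proof (induction rule: free_group_induct)
    case one
    then show ?case using Fa_one[OF wT] S_one[OF wT] free_group_simps(3) by metis
  next
    case (gen k y)
    then show ?case using w by (intro mult[of _ _ "mu i k"]) (auto simp: eig_def)
  next
    case (inv k y)
    have g: "gen k \<in> carrier (Fn n)" using inv by simp
    have "Fa (inv\<^bsub>Fn n\<^esub> (gen k)) w = S (1 / mu i k) w"
      by (rule scalar_inv[OF g wT mu_nz]) (use w inv in \<open>simp add: eig_def\<close>)
    then show ?case using inv g by (intro mult[of _ _ "1 / mu i k"] F.inv_closed)
  qed
qed

lemma S_eig: "w \<in> eig i \<Longrightarrow> S c w \<in> eig i"
  by (simp add: eig_def Fa_S S_commute)

lemma S_Inv: "w \<in> Inv \<Longrightarrow> S c w \<in> Inv"
  by (simp add: Inv_def Fa_S)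

lemma N_S:
  assumes "w \<in> N" shows "S c w \<in> N"
proof (rule additive_map_N[OF _ _ _ _ assms])
  fix i u assume "i \<in> {1..n}" "u \<in> eig i"
  then show "S c u \<in> N" using S_eig eig_subset_N by blast
next
  fix u assume "u \<in> Inv"
  then show "S c u \<in> N" using S_Inv Inv_subset_N by blast
qed (auto simp: S_add)

lemma N_Fa:
  assumes x: "x \<in> carrier (Fn n)" and w: "w \<in> N"
  shows "Fa x w \<in> N"
proof (rule additive_map_N[OF _ _ _ _ w])
  fix i u assume i: "i \<in> {1..n}" and u: "u \<in> eig i"
  then show "Fa x u \<in> N" using eig_scalar[OF u x] S_eig[OF u] eig_subset_N[OF i] by auto
next
  fix u assume "u \<in> Inv"
  then show "Fa x u \<in> N" using x Inv_subset_N by (auto simp: Inv_def)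
qed (use x in \<open>auto simp: Fa_add\<close>)

lemma conj_scalar:
  assumes y: "y \<in> carrier (Fn n)" and z: "z \<in> carrier (Fn n)" and w: "w \<in> carrier T"
    and zw: "Fa z w = S c w" and yw: "Fa (inv\<^bsub>Fn n\<^esub> y) w = S d w"
  shows "Fa (y \<otimes>\<^bsub>Fn n\<^esub> z \<otimes>\<^bsub>Fn n\<^esub> inv\<^bsub>Fn n\<^esub> y) w = S c w"
proof -
  have yi: "inv\<^bsub>Fn n\<^esub> y \<in> carrier (Fn n)" using y by (rule F.inv_closed)
  have "Fa (y \<otimes>\<^bsub>Fn n\<^esub> z \<otimes>\<^bsub>Fn n\<^esub> inv\<^bsub>Fn n\<^esub> y) w = Fa y (Fa z (S d w))"
    using y z yi w by (simp add: Fa_mult yw)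
  also have "\<dots> = S c (Fa y (Fa (inv\<^bsub>Fn n\<^esub> y) w))"
    using y z w by (simp add: Fa_S zw yw S_commute[of _ c d])
  also have "\<dots> = S c w" using Fa_inv_cancel(2)[OF y w] by simp
  finally show ?thesis .
qed

text \<open>The element \<open>g\<close> permutes the eigenspaces: \<open>x\<^sub>j\<close> acts on \<open>g u\<close> as \<open>\<alpha>(g\<inverse>)(x\<^sub>j)\<close> acts on \<open>u\<close>. The latter is a
  conjugate of some \<open>x\<^bsub>\<pi> j\<^esub>\<close>, and conjugation is invisible on a vector on which all words act by scalars.\<close>

lemma N_Ga:
  assumes g: "g \<in> carrier G" and w: "w \<in> N"
  shows "Ga g w \<in> N"
proof (rule additive_map_N[OF _ _ _ _ w])
  let ?h = "inv\<^bsub>G\<^esub> g"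
  have h: "?h \<in> carrier G" using g by simp
  have move: "Fa x (Ga g u) = Ga g (Fa (\<alpha> ?h x) u)" if "x \<in> carrier (Fn n)" "u \<in> carrier T" for x u
    using that g h \<alpha>_inv[OF g that(1)] by (simp add: Ga_Fa \<alpha>_closed)
  fix u assume u: "u \<in> Inv"
  then have "Ga g u \<in> Inv"
    using g h by (auto simp: Inv_def move \<alpha>_closed)
  then show "Ga g u \<in> N" using Inv_subset_N by blast
next
  let ?h = "inv\<^bsub>G\<^esub> g"
  have h: "?h \<in> carrier G" using g by simp
  have move: "Fa x (Ga g u) = Ga g (Fa (\<alpha> ?h x) u)" if "x \<in> carrier (Fn n)" "u \<in> carrier T" for x u
    using that g h \<alpha>_inv[OF g that(1)] by (simp add: Ga_Fa \<alpha>_closed)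
  fix i u assume i: "i \<in> {1..n}" and u: "u \<in> eig i"
  note uT = eig_closed[OF u]
  obtain \<pi> where \<pi>: "bij_betw \<pi> {1..n} {1..n}" and conj: "\<And>j. j \<in> {1..n} \<Longrightarrow>
    \<exists>y\<in>carrier (Fn n). \<alpha> ?h (gen j) = y \<otimes>\<^bsub>Fn n\<^esub> gen (\<pi> j) \<otimes>\<^bsub>Fn n\<^esub> inv\<^bsub>Fn n\<^esub> y"
    using \<alpha>_conj[OF h] unfolding conj_permutes_def by blast
  have "i \<in> \<pi> ` {1..n}" using i bij_betw_imp_surj_on[OF \<pi>] by simp
  then obtain k where k: "k \<in> {1..n}" "\<pi> k = i" by (elim imageE) simp
  have "Fa (gen j) (Ga g u) = S (mu k j) (Ga g u)" if j: "j \<in> {1..n}" for j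
  proof -
    have \<pi>j: "\<pi> j \<in> {1..n}" using \<pi> j by (meson bij_betwE)
    have "\<pi> j = \<pi> k \<longleftrightarrow> j = k"
      by (rule inj_on_eq_iff[OF bij_betw_imp_inj_on[OF \<pi>] j k(1)])
    then have mu: "mu i (\<pi> j) = mu k j"
      using k(2) by (simp add: mu_def)
    obtain y where y: "y \<in> carrier (Fn n)"
      "\<alpha> ?h (gen j) = y \<otimes>\<^bsub>Fn n\<^esub> gen (\<pi> j) \<otimes>\<^bsub>Fn n\<^esub> inv\<^bsub>Fn n\<^esub> y"
      using conj[OF j] by blast
    obtain d where d: "Fa (inv\<^bsub>Fn n\<^esub> y) u = S d u"
      using eig_scalar[OF u F.inv_closed[OF y(1)]] by blast
    have "Fa (gen (\<pi> j)) u = S (mu k j) u"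
      using u \<pi>j mu by (simp add: eig_def)
    from conj_scalar[OF y(1) gen_closed[OF \<pi>j] uT this d]
    have "Fa (\<alpha> ?h (gen j)) u = S (mu k j) u" by (simp add: y(2))
    then show ?thesis using move[OF gen_closed[OF j] uT] Ga_S[OF g uT] by simp
  qed
  then have "Ga g u \<in> eig k" using uT g by (simp add: eig_def)
  then show "Ga g u \<in> N" using eig_subset_N[OF k(1)] by blast
qed (use g in \<open>auto simp: Ga_add\<close>)

lemma N_submodule: "submodule N RH L"
proof (rule L.submoduleI)
  show "N \<subseteq> carrier L" using N_closed by simp
  show zero: "\<zero>\<^bsub>L\<^esub> \<in> N" using Inv_subset_N zero_in_Inv by auto
  show "v \<oplus>\<^bsub>L\<^esub> w \<in> N" if "v \<in> N" "w \<in> N" for v w using N_add[OF that] by simp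
  fix a w assume a: "a \<in> carrier RH" and w: "w \<in> N"
  have wT: "w \<in> carrier L" using w N_closed by auto
  from a show "a \<odot>\<^bsub>L\<^esub> w \<in> N"
  proof (induction rule: group_ring_induct)
    case zero
    show ?case using L.smult_l_null[OF wT] \<open>\<zero>\<^bsub>L\<^esub> \<in> N\<close> by simp
  next
    case (add c p a)
    obtain x g where p: "p = (x, g)" "x \<in> carrier (Fn n)" "g \<in> carrier G"
      using add(1) by (cases p) (auto simp: semidirect_simps)
    have "gr_monom c p \<odot>\<^bsub>L\<^esub> w \<in> N"
      using L_monom[OF p(2,3)] wT N_S[OF N_Fa[OF p(2) N_Ga[OF p(3) w]]] p(1) by simp
    then show ?case
      using L.smult_l_distr[OF gr_monom_closed[OF add(1)] add(2) wT] add(3) N_add by simp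
  qed
qed

section \<open>Submodules of the Long--Moody module\<close>

definition esum :: "(nat \<Rightarrow> 'v) \<Rightarrow> (((nat gword \<Rightarrow> 'k) \<times> 'v) \<Rightarrow>\<^sub>0 int) set" where
  "esum v = finsum T (\<lambda>j. pure (e j) (v j)) {1..n}"

lemma esum_add:
  assumes "v \<in> {1..n} \<rightarrow> carrier V" "w \<in> {1..n} \<rightarrow> carrier V"
  shows "esum (\<lambda>j. v j \<oplus>\<^bsub>V\<^esub> w j) = esum v \<oplus>\<^bsub>T\<^esub> esum w"
proof -
  have c: "(\<lambda>j. pure (e j) (v j)) \<in> {1..n} \<rightarrow> carrier T" "(\<lambda>j. pure (e j) (w j)) \<in> {1..n} \<rightarrow> carrier T"
    using assms by (auto intro!: pure_closed e_in_I simp del: atLeastAtMost_iff)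
  have "esum (\<lambda>j. v j \<oplus>\<^bsub>V\<^esub> w j) = finsum T (\<lambda>j. pure (e j) (v j) \<oplus>\<^bsub>T\<^esub> pure (e j) (w j)) {1..n}"
    unfolding esum_def using assms c
    by (intro TP.T.finsum_cong') (auto simp: Pi_iff pure_add_r)
  then show ?thesis unfolding esum_def using TP.T.finsum_addf[OF c] by simp
qed

text \<open>Since \<open>e\<^sub>jr \<otimes> v = e\<^sub>j \<otimes> rv\<close> and the \<open>e\<^sub>j\<close> generate the augmentation ideal.\<close>

lemma T_spanned:
  assumes "w \<in> carrier T"
  shows "\<exists>v. v \<in> {1..n} \<rightarrow> carrier V \<and> w = esum v"
  using assms
proof (induction rule: TP.tensor_induct)
  case zero
  have "esum (\<lambda>_. \<zero>\<^bsub>V\<^esub>) = finsum T (\<lambda>j. \<zero>\<^bsub>T\<^esub>) {1..n}"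
    unfolding esum_def by (intro TP.T.finsum_cong') (auto simp: pure_zero)
  then show ?case by (intro exI[of _ "\<lambda>_. \<zero>\<^bsub>V\<^esub>"]) auto
next
  case (pure f v)
  then have v: "v \<in> carrier V" by simp
  from pure(1) show ?case
  proof (induction rule: I_induct)
    case zero
    have "pure \<zero> v = \<zero>\<^bsub>T\<^esub>"
      by (rule additive_map_zero[OF abelian_group_I abelian_T, of "\<lambda>f. pure f v", simplified])
         (auto simp: pure_add_l v)
    moreover have "esum (\<lambda>_. \<zero>\<^bsub>V\<^esub>) = finsum T (\<lambda>j. \<zero>\<^bsub>T\<^esub>) {1..n}"
      unfolding esum_def by (intro TP.T.finsum_cong') (auto simp: pure_zero)
    ultimately show ?case by (intro exI[of _ "\<lambda>_. \<zero>\<^bsub>V\<^esub>"]) auto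
  next
    case (e k r)
    let ?v = "\<lambda>j. if k = j then r \<odot>\<^bsub>Vr\<^esub> v else \<zero>\<^bsub>V\<^esub>"
    have rv: "r \<odot>\<^bsub>Vr\<^esub> v \<in> carrier V" using Vr.smult_closed[of r v] e v by simp
    have "esum ?v = finsum T (\<lambda>j. if k = j then pure (e k) (r \<odot>\<^bsub>Vr\<^esub> v) else \<zero>\<^bsub>T\<^esub>) {1..n}"
      unfolding esum_def using rv e
      by (intro TP.T.finsum_cong') (auto simp: pure_zero simp del: Vr_simps(4))
    also have "\<dots> = pure (e k) (r \<odot>\<^bsub>Vr\<^esub> v)" using e rv by (intro finsum_single) auto
    also have "\<dots> = pure (e k \<otimes> r) v" using e v by (simp add: pure_balanced)
    finally show ?case using rv by (intro exI[of _ ?v]) auto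
  next
    case (add f g)
    then obtain u w where "u \<in> {1..n} \<rightarrow> carrier V" "pure f v = esum u"
      "w \<in> {1..n} \<rightarrow> carrier V" "pure g v = esum w" by blast
    then show ?case
      using esum_add[of u w] add v
      by (intro exI[of _ "\<lambda>j. u j \<oplus>\<^bsub>V\<^esub> w j"]) (auto simp: pure_add_l Pi_iff)
  qed
next
  case (diff w w')
  then obtain u u' where u: "u \<in> {1..n} \<rightarrow> carrier V" "w = esum u"
    and u': "u' \<in> {1..n} \<rightarrow> carrier V" "w' = esum u'" by blast
  have m: "(\<lambda>j. \<ominus>\<^bsub>V\<^esub> u' j) \<in> {1..n} \<rightarrow> carrier V" using u' by (auto simp: Pi_iff)
  have "esum (\<lambda>j. \<ominus>\<^bsub>V\<^esub> u' j) \<oplus>\<^bsub>T\<^esub> w' = esum (\<lambda>j. \<ominus>\<^bsub>V\<^esub> u' j \<oplus>\<^bsub>V\<^esub> u' j)"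
    unfolding u'(2) by (rule esum_add[OF m u'(1), symmetric])
  also have "\<dots> = finsum T (\<lambda>j. \<zero>\<^bsub>T\<^esub>) {1..n}"
    unfolding esum_def using u'(1)
    by (intro TP.T.finsum_cong') (auto simp: pure_zero V.M.l_neg Pi_iff)
  finally have "esum (\<lambda>j. \<ominus>\<^bsub>V\<^esub> u' j) = \<ominus>\<^bsub>T\<^esub> w'"
    using diff(2) TP.T.minus_equality[of "esum (\<lambda>j. \<ominus>\<^bsub>V\<^esub> u' j)" w'] m
    by (simp add: esum_def Pi_iff)
  then show ?case
    using esum_add[OF u(1) m] u(2) m u(1)
    by (intro exI[of _ "\<lambda>j. u j \<oplus>\<^bsub>V\<^esub> \<ominus>\<^bsub>V\<^esub> u' j"]) (auto simp: a_minus_def Pi_iff)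
qed

definition phi :: "nat \<Rightarrow> (nat \<Rightarrow> 'v) \<Rightarrow> 'v" where
  "phi i v = finsum V (\<lambda>j. D i (e j) \<odot>\<^bsub>Vr\<^esub> v j) {1..n}"

text \<open>Every \<open>x\<^sub>i\<close> changes a vector only by an element of \<open>e\<^sub>i \<otimes> V\<close>.\<close>

lemma Fa_gen_esum:
  assumes i: "i \<in> {1..n}" and v: "v \<in> {1..n} \<rightarrow> carrier V"
  shows "phi i v \<in> carrier V" "Fa (gen i) (esum v) = esum v \<oplus>\<^bsub>T\<^esub> pure (e i) (phi i v)"
proof -
  have c: "(\<lambda>j. D i (e j) \<odot>\<^bsub>Vr\<^esub> v j) \<in> {1..n} \<rightarrow> carrier V"
    using v Vr.smult_closed by (auto simp: Pi_iff simp del: Vr_simps(4))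
  then show "phi i v \<in> carrier V" unfolding phi_def by (rule V.M.finsum_closed)
  have p: "(\<lambda>j. pure (e j) (v j)) \<in> {1..n} \<rightarrow> carrier T"
    using v by (auto simp: Pi_iff)
  have q: "(\<lambda>j. pure (e i) (D i (e j) \<odot>\<^bsub>Vr\<^esub> v j)) \<in> {1..n} \<rightarrow> carrier T"
    using c i by (auto simp: Pi_iff simp del: Vr_simps(4))
  have "Fa (gen i) (esum v) = finsum T (\<lambda>j. Fa (gen i) (pure (e j) (v j))) {1..n}"
    unfolding esum_def
    by (rule additive_map_finsum[OF abelian_T abelian_T _ _ _ p]) (use i in \<open>auto simp: Fa_add\<close>)
  also have "\<dots> = finsum T (\<lambda>j. pure (e j) (v j) \<oplus>\<^bsub>T\<^esub> pure (e i) (D i (e j) \<odot>\<^bsub>Vr\<^esub> v j)) {1..n}"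
    using i v p q by (intro TP.T.finsum_cong') (auto simp: Pi_iff Fa_gen_pure_e simp del: Vr_simps(4))
  also have "\<dots> = esum v \<oplus>\<^bsub>T\<^esub> finsum T (\<lambda>j. pure (e i) (D i (e j) \<odot>\<^bsub>Vr\<^esub> v j)) {1..n}"
    unfolding esum_def by (rule TP.T.finsum_addf[OF p q])
  also have "finsum T (\<lambda>j. pure (e i) (D i (e j) \<odot>\<^bsub>Vr\<^esub> v j)) {1..n} = pure (e i) (phi i v)"
    unfolding phi_def
    by (rule additive_map_finsum[OF V.M.abelian_group_axioms abelian_T _ _ _ c, symmetric])
       (use i in \<open>auto simp: pure_add_r\<close>)
  finally show "Fa (gen i) (esum v) = esum v \<oplus>\<^bsub>T\<^esub> pure (e i) (phi i v)" .
qed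

lemma Inv_if_gens:
  assumes w: "w \<in> carrier T" and gens: "\<And>i. i \<in> {1..n} \<Longrightarrow> Fa (gen i) w = w"
  shows "w \<in> Inv"
proof -
  have "Fa x w = w" if "x \<in> carrier (Fn n)" for x
    using that
  proof (induction rule: free_group_induct)
    case one
    then show ?case using Fa_one[OF w] by (simp add: free_group_simps(3))
  next
    case (gen i y)
    then show ?case using gens w by (simp add: Fa_mult)
  next
    case (inv i y)
    have g: "gen i \<in> carrier (Fn n)" using inv by simp
    have "Fa (inv\<^bsub>Fn n\<^esub> (gen i)) w = w"
      using Fa_inv_cancel(1)[OF g w] gens[OF inv(1)] by simp
    then show ?case using inv w g by (simp add: Fa_mult)
  qed
  with w show ?thesis by (simp add: Inv_def)
qed

end

context LM_setup
begin

lemma e_smult: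
  assumes "j \<in> {1..n}" "v \<in> carrier V"
  shows "e j \<odot>\<^bsub>Vr\<^esub> v = (mon (gen j) \<odot>\<^bsub>Vr\<^esub> v) \<oplus>\<^bsub>V\<^esub> \<ominus>\<^bsub>V\<^esub> v"
proof -
  have v: "v \<in> carrier Vr" using assms by simp
  have m: "mon (gen j) \<in> carrier R" using assms by simp
  have "\<ominus>\<^bsub>Vr\<^esub> v = \<ominus>\<^bsub>V\<^esub> v"
    using Vr.M.minus_equality[of "\<ominus>\<^bsub>V\<^esub> v" v] assms by (simp add: V.M.l_neg)
  then show ?thesis
    using Vr.smult_l_distr[OF m a_inv_closed[OF one_closed] v]
      Vr.smult_l_minus[OF one_closed v] Vr.smult_one[OF v]
    unfolding e_eq a_minus_def Vr_simps(3) by (simp only:)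
qed

lemma Vr_closed: "r \<in> carrier R \<Longrightarrow> v \<in> carrier V \<Longrightarrow> r \<odot>\<^bsub>Vr\<^esub> v \<in> carrier V"
  using Vr.smult_closed[of r v] by (simp del: Vr_simps(4))

lemma Vr_assoc: "r \<in> carrier R \<Longrightarrow> r' \<in> carrier R \<Longrightarrow> v \<in> carrier V \<Longrightarrow>
    (r \<otimes> r') \<odot>\<^bsub>Vr\<^esub> v = r \<odot>\<^bsub>Vr\<^esub> (r' \<odot>\<^bsub>Vr\<^esub> v)"
  using Vr.smult_assoc[of r r' v] by (simp del: Vr_simps(4))

lemma Vr_add: "r \<in> carrier R \<Longrightarrow> r' \<in> carrier R \<Longrightarrow> v \<in> carrier V \<Longrightarrow>
    (r \<oplus> r') \<odot>\<^bsub>Vr\<^esub> v = (r \<odot>\<^bsub>Vr\<^esub> v) \<oplus>\<^bsub>V\<^esub> (r' \<odot>\<^bsub>Vr\<^esub> v)"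
  using Vr.smult_l_distr[of r r' v] by (simp del: Vr_simps(4))

lemma Vr_one: "v \<in> carrier V \<Longrightarrow> \<one> \<odot>\<^bsub>Vr\<^esub> v = v"
  using Vr.smult_one[of v] by (simp del: Vr_simps(4))

lemma Vr_zero: "r \<in> carrier R \<Longrightarrow> r \<odot>\<^bsub>Vr\<^esub> \<zero>\<^bsub>V\<^esub> = \<zero>\<^bsub>V\<^esub>"
  using Vr.smult_r_null[of r] by (simp del: Vr_simps(4))

declare Vr_simps(4) [simp del]

lemma C_inv: "c \<noteq> 0 \<Longrightarrow> v \<in> carrier V \<Longrightarrow> C (1 / c) \<odot>\<^bsub>Vr\<^esub> (C c \<odot>\<^bsub>Vr\<^esub> v) = v"
  by (simp add: Vr_assoc[symmetric] C_mult[symmetric] C_one Vr_one)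

lemma pure_C: "f \<in> I \<Longrightarrow> v \<in> carrier V \<Longrightarrow> pure f (C c \<odot>\<^bsub>Vr\<^esub> v) = S c (pure f v)"
  by (simp add: pure_balanced[symmetric] S_pure C_commute)

text \<open>If \<open>x\<^sub>i\<close> fixes \<open>v\<close>, then \<open>D\<^sub>j(e\<^sub>i)\<close> kills \<open>v\<close> for \<open>j \<noteq> i\<close>, while \<open>1 + D\<^sub>i(e\<^sub>i) = \<lambda>x\<^sub>i\<close> multiplies it by \<open>\<lambda>\<close>.\<close>

lemma pure_e_in_eig:
  assumes i: "i \<in> {1..n}" and v: "v \<in> carrier V" and ev: "e i \<odot>\<^bsub>Vr\<^esub> v = \<zero>\<^bsub>V\<^esub>"
  shows "pure (e i) v \<in> eig i"
proof -
  have "Fa (gen j) (pure (e i) v) = S (mu i j) (pure (e i) v)" if j: "j \<in> {1..n}" for j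
  proof -
    have D0: "D j (e i) \<odot>\<^bsub>Vr\<^esub> v = \<zero>\<^bsub>V\<^esub>" if "j \<noteq> i"
    proof (cases "j < i")
      case True
      then show ?thesis using D_e(3)[OF i] ev by simp
    next
      case False
      then show ?thesis using that D_e(1)[OF i, of j] ev v i by (simp add: Vr_assoc Vr_zero)
    qed
    show ?thesis
    proof (cases "j = i")
      case False
      then show ?thesis
        using Fa_gen_pure_e[OF j i v] D0 i j v by (simp add: mu_def S_one pure_zero)
    next
      case True
      have m: "mon (gen i) \<in> carrier R" using i by simp
      have xv: "mon (gen i) \<odot>\<^bsub>Vr\<^esub> v = v"
      proof -
        have "mon (gen i) \<odot>\<^bsub>Vr\<^esub> v = (e i \<oplus> \<one>) \<odot>\<^bsub>Vr\<^esub> v"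
          using m by (simp add: e_eq ring_norm)
        then show ?thesis using i v ev by (simp add: Vr_add Vr_one)
      qed
      have "pure (e i) v \<oplus>\<^bsub>T\<^esub> pure (e i) (D i (e i) \<odot>\<^bsub>Vr\<^esub> v) =
          pure (e i) ((\<one> \<oplus> D i (e i)) \<odot>\<^bsub>Vr\<^esub> v)"
        using i v by (simp add: Vr_add Vr_one pure_add_r Vr_closed)
      also have "\<one> \<oplus> D i (e i) = C lam \<otimes> mon (gen i)"
        using m by (simp add: D_e(2)[OF i] ring_norm)
      also have "pure (e i) ((C lam \<otimes> mon (gen i)) \<odot>\<^bsub>Vr\<^esub> v) = S lam (pure (e i) v)"
        using i v m by (simp add: Vr_assoc xv pure_C)
      finally show ?thesis
        using Fa_gen_pure_e[OF i i v] True by (simp add: mu_def)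
    qed
  qed
  then show ?thesis using i v by (simp add: eig_def)
qed

text \<open>A subspace \<open>W\<close> that is stable under the free group is studied through the subspaces
  \<open>layer i = {v. e\<^sub>i \<otimes> v \<in> W}\<close> of \<open>V\<close> and their intersection \<open>core\<close>.\<close>

context
  fixes W assumes WT: "W \<subseteq> carrier T" and W_zero: "\<zero>\<^bsub>T\<^esub> \<in> W"
    and W_add: "\<And>v w. v \<in> W \<Longrightarrow> w \<in> W \<Longrightarrow> v \<oplus>\<^bsub>T\<^esub> w \<in> W"
    and W_S: "\<And>c w. w \<in> W \<Longrightarrow> S c w \<in> W"
    and W_Fa: "\<And>x w. x \<in> carrier (Fn n) \<Longrightarrow> w \<in> W \<Longrightarrow> Fa x w \<in> W"
begin

definition layer :: "nat \<Rightarrow> 'v set" where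
  "layer i = {v \<in> carrier V. pure (e i) v \<in> W}"

lemma W_cancel:
  assumes "u \<in> carrier T" "w \<in> W" "w \<oplus>\<^bsub>T\<^esub> u \<in> W" shows "u \<in> W"
proof -
  have wT: "w \<in> carrier T" using assms(2) WT by blast
  have "S (- 1) w \<oplus>\<^bsub>T\<^esub> (w \<oplus>\<^bsub>T\<^esub> u) = u"
    using assms(1) wT by (simp add: S_uminus TP.T.r_neg1)
  then show ?thesis using W_add[OF W_S[OF assms(2), of "- 1"] assms(3)] by simp
qed

lemma layer_closed: "v \<in> layer i \<Longrightarrow> v \<in> carrier V"
  by (simp add: layer_def)

lemma layer_add: "i \<in> {1..n} \<Longrightarrow> v \<in> layer i \<Longrightarrow> w \<in> layer i \<Longrightarrow> v \<oplus>\<^bsub>V\<^esub> w \<in> layer i"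
  by (simp add: layer_def pure_add_r W_add)

lemma layer_zero: "i \<in> {1..n} \<Longrightarrow> \<zero>\<^bsub>V\<^esub> \<in> layer i"
  by (simp add: layer_def pure_zero W_zero)

lemma layer_C: "i \<in> {1..n} \<Longrightarrow> v \<in> layer i \<Longrightarrow> C c \<odot>\<^bsub>Vr\<^esub> v \<in> layer i"
  by (simp add: layer_def pure_C W_S Vr_closed)

lemma layer_uminus:
  assumes "i \<in> {1..n}" "v \<in> layer i" shows "\<ominus>\<^bsub>V\<^esub> v \<in> layer i"
proof -
  have v: "v \<in> carrier V" using assms(2) by (rule layer_closed)
  have "C (- 1) \<odot>\<^bsub>Vr\<^esub> v \<oplus>\<^bsub>V\<^esub> v = C (- 1 + 1) \<odot>\<^bsub>Vr\<^esub> v"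
    unfolding C_add using v by (simp add: Vr_add C_one Vr_one)
  also have "\<dots> = \<zero>\<^bsub>V\<^esub>" using Vr.smult_l_null[of v] v by (simp add: C_zero)
  finally have "\<ominus>\<^bsub>V\<^esub> v = C (- 1) \<odot>\<^bsub>Vr\<^esub> v"
    using v by (intro V.M.minus_equality) (simp_all add: Vr_closed)
  then show ?thesis using layer_C[OF assms, of "- 1"] by simp
qed

lemma layer_D:
  assumes i: "i \<in> {1..n}" and j: "j \<in> {1..n}" and v: "v \<in> layer j"
  shows "D i (e j) \<odot>\<^bsub>Vr\<^esub> v \<in> layer i"
proof -
  have vV: "v \<in> carrier V" and vW: "pure (e j) v \<in> W" using v by (simp_all add: layer_def)
  have c: "D i (e j) \<odot>\<^bsub>Vr\<^esub> v \<in> carrier V" using vV j by (simp add: Vr_closed)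
  have "pure (e j) v \<oplus>\<^bsub>T\<^esub> pure (e i) (D i (e j) \<odot>\<^bsub>Vr\<^esub> v) \<in> W"
    using W_Fa[OF gen_closed[OF i] vW] Fa_gen_pure_e[OF i j vV] by simp
  then have "pure (e i) (D i (e j) \<odot>\<^bsub>Vr\<^esub> v) \<in> W"
    using W_cancel[OF _ vW] c i by simp
  with c show ?thesis by (simp add: layer_def)
qed

lemma layer_C_cancel:
  assumes "i \<in> {1..n}" "v \<in> carrier V" "c \<noteq> 0" "C c \<odot>\<^bsub>Vr\<^esub> v \<in> layer i"
  shows "v \<in> layer i"
  using layer_C[OF assms(1,4), of "1 / c"] C_inv[OF assms(3,2)] by simp

lemma layer_gen:
  assumes j: "j \<in> {1..n}" and v: "v \<in> layer j"
  shows "mon (gen j) \<odot>\<^bsub>Vr\<^esub> v \<in> layer j"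
proof -
  have vV: "v \<in> carrier V" using v by (rule layer_closed)
  have m: "mon (gen j) \<in> carrier R" using j by simp
  have "D j (e j) \<odot>\<^bsub>Vr\<^esub> v \<oplus>\<^bsub>V\<^esub> v = (D j (e j) \<oplus> \<one>) \<odot>\<^bsub>Vr\<^esub> v"
    using vV j by (simp add: Vr_add Vr_one)
  also have "D j (e j) \<oplus> \<one> = C lam \<otimes> mon (gen j)"
    using m by (simp add: D_e(2)[OF j] ring_norm)
  also have "\<dots> \<odot>\<^bsub>Vr\<^esub> v = C lam \<odot>\<^bsub>Vr\<^esub> (mon (gen j) \<odot>\<^bsub>Vr\<^esub> v)"
    using m vV by (simp add: Vr_assoc)
  finally have "C lam \<odot>\<^bsub>Vr\<^esub> (mon (gen j) \<odot>\<^bsub>Vr\<^esub> v) \<in> layer j"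
    using layer_add[OF j layer_D[OF j j v] v] by simp
  then show ?thesis using layer_C_cancel[OF j _ lam_nz] m vV by (simp add: Vr_closed)
qed

text \<open>The vector \<open>e\<^sub>j \<otimes> v\<close> is the image under \<open>x\<^sub>j\<close> of \<open>e\<^sub>j \<otimes> \<lambda>\<inverse>x\<^sub>j\<inverse>v\<close>.\<close>

lemma layer_inv:
  assumes j: "j \<in> {1..n}" and v: "v \<in> layer j"
  shows "mon (inv\<^bsub>Fn n\<^esub> (gen j)) \<odot>\<^bsub>Vr\<^esub> v \<in> layer j"
proof -
  have vV: "v \<in> carrier V" and vW: "pure (e j) v \<in> W" using v by (simp_all add: layer_def)
  note g = gen_closed[OF j]
  have m: "mon (gen j) \<in> carrier R" "mon (inv\<^bsub>Fn n\<^esub> (gen j)) \<in> carrier R"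
    using mon_closed[OF g] mon_closed[OF F.inv_closed[OF g]] .
  define u where "u = C (1 / lam) \<odot>\<^bsub>Vr\<^esub> (mon (inv\<^bsub>Fn n\<^esub> (gen j)) \<odot>\<^bsub>Vr\<^esub> v)"
  have y: "mon (inv\<^bsub>Fn n\<^esub> (gen j)) \<odot>\<^bsub>Vr\<^esub> v \<in> carrier V" using m vV by (simp add: Vr_closed)
  then have uV: "u \<in> carrier V" by (simp add: u_def Vr_closed)
  have "u \<oplus>\<^bsub>V\<^esub> (D j (e j) \<odot>\<^bsub>Vr\<^esub> u) = (\<one> \<oplus> D j (e j)) \<odot>\<^bsub>Vr\<^esub> u"
    using uV j by (simp add: Vr_add Vr_one)
  also have "\<one> \<oplus> D j (e j) = mon (gen j) \<otimes> C lam"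
    using m by (simp add: D_e(2)[OF j] C_commute) (simp add: ring_norm)
  also have "\<dots> \<odot>\<^bsub>Vr\<^esub> u = mon (gen j) \<odot>\<^bsub>Vr\<^esub> (mon (inv\<^bsub>Fn n\<^esub> (gen j)) \<odot>\<^bsub>Vr\<^esub> v)"
    using C_inv[of "1 / lam", OF _ y] lam_nz m uV by (simp add: Vr_assoc u_def)
  also have "\<dots> = v"
    using m vV mon_inv_mult(1)[OF g] by (simp add: Vr_assoc[symmetric] Vr_one)
  finally have "Fa (gen j) (pure (e j) u) = pure (e j) v"
    using Fa_gen_pure_e[OF j j uV] j uV
    by (simp add: pure_add_r[symmetric] Vr_closed)
  then have "pure (e j) u = Fa (inv\<^bsub>Fn n\<^esub> (gen j)) (pure (e j) v)"
    using Fa_inv_cancel(1)[OF g, of "pure (e j) u"] j uV by simp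
  then have "u \<in> layer j"
    using W_Fa[OF F.inv_closed[OF g] vW] uV by (simp add: layer_def)
  then show ?thesis
    unfolding u_def using layer_C_cancel[OF j y, of "1 / lam"] lam_nz by simp
qed

text \<open>Up to the unit \<open>\<lambda>\<close>, \<open>D\<^sub>i(e\<^sub>j)\<close> is \<open>e\<^sub>j\<close> when \<open>i \<noteq> j\<close>; when \<open>i = j\<close>, both \<open>x\<^sub>jv\<close> and \<open>v\<close> lie in the layer.\<close>

lemma layer_e:
  assumes i: "i \<in> {1..n}" and j: "j \<in> {1..n}" and v: "v \<in> layer j"
  shows "e j \<odot>\<^bsub>Vr\<^esub> v \<in> layer i"
proof -
  have vV: "v \<in> carrier V" using v by (rule layer_closed)
  have eV: "e j \<odot>\<^bsub>Vr\<^esub> v \<in> carrier V" using j vV by (simp add: Vr_closed)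
  consider "j < i" | "j = i" | "i < j" by linarith
  then show ?thesis
  proof cases
    case 1
    have "C lam \<odot>\<^bsub>Vr\<^esub> (e j \<odot>\<^bsub>Vr\<^esub> v) \<in> layer i"
      using layer_D[OF i j v] D_e(1)[OF j 1] j vV by (simp add: Vr_assoc)
    then show ?thesis by (rule layer_C_cancel[OF i eV lam_nz])
  next
    case 2
    then show ?thesis
      using e_smult[OF j vV] layer_add[OF j layer_gen[OF j v] layer_uminus[OF j v]] by simp
  next
    case 3
    then show ?thesis using layer_D[OF i j v] D_e(3)[OF j 3] by simp
  qed
qed

definition core :: "'v set" where
  "core = {v \<in> carrier V. \<forall>i\<in>{1..n}. v \<in> layer i}"

text \<open>On the intersection of the layers \<open>x\<^sub>j v = e\<^sub>j v + v\<close>, where \<open>e\<^sub>j v\<close> lies in every layer because \<open>v\<close> lies in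
  the \<open>j\<close>-th one. For \<open>x\<^sub>j\<inverse>\<close> the same argument applies to \<open>x\<^sub>j\<inverse>v\<close>, which lies in the \<open>j\<close>-th layer.\<close>

lemma core_submodule: "submodule core R Vr"
proof (rule Vr.submoduleI)
  show "core \<subseteq> carrier Vr" by (auto simp: core_def)
  show zero: "\<zero>\<^bsub>Vr\<^esub> \<in> core" by (simp add: core_def layer_zero)
  show add: "v \<oplus>\<^bsub>Vr\<^esub> w \<in> core" if "v \<in> core" "w \<in> core" for v w
    using that by (simp add: core_def layer_add)
  have gen: "mon (gen j) \<odot>\<^bsub>Vr\<^esub> v \<in> core" and inv: "mon (inv\<^bsub>Fn n\<^esub> (gen j)) \<odot>\<^bsub>Vr\<^esub> v \<in> core"
    if j: "j \<in> {1..n}" and v: "v \<in> core" for j v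
  proof -
    have vV: "v \<in> carrier V" and vl: "\<And>i. i \<in> {1..n} \<Longrightarrow> v \<in> layer i"
      using v by (simp_all add: core_def)
    note g = gen_closed[OF j]
    have m: "mon (gen j) \<in> carrier R" "mon (inv\<^bsub>Fn n\<^esub> (gen j)) \<in> carrier R"
      using mon_closed[OF g] mon_closed[OF F.inv_closed[OF g]] .
    have "mon (gen j) \<odot>\<^bsub>Vr\<^esub> v \<in> layer i" if i: "i \<in> {1..n}" for i
    proof -
      have "mon (gen j) \<odot>\<^bsub>Vr\<^esub> v = (e j \<odot>\<^bsub>Vr\<^esub> v) \<oplus>\<^bsub>V\<^esub> v"
        using m vV by (simp add: e_smult[OF j vV] V.M.a_assoc V.M.l_neg Vr_closed)
      then show ?thesis using layer_add[OF i layer_e[OF i j vl[OF j]] vl[OF i]] by simp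
    qed
    then show "mon (gen j) \<odot>\<^bsub>Vr\<^esub> v \<in> core" using m vV by (simp add: core_def Vr_closed)
    let ?y = "mon (inv\<^bsub>Fn n\<^esub> (gen j)) \<odot>\<^bsub>Vr\<^esub> v"
    have y: "?y \<in> carrier V" "?y \<in> layer j" using layer_inv[OF j vl[OF j]] layer_closed by blast+
    have "?y \<in> layer i" if i: "i \<in> {1..n}" for i
    proof -
      have "mon (gen j) \<odot>\<^bsub>Vr\<^esub> ?y = v"
        using m vV mon_inv_mult(1)[OF g] by (simp add: Vr_assoc[symmetric] Vr_one)
      then have "e j \<odot>\<^bsub>Vr\<^esub> ?y = v \<oplus>\<^bsub>V\<^esub> \<ominus>\<^bsub>V\<^esub> ?y"
        by (simp add: e_smult[OF j y(1)])
      then have "?y = v \<oplus>\<^bsub>V\<^esub> \<ominus>\<^bsub>V\<^esub> (e j \<odot>\<^bsub>Vr\<^esub> ?y)"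
        using y(1) vV by (simp add: V.M.minus_add V.M.a_assoc[symmetric] V.M.r_neg)
      moreover have "v \<oplus>\<^bsub>V\<^esub> \<ominus>\<^bsub>V\<^esub> (e j \<odot>\<^bsub>Vr\<^esub> ?y) \<in> layer i"
        using layer_add[OF i vl[OF i] layer_uminus[OF i layer_e[OF i j y(2)]]] .
      ultimately show ?thesis by simp
    qed
    then show "?y \<in> core" using y by (simp add: core_def)
  qed
  have word: "mon w \<odot>\<^bsub>Vr\<^esub> v \<in> core" if "w \<in> carrier (Fn n)" "v \<in> core" for w v
    using that(1)
  proof (induction rule: free_group_induct)
    case one
    then show ?case using that(2) by (simp add: mon_one core_def Vr_one)
  next
    case (gen i w)
    have "v \<in> carrier V" using that(2) by (simp add: core_def)
    then show ?case
      using gen \<open>\<And>v j. j \<in> {1..n} \<Longrightarrow> v \<in> core \<Longrightarrow> mon (gen j) \<odot>\<^bsub>Vr\<^esub> v \<in> core\<close>[of i "mon w \<odot>\<^bsub>Vr\<^esub> v"]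
      by (simp add: mon_mult[symmetric] Vr_assoc)
  next
    case (inv i w)
    have "v \<in> carrier V" using that(2) by (simp add: core_def)
    moreover have "mon (inv\<^bsub>Fn n\<^esub> (gen i)) \<in> carrier R"
      using inv(1) by (intro mon_closed F.inv_closed gen_closed)
    ultimately show ?case
      using inv \<open>\<And>v j. j \<in> {1..n} \<Longrightarrow> v \<in> core \<Longrightarrow> mon (inv\<^bsub>Fn n\<^esub> (gen j)) \<odot>\<^bsub>Vr\<^esub> v \<in> core\<close>[of i "mon w \<odot>\<^bsub>Vr\<^esub> v"]
      by (simp add: mon_mult[symmetric] Vr_assoc)
  qed
  fix a v assume a: "a \<in> carrier R" and v: "v \<in> core"
  have vV: "v \<in> carrier V" using v by (simp add: core_def)
  from a show "a \<odot>\<^bsub>Vr\<^esub> v \<in> core"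
  proof (induction rule: R_induct)
    case zero
    have "\<zero> \<odot>\<^bsub>Vr\<^esub> v = \<zero>\<^bsub>Vr\<^esub>" using Vr.smult_l_null[of v] vV by simp
    then show ?case using \<open>\<zero>\<^bsub>Vr\<^esub> \<in> core\<close> by simp
  next
    case (add c w a)
    have "C c \<odot>\<^bsub>Vr\<^esub> (mon w \<odot>\<^bsub>Vr\<^esub> v) \<in> core"
      using word[OF add(1) v] by (simp add: core_def layer_C Vr_closed)
    then have "(C c \<otimes> mon w) \<odot>\<^bsub>Vr\<^esub> v \<in> core" using add vV by (simp add: Vr_assoc)
    then show ?case
      using add vV \<open>\<And>v w. v \<in> core \<Longrightarrow> w \<in> core \<Longrightarrow> v \<oplus>\<^bsub>Vr\<^esub> w \<in> core\<close>[of "(C c \<otimes> mon w) \<odot>\<^bsub>Vr\<^esub> v" "a \<odot>\<^bsub>Vr\<^esub> v"]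
      by (simp add: Vr_add)
  qed
qed

lemma W_full_if_core_full:
  assumes "core = carrier V"
  shows "W = carrier T"
proof
  show "carrier T \<subseteq> W"
  proof
    fix w assume "w \<in> carrier T"
    then obtain v where v: "v \<in> {1..n} \<rightarrow> carrier V" "w = esum v" using T_spanned by blast
    have "pure (e j) (v j) \<in> W" if j: "j \<in> {1..n}" for j
    proof -
      have "v j \<in> core" using assms v(1) j by blast
      then show ?thesis using j by (simp add: core_def layer_def)
    qed
    then show "w \<in> W"
      unfolding v(2) esum_def by (intro finsum_mem WT W_zero W_add) auto
  qed
qed (rule WT)

text \<open>As \<open>e\<^sub>j\<close> maps the \<open>j\<close>-th layer into the intersection of the layers, it now kills that layer. For
  \<open>w\<close> in \<open>W\<close> and \<open>x\<^sub>iw = w + e\<^sub>i \<otimes> p\<^sub>i\<close>, the vector \<open>p\<^sub>i\<close> lies in the \<open>i\<close>-th layer, so \<open>e\<^sub>i \<otimes> p\<^sub>i\<close> lies in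
  the \<open>i\<close>-th eigenspace. If \<open>\<lambda> \<noteq> 1\<close>, subtracting the \<open>(\<lambda> - 1)\<inverse>e\<^sub>i \<otimes> p\<^sub>i\<close> from \<open>w\<close> leaves an invariant vector. If
  \<open>\<lambda> = 1\<close>, then \<open>p\<^sub>i\<close> does not depend on \<open>i\<close>, so it lies in all layers and vanishes.\<close>

lemma W_subset_N_if_core_zero:
  assumes core: "core = {\<zero>\<^bsub>V\<^esub>}"
  shows "W \<subseteq> N"
proof
  have e0: "e j \<odot>\<^bsub>Vr\<^esub> v = \<zero>\<^bsub>V\<^esub>" if "j \<in> {1..n}" "v \<in> layer j" for j v
  proof -
    have "e j \<odot>\<^bsub>Vr\<^esub> v \<in> core"
      using that layer_e[OF _ that] layer_closed[OF that(2)] by (simp add: core_def Vr_closed)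
    then show ?thesis using core by simp
  qed
  fix w assume w: "w \<in> W"
  then have wT: "w \<in> carrier T" using WT by blast
  obtain v where v: "v \<in> {1..n} \<rightarrow> carrier V" "w = esum v" using T_spanned[OF wT] by blast
  define p where "p i = phi i v" for i
  have pV: "p i \<in> carrier V" and Fw: "Fa (gen i) w = w \<oplus>\<^bsub>T\<^esub> pure (e i) (p i)" if "i \<in> {1..n}" for i
    using Fa_gen_esum[OF that v(1)] by (simp_all add: p_def v(2))
  have pl: "p i \<in> layer i" if i: "i \<in> {1..n}" for i
    using W_cancel[OF _ w, of "pure (e i) (p i)"] W_Fa[OF gen_closed[OF i] w] Fw[OF i] pV[OF i] i
    by (simp add: layer_def)
  show "w \<in> N"
  proof (cases "lam = 1")
    case True
    have "C (lam - 1) = \<zero>" using True by (simp add: C_zero)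
    then have "D i f = f" if "f \<in> carrier R" for i f
      using that by (simp add: D_def)
    then have p_eq: "p i = p j" for i j
      unfolding p_def phi_def using v(1)
      by (intro V.M.finsum_cong') (auto simp: Vr_closed Pi_iff)
    have "p i = \<zero>\<^bsub>V\<^esub>" if i: "i \<in> {1..n}" for i
    proof -
      have "p i \<in> layer k" if k: "k \<in> {1..n}" for k
        using pl[OF k] by (simp only: p_eq[of i k])
      then have "p i \<in> core" using pV[OF i] by (simp add: core_def)
      then show ?thesis using core by simp
    qed
    then have "Fa (gen i) w = w" if "i \<in> {1..n}" for i
      using Fw[OF that] that wT by (simp add: pure_zero)
    then have "w \<in> Inv" by (rule Inv_if_gens[OF wT])
    then show ?thesis using Inv_subset_N by blast
  next
    case False
    \<comment> \<open>On the \<open>i\<close>-th eigenspace \<open>x\<^sub>i - 1\<close> is multiplication by \<open>\<lambda> - 1\<close>.\<close>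
    define z where "z i = S (1 / (lam - 1)) (pure (e i) (p i))" for i
    have z_eig: "z i \<in> eig i" if i: "i \<in> {1..n}" for i
      unfolding z_def using S_eig[OF pure_e_in_eig[OF i pV[OF i] e0[OF i pl[OF i]]]] .
    then have zT: "z i \<in> carrier T" if "i \<in> {1..n}" for i using eig_closed that by blast
    then have zf: "z \<in> {1..n} \<rightarrow> carrier T" by blast
    define y where "y = finsum T z {1..n}"
    have yT: "y \<in> carrier T" unfolding y_def using zf by (rule TP.T.finsum_closed)
    define u where "u = w \<oplus>\<^bsub>T\<^esub> \<ominus>\<^bsub>T\<^esub> y"
    have uT: "u \<in> carrier T" using wT yT by (simp add: u_def)
    have Fy: "Fa (gen i) y = y \<oplus>\<^bsub>T\<^esub> pure (e i) (p i)" if i: "i \<in> {1..n}" for i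
    proof -
      let ?q = "pure (e i) (p i)"
      have q: "?q \<in> carrier T" using i pV[OF i] by simp
      have Sz: "S lam (z i) = z i \<oplus>\<^bsub>T\<^esub> ?q"
      proof -
        have "S lam (z i) = S (1 + (lam - 1)) (z i)" by simp
        also have "\<dots> = z i \<oplus>\<^bsub>T\<^esub> S (lam - 1) (z i)"
          using zT[OF i] unfolding S_add_scalar[OF zT[OF i]] by (simp add: S_one)
        also have "S (lam - 1) (z i) = ?q"
          using False q by (simp add: z_def S_mult[symmetric] S_one)
        finally show ?thesis .
      qed
      have "Fa (gen i) y = finsum T (\<lambda>j. Fa (gen i) (z j)) {1..n}"
        unfolding y_def
        by (rule additive_map_finsum[where f = "Fa (gen i)" and g = z, OF abelian_T abelian_T _ _ _ zf])
           (use i in \<open>auto simp: Fa_add\<close>)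
      also have "\<dots> = finsum T (\<lambda>j. z j \<oplus>\<^bsub>T\<^esub> (if i = j then ?q else \<zero>\<^bsub>T\<^esub>)) {1..n}"
      proof (rule TP.T.finsum_cong')
        show "(\<lambda>j. z j \<oplus>\<^bsub>T\<^esub> (if i = j then ?q else \<zero>\<^bsub>T\<^esub>)) \<in> {1..n} \<rightarrow> carrier T"
          using zT q by auto
        fix j assume j: "j \<in> {1..n}"
        have "Fa (gen i) (z j) = S (mu j i) (z j)" using z_eig[OF j] i by (simp add: eig_def)
        then show "Fa (gen i) (z j) = z j \<oplus>\<^bsub>T\<^esub> (if i = j then ?q else \<zero>\<^bsub>T\<^esub>)"
          using Sz zT[OF j] by (cases "i = j") (simp_all add: mu_def S_one)
      qed simp
      also have "\<dots> = y \<oplus>\<^bsub>T\<^esub> finsum T (\<lambda>j. if i = j then ?q else \<zero>\<^bsub>T\<^esub>) {1..n}"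
        unfolding y_def using q by (intro TP.T.finsum_addf zf) auto
      finally show ?thesis using finsum_single[OF i q] by simp
    qed
    have "Fa (gen i) u = u" if i: "i \<in> {1..n}" for i
    proof -
      note g = gen_closed[OF i]
      have q: "pure (e i) (p i) \<in> carrier T" using i pV[OF i] by simp
      have "Fa (gen i) (\<ominus>\<^bsub>T\<^esub> y) = \<ominus>\<^bsub>T\<^esub> (Fa (gen i) y)"
        by (rule additive_map_minus[where f = "Fa (gen i)", OF abelian_T abelian_T _ _ yT])
           (use g in \<open>auto simp: Fa_add\<close>)
      then have "Fa (gen i) u = (w \<oplus>\<^bsub>T\<^esub> pure (e i) (p i)) \<oplus>\<^bsub>T\<^esub> \<ominus>\<^bsub>T\<^esub> (y \<oplus>\<^bsub>T\<^esub> pure (e i) (p i))"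
        using wT yT g Fw[OF i] Fy[OF i] by (simp add: u_def Fa_add)
      also have "\<dots> = u"
        using wT yT q by (simp add: u_def TP.T.minus_add TP.T.a_ac TP.T.cancel_deep TP.T.r_neg)
      finally show ?thesis .
    qed
    then have "u \<in> Inv" by (rule Inv_if_gens[OF uT])
    moreover have "w = y \<oplus>\<^bsub>T\<^esub> u"
      using wT yT by (simp add: u_def TP.T.cancel_deep)
    ultimately show ?thesis unfolding N_def y_def using z_eig by blast
  qed
qed

end

lemma restrict_Fn_simps:
  "carrier (restrict_Fn G M) = carrier M" "\<zero>\<^bsub>restrict_Fn G M\<^esub> = \<zero>\<^bsub>M\<^esub>"
  "v \<oplus>\<^bsub>restrict_Fn G M\<^esub> w = v \<oplus>\<^bsub>M\<^esub> w" "r \<odot>\<^bsub>restrict_Fn G M\<^esub> v = gr_map \<iota> r \<odot>\<^bsub>M\<^esub> v"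
  by (simp_all add: restrict_Fn_def)

text \<open>The preimage in the Long--Moody module of a submodule of the quotient is a stable subspace. As
  \<open>V\<close> is irreducible, its core is \<open>V\<close> or zero, so that \<open>W_full_if_core_full\<close> or
  \<open>W_subset_N_if_core_zero\<close> applies.\<close>

lemma quotient_irreducible:
  assumes irr: "\<And>U. submodule U R Vr \<Longrightarrow> U = {\<zero>\<^bsub>V\<^esub>} \<or> U = carrier V"
    and W: "submodule W R (restrict_Fn G (quotient_module L N))"
  shows "W = {N} \<or> W = a_rcosets\<^bsub>L\<^esub> N"
proof -
  let ?Q = "quotient_module L N" and ?k = "\<lambda>w. N +>\<^bsub>L\<^esub> w"
  interpret Q: left_module RH ?Q by (rule L.left_module_quotient[OF N_submodule])
  have rQ: "left_module R (restrict_Fn G ?Q)"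
    unfolding restrict_Fn_def
    by (rule left_module_restrict_scalars[OF Q.left_module_axioms ring_axioms \<iota>_ring_hom])
  note Wp = left_module.submodule_props[OF rQ W]
  have zero: "?k \<zero>\<^bsub>T\<^esub> = N"
    using L.submodule_props(1)[OF N_submodule] by (force simp: a_r_coset_def r_coset_def)
  have kN: "?k w = N" if "w \<in> N" for w
    using L.quotient_coset_eq(2)[OF N_submodule, of "\<zero>\<^bsub>T\<^esub>" w] zero that by simp
  have W_sub: "W \<subseteq> ?k ` carrier T"
    using Wp(1) by (simp add: restrict_Fn_simps L.quotient_carrier)
  have smult: "gr_map \<iota> (gr_monom c x) \<odot>\<^bsub>?Q\<^esub> ?k w = ?k (S c (Fa x w))"
    if "x \<in> carrier (Fn n)" "w \<in> carrier T" for c x w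
    using that L.quotient_smult[OF N_submodule gr_monom_closed[of "(x, \<one>\<^bsub>G\<^esub>)" H c], of w]
    by (simp add: gr_map_monom semidirect_simps L_monom Ga_one)
  have W_smult: "?k (S c (Fa x w)) \<in> W" if "x \<in> carrier (Fn n)" "w \<in> carrier T" "?k w \<in> W" for c x w
  proof -
    have "gr_monom c x \<in> carrier R" unfolding R_def by (rule gr_monom_closed[OF that(1)])
    from Wp(4)[OF this that(3)] show ?thesis
      using smult[OF that(1,2), of c] by (simp add: restrict_Fn_simps)
  qed
  define W' where "W' = {w \<in> carrier T. ?k w \<in> W}"
  have W'T: "W' \<subseteq> carrier T" by (auto simp: W'_def)
  have "N \<in> W" using Wp(2) by (simp add: restrict_Fn_simps)
  then have W'_zero: "\<zero>\<^bsub>T\<^esub> \<in> W'"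
    by (simp add: W'_def zero)
  have W'_add: "v \<oplus>\<^bsub>T\<^esub> w \<in> W'" if "v \<in> W'" "w \<in> W'" for v w
    using that Wp(3)[of "?k v" "?k w"] L.quotient_add[OF N_submodule, of v w]
    by (simp add: W'_def restrict_Fn_simps)
  have W'_S: "S c w \<in> W'" if "w \<in> W'" for c w
    using that W_smult[OF F.one_closed, of w c] by (simp add: W'_def Fa_one)
  have W'_Fa: "Fa x w \<in> W'" if "x \<in> carrier (Fn n)" "w \<in> W'" for x w
    using that W_smult[of x w 1] by (simp add: W'_def S_one)
  note W' = W'T W'_zero W'_add W'_S W'_Fa
  have "submodule (core W') R Vr" using core_submodule[OF W'] by blast
  from irr[OF this] show ?thesis
  proof
    assume "core W' = {\<zero>\<^bsub>V\<^esub>}"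
    then have "W' \<subseteq> N" using W_subset_N_if_core_zero[OF W'] by blast
    then have "W \<subseteq> {N}" using W_sub kN by (auto simp: W'_def)
    moreover have "N \<in> W" using W'_zero zero by (simp add: W'_def)
    ultimately show ?thesis by blast
  next
    assume "core W' = carrier V"
    then have "W' = carrier T" using W_full_if_core_full[OF W'] by blast
    then have "?k ` carrier T \<subseteq> W" by (auto simp: W'_def)
    with W_sub show ?thesis unfolding L.quotient_carrier L_simps(1) by blast
  qed
qed

end

theorem theorem0p3:
  fixes n :: nat
    and G :: "('g, 'c) monoid_scheme"
    and \<alpha> :: "'g \<Rightarrow> nat gword \<Rightarrow> nat gword"
    and V :: "(nat gword \<times> 'g \<Rightarrow> 'k::field, 'v) module"
    and lam :: 'k
  assumes "n \<ge> 2"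
    and "artin_representation n G \<alpha>"
    and "Fn_irreducible n G \<alpha> V"
    and "lam \<noteq> 0"
  shows "Fn_irreducible n G \<alpha> (KLM n G \<alpha> lam V)"
proof -
  interpret LM_setup n "group_ring (Fn n)" lam G \<alpha> V
    by (intro LM_setup.intro LM_setup_axioms.intro twisted_Fn_ring.intro
        twisted_Fn_ring_axioms.intro Fn_ring.intro refl)
       (use assms in \<open>simp_all add: Fn_irreducible_def\<close>)
  have KLM: "KLM n G \<alpha> lam V = quotient_module L N"
    by (simp add: KLM_def KLM_kernel_eq)
  show ?thesis
    unfolding Fn_irreducible_def KLM
    using L.left_module_quotient[OF N_submodule] quotient_irreducible assms(3)
    by (auto simp: Fn_irreducible_def)
qed

end
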